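(* There is an algorithm that, given a graph $G$ on $n$ vertices, computes the pathwidth of $G$ in time $O^*(3^k)$, where $k$ is the size of a minimum vertex cover of $G$.
   Context: All graphs are finite, simple and undirected. A vertex cover of $G=(V,E)$ is a set $C\subseteq V$ containing at least one endpoint of every edge. A tree decomposition of $G$ is a pair $(T,\{X_i\}_{i\in I})$ with $T$ a tree and $X_i\subseteq V$ (bags) such that every vertex lies in some bag, every edge has both endpoints in some bag, and for each vertex $v$ the nodes whose bags contain $v$ induce a connected subtree of $T$; its width is $\max_i|X_i|-1$. A path decomposition is a tree decomposition whose tree is a path; the pathwidth of $G$ is the minimum width of a path decomposition of $G$. The notation $f(n,k)=O^*(g(n,k))$ means $f(n,k)=O(g(n,k)\cdot n^{O(1)})$. *)

theory Defs
  imports Complex_Main "HOL-Library.Log_Nat"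
begin

definition simple_graph :: "'a set \<Rightarrow> 'a set set \<Rightarrow> bool" where
  "simple_graph V E \<longleftrightarrow> finite V \<and> (\<forall>e\<in>E. e \<subseteq> V \<and> card e = 2)"

definition vertex_cover :: "'a set \<Rightarrow> 'a set set \<Rightarrow> 'a set \<Rightarrow> bool" where
  "vertex_cover V E C \<longleftrightarrow> C \<subseteq> V \<and> (\<forall>e\<in>E. e \<inter> C \<noteq> {})"

definition vertex_cover_number :: "'a set \<Rightarrow> 'a set set \<Rightarrow> nat" where
  "vertex_cover_number V E = (LEAST k. \<exists>C. vertex_cover V E C \<and> card C = k)"

definition induces_connected :: "'a set set \<Rightarrow> 'a set \<Rightarrow> bool" where
  "induces_connected E S \<longleftrightarrow>
     S \<noteq> {} \<and> (\<forall>u\<in>S. \<forall>v\<in>S. (u, v) \<in> {(x, y). x \<in> S \<and> y \<in> S \<and> {x, y} \<in> E}\<^sup>*)"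

definition is_cycle :: "'a set set \<Rightarrow> 'a list \<Rightarrow> bool" where
  "is_cycle E xs \<longleftrightarrow> 3 \<le> length xs \<and> distinct xs \<and>
     (\<forall>i<length xs. {xs ! i, xs ! (Suc i mod length xs)} \<in> E)"

definition is_tree :: "'a set \<Rightarrow> 'a set set \<Rightarrow> bool" where
  "is_tree V E \<longleftrightarrow> simple_graph V E \<and> induces_connected E V \<and> (\<nexists>xs. is_cycle E xs)"

definition is_path_graph :: "'a set \<Rightarrow> 'a set set \<Rightarrow> bool" where
  "is_path_graph V E \<longleftrightarrow> (\<exists>xs. xs \<noteq> [] \<and> distinct xs \<and> set xs = V \<and>
     E = {{xs ! i, xs ! Suc i} | i. Suc i < length xs})"

definition tree_decomposition ::
    "'a set \<Rightarrow> 'a set set \<Rightarrow> 'i set \<Rightarrow> 'i set set \<Rightarrow> ('i \<Rightarrow> 'a set) \<Rightarrow> bool" where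
  "tree_decomposition V E I F X \<longleftrightarrow>
     is_tree I F \<and>
     (\<forall>i\<in>I. X i \<subseteq> V) \<and>
     (\<forall>v\<in>V. \<exists>i\<in>I. v \<in> X i) \<and>
     (\<forall>e\<in>E. \<exists>i\<in>I. e \<subseteq> X i) \<and>
     (\<forall>v\<in>V. induces_connected F {i \<in> I. v \<in> X i})"

definition path_decomposition ::
    "'a set \<Rightarrow> 'a set set \<Rightarrow> 'i set \<Rightarrow> 'i set set \<Rightarrow> ('i \<Rightarrow> 'a set) \<Rightarrow> bool" where
  "path_decomposition V E I F X \<longleftrightarrow> tree_decomposition V E I F X \<and> is_path_graph I F"

text \<open>Integer-valued: the width is \<open>-1\<close> if all bags are empty, as for the graph without vertices.\<close>

definition decomposition_width :: "'i set \<Rightarrow> ('i \<Rightarrow> 'a set) \<Rightarrow> int" where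
  "decomposition_width I X = Max ((\<lambda>i. int (card (X i))) ` I) - 1"

text \<open>Since decomposition trees are finite, it is no restriction to take their nodes in \<^typ>\<open>nat\<close>.\<close>

definition pathwidth :: "'a set \<Rightarrow> 'a set set \<Rightarrow> int" where
  "pathwidth V E = (LEAST w. \<exists>(I :: nat set) F X.
     path_decomposition V E I F X \<and> w = decomposition_width I X)"

text \<open>
  Random access machine with structured control flow. Time is measured by the logarithmic cost criterion: every operation
  is charged the binary lengths of the operands and addresses it touches, so that large
  numbers cannot be used for unaccounted parallelism.
\<close>

type_synonym memory = "int \<Rightarrow> int"

datatype expr = Const int | Load expr | Add expr expr | Sub expr expr

datatype program =
    Skip
  | Store expr expr
  | Seq program program
  | IfPos expr program program
  | WhilePos expr program

fun val :: "expr \<Rightarrow> memory \<Rightarrow> int" where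
  "val (Const a) m = a"
| "val (Load e) m = m (val e m)"
| "val (Add e f) m = val e m + val f m"
| "val (Sub e f) m = val e m - val f m"

text \<open>Binary length of an integer including its sign, hence at least \<open>1\<close>.\<close>

definition len :: "int \<Rightarrow> nat" where
  "len a = 1 + floorlog 2 (nat \<bar>a\<bar>)"

fun expr_cost :: "expr \<Rightarrow> memory \<Rightarrow> nat" where
  "expr_cost (Const a) m = len a"
| "expr_cost (Load e) m = expr_cost e m + len (val e m) + len (m (val e m))"
| "expr_cost (Add e f) m = expr_cost e m + expr_cost f m + len (val e m) + len (val f m)"
| "expr_cost (Sub e f) m = expr_cost e m + expr_cost f m + len (val e m) + len (val f m)"

text \<open>
  \<open>exec p m t m'\<close>: started in memory \<open>m\<close>, the program \<open>p\<close> halts after time \<open>t\<close> in memory \<open>m'\<close>.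
  \<open>Store e f\<close> writes the value of \<open>f\<close> to the cell whose address is the value of \<open>e\<close>;
  the tests of \<open>IfPos\<close> and \<open>WhilePos\<close> succeed on positive values.
\<close>

inductive exec :: "program \<Rightarrow> memory \<Rightarrow> nat \<Rightarrow> memory \<Rightarrow> bool" where
  Skip: "exec Skip m 1 m"
| Store: "exec (Store e f) m
     (expr_cost e m + expr_cost f m + len (val e m) + len (val f m)) (m(val e m := val f m))"
| Seq: "exec p m t m' \<Longrightarrow> exec q m' u m'' \<Longrightarrow> exec (Seq p q) m (t + u) m''"
| IfTrue: "val e m > 0 \<Longrightarrow> exec p m t m' \<Longrightarrow>
     exec (IfPos e p q) m (expr_cost e m + len (val e m) + t) m'"
| IfFalse: "val e m \<le> 0 \<Longrightarrow> exec q m t m' \<Longrightarrow>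
     exec (IfPos e p q) m (expr_cost e m + len (val e m) + t) m'"
| WhileFalse: "val e m \<le> 0 \<Longrightarrow>
     exec (WhilePos e p) m (expr_cost e m + len (val e m)) m"
| WhileTrue: "val e m > 0 \<Longrightarrow> exec p m t m' \<Longrightarrow> exec (WhilePos e p) m' u m'' \<Longrightarrow>
     exec (WhilePos e p) m (expr_cost e m + len (val e m) + t + u) m''"

inductive_cases exec_SkipE: "exec Skip m t m'"
inductive_cases exec_StoreE: "exec (Store e f) m t m'"
inductive_cases exec_SeqE: "exec (Seq p q) m t m'"
inductive_cases exec_IfPosE: "exec (IfPos e p q) m t m'"
inductive_cases exec_WhilePosE: "exec (WhilePos e p) m t m'"

lemma exec_deterministic:
  assumes "exec p m t m'" and "exec p m u m''"
  shows "t = u \<and> m' = m''"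
  using assms
proof (induction arbitrary: u m'' rule: exec.induct)
  case Skip
  from Skip.prems show ?case by (rule exec_SkipE) simp
next
  case Store
  from Store.prems show ?case by (rule exec_StoreE) simp
next
  case (Seq p m t m' q v n)
  from Seq.prems obtain t' k v' where "u = t' + v'" "exec p m t' k" "exec q k v' m''"
    by (rule exec_SeqE)
  with Seq.IH show ?case by blast
next
  case (IfTrue e m p t m' q)
  from IfTrue.prems IfTrue.hyps(1) obtain t'
    where "u = expr_cost e m + len (val e m) + t'" "exec p m t' m''"
    by (elim exec_IfPosE) simp_all
  with IfTrue.IH show ?case by blast
next
  case (IfFalse e m q t m' p)
  from IfFalse.prems IfFalse.hyps(1) obtain t'
    where "u = expr_cost e m + len (val e m) + t'" "exec q m t' m''"
    by (elim exec_IfPosE) simp_all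
  with IfFalse.IH show ?case by blast
next
  case (WhileFalse e m p)
  from WhileFalse.prems show ?case
    by (rule exec_WhilePosE) (use WhileFalse.hyps in simp_all)
next
  case (WhileTrue e m p t m' v n)
  from WhileTrue.prems obtain t' k v'
    where "u = expr_cost e m + len (val e m) + t' + v'" "exec p m t' k"
      "exec (WhilePos e p) k v' m''"
    by (rule exec_WhilePosE) (use WhileTrue.hyps(1) in simp_all)
  with WhileTrue.IH show ?case by blast
qed

text \<open>Cell \<open>0\<close> holds \<open>n\<close>; the adjacency matrix follows in row-major order.\<close>

definition graph_input :: "nat \<Rightarrow> nat set set \<Rightarrow> memory" where
  "graph_input n E a =
     (if a = 0 then int n
      else if \<exists>u<n. \<exists>v<n. a = int (1 + u * n + v) \<and> {u, v} \<in> E then 1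
      else 0)"

text \<open>
  \<open>n + 1\<close> instead of \<open>n\<close> only matters for \<open>n = 0\<close>, where \<open>n ^ d\<close> would vanish.
\<close>

definition Ostar :: "(nat \<Rightarrow> nat \<Rightarrow> real) \<Rightarrow> (nat \<Rightarrow> nat \<Rightarrow> real) set" where
  "Ostar g = {f. \<exists>(c :: real) (d :: nat). \<forall>n k. \<bar>f n k\<bar> \<le> c * (\<bar>g n k\<bar> * real (n + 1) ^ d)}"

end

theory Submission
  imports Defs
begin

text \<open>
  Pathwidth equals the vertex separation number: the least \<open>w\<close> such that the vertices can be added one
  at a time with at most \<open>w\<close> added vertices ever having a neighbour that is still missing. Given a vertex
  cover \<open>C\<close>, a set \<open>A\<close> of added vertices is summarised by a status in \<open>{0, 1, 2}\<close> for each \<open>c \<in> C\<close>: absent,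
  present, or present together with all neighbours outside \<open>C\<close>. A status determines a canonical set of
  added vertices, and raising one entry by \<open>1\<close> amounts to adding the missing canonical vertices in a fixed
  order, whose cost can be computed in polynomial time. An exchange argument shows that every ordering can
  be replaced by a sequence of such raises without increasing its cost, so a shortest (bottleneck) path
  computation on \<open>3 ^ card C\<close> states gives the pathwidth. A minimum vertex cover is found by branching on
  uncovered edges, the choices being read from a ternary counter of length \<open>\<kappa> = 0, 1, 2, \<dots>\<close>.

  The algorithm is written in a small language of bounded loops over arrays of natural numbers and
  compiled to the machine. Stored values grow additively, so the number of steps also
  bounds the length of all numbers.
\<close>

section \<open>A language of bounded loops\<close>

text \<open>Every neighbour of a vertex outside \<open>C\<close> lies in \<open>C\<close>. Once all
  of them are present, the vertex can be added without entering the boundary; before that, adding it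
  pays off only if it helps to complete the outside neighbourhood of some vertex of
  \<open>C\<close>, which may then leave the boundary. Canonical sets contain the vertices of these
  two kinds and postpone all others. The order within a raise does not matter, because the exchange
  argument compares each intermediate set directly with two consecutive prefixes of the given
  ordering. Raising digit \<open>z\<close> adds \<open>3 ^ z\<close> to the ternary code of a
  status, so numeric order is a topological order of the transitions and a single sweep suffices.
  The time bound leaves room for one exponential factor only: loops of exponential length are never
  nested, and the cover search does no work beyond the minimum length. The logarithmic cost
  criterion further requires numbers of \<open>O(n)\<close> bits; these are ensured because the
  number of steps is at most exponential in \<open>n\<close> and a step raises the largest stored
  value by at most a constant.\<close>

type_synonym store = "nat \<Rightarrow> nat \<Rightarrow> nat"

datatype aexp = Num nat | Arr nat aexp | Plus aexp aexp

datatype cmd =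
    SKIP
  | Asg nat aexp aexp
  | Sequ cmd cmd (infixr ";;" 60)
  | Less aexp aexp cmd cmd
  | For nat nat cmd

primrec aval :: "aexp \<Rightarrow> store \<Rightarrow> nat" where
  "aval (Num a) s = a"
| "aval (Arr x e) s = s x (aval e s)"
| "aval (Plus e f) s = aval e s + aval f s"

definition upd :: "store \<Rightarrow> nat \<Rightarrow> nat \<Rightarrow> nat \<Rightarrow> store" where
  "upd s x i v = s(x := (s x)(i := v))"

lemma upd_apply: "upd s x i v y = (if y = x then (s x)(i := v) else s y)"
  by (simp add: upd_def)

primrec sem :: "cmd \<Rightarrow> store \<Rightarrow> store" where
  "sem SKIP s = s"
| "sem (Asg x i e) s = upd s x (aval i s) (aval e s)"
| "sem (c ;; d) s = sem d (sem c s)"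
| "sem (Less e f c d) s = (if aval e s < aval f s then sem c s else sem d s)"
| "sem (For x l c) s = ((\<lambda>s. upd (sem c s) x 0 (Suc (sem c s x 0))) ^^ s l 0) (upd s x 0 0)"

text \<open>The state in which the body is run with counter value \<open>i\<close>. Naming it lets
  invariants and step counts refer to intermediate states, of which \<open>sem\<close> shows only
  the last.\<close>

definition iter :: "nat \<Rightarrow> cmd \<Rightarrow> store \<Rightarrow> nat \<Rightarrow> store" where
  "iter x c s i = ((\<lambda>s. upd (sem c s) x 0 (Suc (sem c s x 0))) ^^ i) (upd s x 0 0)"

primrec steps :: "cmd \<Rightarrow> store \<Rightarrow> nat" where
  "steps SKIP s = 1"
| "steps (Asg x i e) s = 1"
| "steps (c ;; d) s = steps c s + steps d (sem c s)"
| "steps (Less e f c d) s = 1 + (if aval e s < aval f s then steps c s else steps d s)"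
| "steps (For x l c) s = 2 + (\<Sum>i<s l 0. steps c (iter x c s i) + 2)"

primrec writes :: "cmd \<Rightarrow> nat set" where
  "writes SKIP = {}"
| "writes (Asg x i e) = {x}"
| "writes (c ;; d) = writes c \<union> writes d"
| "writes (Less e f c d) = writes c \<union> writes d"
| "writes (For x l c) = insert x (writes c)"

primrec limits :: "cmd \<Rightarrow> nat set" where
  "limits SKIP = {}"
| "limits (Asg x i e) = {}"
| "limits (c ;; d) = limits c \<union> limits d"
| "limits (Less e f c d) = limits c \<union> limits d"
| "limits (For x l c) = insert l (limits c)"

lemma iter_0 [simp]: "iter x c s 0 = upd s x 0 0"
  and iter_Suc: "iter x c s (Suc i) = upd (sem c (iter x c s i)) x 0 (Suc (sem c (iter x c s i) x 0))"
  by (simp_all add: iter_def)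

lemma sem_For: "sem (For x l c) s = iter x c s (s l 0)"
  by (simp add: iter_def)

lemma sem_unwritten: "y \<notin> writes c \<Longrightarrow> sem c s y = s y"
proof (induction c arbitrary: s)
  case (For x l c)
  have "iter x c s i y = s y" for i
    by (induction i) (use For in \<open>auto simp: iter_Suc upd_apply\<close>)
  then show ?case by (metis sem_For)
qed (auto simp: upd_apply)

lemma iter_unwritten: "y \<notin> writes c \<Longrightarrow> y \<noteq> x \<Longrightarrow> iter x c s i y = s y"
  by (induction i) (auto simp: iter_Suc upd_apply sem_unwritten)

lemma iter_counter: "x \<notin> writes c \<Longrightarrow> iter x c s i x 0 = i"
  by (induction i) (auto simp: iter_Suc upd_apply sem_unwritten)

text \<open>The step premise may assume that arrays not written by the body still agree with the
  initial state. Invariants in later proofs therefore mention only what changes.\<close>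

lemma iter_invariant:
  assumes "x \<notin> writes c" and "I 0 (upd s x 0 0)"
    and "\<And>i s'. i < N \<Longrightarrow> I i s' \<Longrightarrow> s' x 0 = i \<Longrightarrow> (\<And>y. y \<notin> writes c \<Longrightarrow> y \<noteq> x \<Longrightarrow> s' y = s y) \<Longrightarrow>
      I (Suc i) (upd (sem c s') x 0 (Suc i))"
    and "i \<le> N"
  shows "I i (iter x c s i)"
  using \<open>i \<le> N\<close>
proof (induction i)
  case 0
  show ?case using assms(2) by simp
next
  case (Suc i)
  have "I (Suc i) (upd (sem c (iter x c s i)) x 0 (Suc i))"
    by (rule assms(3)) (use Suc assms(1) iter_unwritten iter_counter in auto)
  with assms(1) show ?case by (simp add: iter_Suc sem_unwritten iter_counter)
qed

lemma For_invariant: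
  assumes "x \<notin> writes c" and "I 0 (upd s x 0 0)"
    and "\<And>i s'. i < s l 0 \<Longrightarrow> I i s' \<Longrightarrow> s' x 0 = i \<Longrightarrow> (\<And>y. y \<notin> writes c \<Longrightarrow> y \<noteq> x \<Longrightarrow> s' y = s y) \<Longrightarrow>
      I (Suc i) (upd (sem c s') x 0 (Suc i))"
  shows "I (s l 0) (sem (For x l c) s)"
  unfolding sem_For by (rule iter_invariant[where N = "s l 0"]) (use assms in auto)

section \<open>Step counts in terms of loop nesting\<close>

primrec csize :: "cmd \<Rightarrow> nat" where
  "csize SKIP = 1"
| "csize (Asg x i e) = 1"
| "csize (c ;; d) = csize c + csize d"
| "csize (Less e f c d) = 1 + csize c + csize d"
| "csize (For x l c) = csize c + 4"

text \<open>Loops with a limit in \<open>X\<close> are counted separately: their limit will be exponential.\<close>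

primrec depth :: "nat set \<Rightarrow> cmd \<Rightarrow> nat" where
  "depth X SKIP = 0"
| "depth X (Asg x i e) = 0"
| "depth X (c ;; d) = max (depth X c) (depth X d)"
| "depth X (Less e f c d) = max (depth X c) (depth X d)"
| "depth X (For x l c) = (if l \<in> X then Suc (depth X c) else depth X c)"

lemma steps_For_le:
  assumes "\<And>i. i < s l 0 \<Longrightarrow> steps c (iter x c s i) \<le> t"
  shows "steps (For x l c) s \<le> 2 + s l 0 * (t + 2)"
proof -
  have "(\<Sum>i<s l 0. steps c (iter x c s i) + 2) \<le> (\<Sum>i<s l 0. t + 2)"
    by (rule sum_mono) (use assms in auto)
  then show ?thesis by simp
qed

text \<open>Sequencing and branching take the maximum of the exponents and only nesting adds to
  them, so exponential loops one after another still cost a single factor \<open>Q\<close>. Limits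
  must not be written by \<open>c\<close>, because their bounds are assumed in the initial state and
  have to survive until each loop starts.\<close>

lemma steps_le:
  assumes "limits c \<inter> writes c = {}" and "1 \<le> R" "1 \<le> Q"
    and "\<And>l. l \<in> limits c \<Longrightarrow> s l 0 \<le> (if l \<in> X then Q else R)"
  shows "steps c s \<le> csize c * (R ^ depth (- X) c * Q ^ depth X c)"
  using assms(1,4)
proof (induction c arbitrary: s)
  case (Sequ c d)
  let ?B = "R ^ max (depth (- X) c) (depth (- X) d) * Q ^ max (depth X c) (depth X d)"
  have "steps c s \<le> csize c * (R ^ depth (- X) c * Q ^ depth X c)" using Sequ by auto
  also have "\<dots> \<le> csize c * ?B"
    using assms(2,3) by (intro mult_left_mono mult_mono power_increasing) auto
  finally have 1: "steps c s \<le> csize c * ?B" .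
  have "steps d (sem c s) \<le> csize d * (R ^ depth (- X) d * Q ^ depth X d)"
  proof (rule Sequ.IH(2))
    show "limits d \<inter> writes d = {}" using Sequ.prems by auto
    fix l assume l: "l \<in> limits d"
    then have "l \<notin> writes c" using Sequ.prems(1) by auto
    then show "sem c s l 0 \<le> (if l \<in> X then Q else R)"
      using l Sequ.prems(2)[of l] by (simp add: sem_unwritten)
  qed
  also have "\<dots> \<le> csize d * ?B"
    using assms(2,3) by (intro mult_left_mono mult_mono power_increasing) auto
  finally show ?case using 1 by (simp add: distrib_right)
next
  case (Less e f c d)
  let ?B = "R ^ max (depth (- X) c) (depth (- X) d) * Q ^ max (depth X c) (depth X d)"
  have c: "steps c s \<le> csize c * (R ^ depth (- X) c * Q ^ depth X c)"
    and d: "steps d s \<le> csize d * (R ^ depth (- X) d * Q ^ depth X d)"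
    using Less.IH[of s] Less.prems by auto
  have "csize c * (R ^ depth (- X) c * Q ^ depth X c) \<le> csize c * ?B"
    "csize d * (R ^ depth (- X) d * Q ^ depth X d) \<le> csize d * ?B"
    using assms(2,3) by (intro mult_left_mono mult_mono power_increasing; simp)+
  with c d have "steps c s \<le> csize c * ?B" "steps d s \<le> csize d * ?B" by linarith+
  moreover have "1 * 1 \<le> ?B" using assms(2,3) by (intro mult_le_mono) simp_all
  ultimately have "steps (Less e f c d) s \<le> ?B + (csize c * ?B + csize d * ?B)"
    by (cases "aval e s < aval f s"; simp only: steps.simps if_True if_False; linarith)
  then show ?case by (simp add: distrib_right)
next
  case (For x l c)
  let ?B = "R ^ depth (- X) c * Q ^ depth X c" and ?l = "if l \<in> X then Q else R"
  have "steps c (iter x c s i) \<le> csize c * ?B" for i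
  proof (rule For.IH)
    show "limits c \<inter> writes c = {}" using For.prems by auto
    fix l' assume l': "l' \<in> limits c"
    then have "l' \<notin> writes c" "l' \<noteq> x" using For.prems by auto
    then show "iter x c s i l' 0 \<le> (if l' \<in> X then Q else R)"
      using For.prems(2)[of l'] l' by (simp add: iter_unwritten)
  qed
  then have "steps (For x l c) s \<le> 2 + s l 0 * (csize c * ?B + 2)"
    by (rule steps_For_le)
  also have "\<dots> \<le> 2 + ?l * (csize c * ?B + 2)"
    using For.prems(2)[of l] by (intro add_left_mono mult_right_mono) auto
  \<comment> \<open>Setup and bookkeeping cost \<open>2 + 2 * ?l\<close>, which is at most
    \<open>4 * ?l\<close> since \<open>?l\<close> is at least 1; this is the 4 in
    \<open>csize\<close>.\<close>
  also have "\<dots> \<le> (csize c + 4) * (?l * ?B)"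
  proof -
    have l: "1 \<le> ?l" using assms(2,3) by simp
    have "1 * 1 \<le> ?B" using assms(2,3) by (intro mult_le_mono) simp_all
    then have "?l * 1 \<le> ?l * ?B" by (intro mult_le_mono) simp_all
    then have "2 + 2 * ?l + csize c * (?l * ?B) \<le> (csize c + 4) * (?l * ?B)"
      using l unfolding distrib_right by linarith
    then show ?thesis by (simp add: algebra_simps)
  qed
  also have "?l * ?B = R ^ depth (- X) (For x l c) * Q ^ depth X (For x l c)" by simp
  finally show ?case by simp
qed simp_all

section \<open>Compilation to the machine\<close>

text \<open>Array \<open>0\<close> is the input area; the arrays \<open>1, \<dots>, 32\<close> are interleaved on the negative addresses.
  The machine cannot multiply, so \<open>cell\<close> forms \<open>32 * i\<close> by five doublings.\<close>

definition address :: "nat \<Rightarrow> nat \<Rightarrow> int" where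
  "address x i = (if x = 0 then int i else - int (32 * i + x))"

lemma address_eq_iff:
  assumes "x \<le> 32" "y \<le> 32"
  shows "address x i = address y j \<longleftrightarrow> x = y \<and> i = j"
proof
  assume eq: "address x i = address y j"
  show "x = y \<and> i = j"
  proof (cases "x = 0 \<or> y = 0")
    case True
    then show ?thesis using eq by (auto simp: address_def split: if_splits)
  next
    case False
    then have "32 * i + x = 32 * j + y" "0 < x" "0 < y" using eq by (auto simp: address_def)
    moreover from this have "\<not> i < j" "\<not> j < i" using assms by linarith+
    ultimately show ?thesis by simp
  qed
qed simp

definition cell :: "nat \<Rightarrow> expr \<Rightarrow> expr" where
  "cell x e = (if x = 0 then e
     else let double = (\<lambda>e. Add e e)
       in Sub (Const (- int x)) (double (double (double (double (double e))))))"

lemma val_cell: "val e m = int i \<Longrightarrow> val (cell x e) m = address x i"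
  by (simp add: cell_def address_def Let_def)

primrec comp_aexp :: "aexp \<Rightarrow> expr" where
  "comp_aexp (Num a) = Const (int a)"
| "comp_aexp (Arr x e) = Load (cell x (comp_aexp e))"
| "comp_aexp (Plus e f) = Add (comp_aexp e) (comp_aexp f)"

primrec compile :: "cmd \<Rightarrow> program" where
  "compile SKIP = Skip"
| "compile (Asg x i e) = Store (cell x (comp_aexp i)) (comp_aexp e)"
| "compile (c ;; d) = Seq (compile c) (compile d)"
| "compile (Less e f c d) = IfPos (Sub (comp_aexp f) (comp_aexp e)) (compile c) (compile d)"
| "compile (For x l c) = Seq (Store (cell x (Const 0)) (Const 0))
     (WhilePos (Sub (Load (cell l (Const 0))) (Load (cell x (Const 0))))
       (Seq (compile c) (Store (cell x (Const 0)) (Add (Load (cell x (Const 0))) (Const 1)))))"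

definition represents :: "memory \<Rightarrow> store \<Rightarrow> bool" where
  "represents m s \<longleftrightarrow> (\<forall>x\<le>32. \<forall>i. m (address x i) = int (s x i))"

primrec arrays :: "aexp \<Rightarrow> nat set" where
  "arrays (Num a) = {}"
| "arrays (Arr x e) = insert x (arrays e)"
| "arrays (Plus e f) = arrays e \<union> arrays f"

text \<open>Only constants and single cells plus a constant may be stored, so that stored values
  grow at most linearly with the number of steps.\<close>

fun storable :: "aexp \<Rightarrow> bool" where
  "storable (Num a) = True"
| "storable (Arr x e) = True"
| "storable (Plus (Arr x e) (Num a)) = True"
| "storable _ = False"

fun growth :: "aexp \<Rightarrow> nat" where
  "growth (Num a) = a"
| "growth (Plus e (Num a)) = a"
| "growth _ = 0"

text \<open>A compiled loop compares \<open>l\<close> and \<open>x\<close> again before every round,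
  whereas \<open>sem\<close> fixes the number of rounds beforehand. The two agree because the body
  writes neither of them.\<close>

primrec well_formed :: "cmd \<Rightarrow> bool" where
  "well_formed SKIP \<longleftrightarrow> True"
| "well_formed (Asg x i e) \<longleftrightarrow> x \<le> 32 \<and> arrays i \<subseteq> {..32} \<and> arrays e \<subseteq> {..32} \<and> storable e"
| "well_formed (c ;; d) \<longleftrightarrow> well_formed c \<and> well_formed d"
| "well_formed (Less e f c d) \<longleftrightarrow>
     arrays e \<subseteq> {..32} \<and> arrays f \<subseteq> {..32} \<and> well_formed c \<and> well_formed d"
| "well_formed (For x l c) \<longleftrightarrow>
     x \<le> 32 \<and> l \<le> 32 \<and> x \<noteq> l \<and> x \<notin> writes c \<and> l \<notin> writes c \<and> well_formed c"

primrec cgrowth :: "cmd \<Rightarrow> nat" where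
  "cgrowth SKIP = 0"
| "cgrowth (Asg x i e) = growth e"
| "cgrowth (c ;; d) = cgrowth c + cgrowth d"
| "cgrowth (Less e f c d) = cgrowth c + cgrowth d"
| "cgrowth (For x l c) = cgrowth c + 1"

text \<open>If all cells are at most \<open>M\<close> in absolute value, so is any loaded value,
  hence the 1 for \<open>Load\<close> whatever the address. \<open>magnitude\<close> is the
  coefficient of \<open>M + 1\<close> in the bound on the value of an expression,
  \<open>weight\<close> that of \<open>wordlen M\<close> in the bound on its cost.\<close>

fun magnitude :: "expr \<Rightarrow> nat" where
  "magnitude (Const a) = nat \<bar>a\<bar>"
| "magnitude (Load e) = 1"
| "magnitude (Add e f) = magnitude e + magnitude f"
| "magnitude (Sub e f) = magnitude e + magnitude f"

fun weight :: "expr \<Rightarrow> nat" where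
  "weight (Const a) = magnitude (Const a) + 1"
| "weight (Load e) = weight e + (magnitude e + 1) + 2"
| "weight (Add e f) = weight e + weight f + (magnitude e + 1) + (magnitude f + 1)"
| "weight (Sub e f) = weight e + weight f + (magnitude e + 1) + (magnitude f + 1)"

definition wordlen :: "nat \<Rightarrow> nat" where
  "wordlen M = floorlog 2 (M + 1) + 1"

lemma wordlen_pos: "1 \<le> wordlen M"
  by (simp add: wordlen_def)

lemma floorlog_le: "n < 2 ^ w \<Longrightarrow> floorlog 2 n \<le> w"
  using floorlog_leI by fastforce

lemma less_two_power_floorlog: "n < 2 ^ floorlog 2 n"
  using floorlog_bounds[of n 2] by (cases "n = 0") (auto simp: floorlog_def)

text \<open>A factor \<open>b\<close> adds at most \<open>b\<close> bits, as
  \<open>b \<le> 2 ^ b\<close>. This is coarse, but in the applications \<open>b\<close> depends on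
  the program alone.\<close>

lemma len_le:
  assumes "\<bar>a\<bar> \<le> int (b * (M + 1))"
  shows "len a \<le> (b + 1) * wordlen M"
proof -
  have "nat \<bar>a\<bar> \<le> b * (M + 1)" using assms by linarith
  also have "\<dots> \<le> 2 ^ b * (M + 1)" by (intro mult_right_mono) (simp_all add: less_imp_le)
  also have "\<dots> < 2 ^ b * 2 ^ floorlog 2 (M + 1)"
    using less_two_power_floorlog by (intro mult_strict_left_mono) auto
  finally have "nat \<bar>a\<bar> < 2 ^ (b + floorlog 2 (M + 1))" by (simp add: power_add)
  then have "len a \<le> b + wordlen M" by (simp add: len_def wordlen_def floorlog_le)
  also have "\<dots> \<le> b * wordlen M + wordlen M" using wordlen_pos[of M] by simp
  finally show ?thesis by simp
qed

definition bounded :: "memory \<Rightarrow> nat \<Rightarrow> bool" where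
  "bounded m M \<longleftrightarrow> (\<forall>a. \<bar>m a\<bar> \<le> int M)"

lemma bounded_mono: "bounded m M \<Longrightarrow> M \<le> N \<Longrightarrow> bounded m N"
  unfolding bounded_def by (meson of_nat_mono order_trans)

lemma abs_val_le: "bounded m M \<Longrightarrow> \<bar>val e m\<bar> \<le> int (magnitude e * (M + 1))"
proof (induction e)
  case (Const a)
  have "\<bar>a\<bar> * 1 \<le> \<bar>a\<bar> * (int M + 1)" by (intro mult_left_mono) auto
  then show ?case by simp
next
  case (Load e)
  then have "\<bar>m (val e m)\<bar> \<le> int M" by (auto simp: bounded_def)
  then show ?case by simp
next
  case (Add e f)
  have "\<bar>val e m + val f m\<bar> \<le> \<bar>val e m\<bar> + \<bar>val f m\<bar>" by (rule abs_triangle_ineq)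
  also have "\<dots> \<le> int (magnitude e * (M + 1)) + int (magnitude f * (M + 1))"
    using Add by (intro add_mono) auto
  finally show ?case by (simp only: val.simps magnitude.simps distrib_right of_nat_add)
next
  case (Sub e f)
  have "\<bar>val e m - val f m\<bar> \<le> \<bar>val e m\<bar> + \<bar>val f m\<bar>" by (rule abs_triangle_ineq4)
  also have "\<dots> \<le> int (magnitude e * (M + 1)) + int (magnitude f * (M + 1))"
    using Sub by (intro add_mono) auto
  finally show ?case by (simp only: val.simps magnitude.simps distrib_right of_nat_add)
qed

lemma len_val_le: "bounded m M \<Longrightarrow> len (val e m) \<le> (magnitude e + 1) * wordlen M"
  by (rule len_le[OF abs_val_le])

lemma expr_cost_le: "bounded m M \<Longrightarrow> expr_cost e m \<le> weight e * wordlen M"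
proof (induction e)
  case (Const a)
  then show ?case using len_val_le[of m M "Const a"] by simp
next
  case (Load e)
  have "\<bar>m (val e m)\<bar> \<le> int (1 * (M + 1))" using Load.prems by (auto simp: bounded_def intro: order_trans)
  from len_le[OF this] Load len_val_le[of m M e] show ?case by (simp add: algebra_simps)
next
  case (Add e f)
  then show ?case using len_val_le[of m M e] len_val_le[of m M f] by (simp add: algebra_simps)
next
  case (Sub e f)
  then show ?case using len_val_le[of m M e] len_val_le[of m M f] by (simp add: algebra_simps)
qed

definition weight1 :: "expr \<Rightarrow> nat" where
  "weight1 e = weight e + magnitude e + 1"

lemma weight1_le: "bounded m M \<Longrightarrow> expr_cost e m + len (val e m) \<le> weight1 e * wordlen M"
  using expr_cost_le[of m M e] len_val_le[of m M e] by (simp add: weight1_def algebra_simps)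

fun pweight :: "program \<Rightarrow> nat" where
  "pweight Skip = 1"
| "pweight (Store e f) = weight1 e + weight1 f"
| "pweight (Seq p q) = pweight p + pweight q"
| "pweight (IfPos e p q) = weight1 e + pweight p + pweight q"
| "pweight (WhilePos e p) = weight1 e + pweight p"

lemma exec_Store:
  assumes "bounded m M"
  obtains t where "exec (Store e f) m t (m(val e m := val f m))"
    "t \<le> pweight (Store e f) * wordlen M"
proof
  show "exec (Store e f) m (expr_cost e m + expr_cost f m + len (val e m) + len (val f m))
    (m(val e m := val f m))" by (rule exec.Store)
  show "expr_cost e m + expr_cost f m + len (val e m) + len (val f m) \<le>
    pweight (Store e f) * wordlen M"
    using weight1_le[OF assms, of e] weight1_le[OF assms, of f] by (simp add: algebra_simps)
qed

lemma val_comp_aexp: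
  "represents m s \<Longrightarrow> arrays e \<subseteq> {..32} \<Longrightarrow> val (comp_aexp e) m = int (aval e s)"
  by (induction e) (auto simp: val_cell represents_def)

lemma represents_upd:
  assumes "represents m s" "x \<le> 32"
  shows "represents (m(address x i := int v)) (upd s x i v)"
  using assms by (auto simp: represents_def upd_def address_eq_iff)

lemma bounded_upd: "bounded m M \<Longrightarrow> v \<le> M \<Longrightarrow> bounded (m(a := int v)) M"
  by (simp add: bounded_def)

lemma store_le:
  assumes "represents m s" "bounded m M" "x \<le> 32"
  shows "s x i \<le> M"
proof -
  have "\<bar>m (address x i)\<bar> \<le> int M" "m (address x i) = int (s x i)"
    using assms unfolding bounded_def represents_def by blast+
  then show ?thesis by simp
qed

lemma aval_storable_le:
  assumes "storable e" "represents m s" "bounded m M" "arrays e \<subseteq> {..32}"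
  shows "aval e s \<le> M + growth e"
  using assms(1,4) by (induction e rule: storable.induct) (auto simp: store_le[OF assms(2,3)])

text \<open>\<open>M\<close> bounds the cells at the start and grows along the induction, while
  \<open>B\<close> is one bound for the whole run. Every machine operation can thus be charged the
  same length \<open>wordlen B\<close>, so that the time is a multiple of the number of
  steps.\<close>

theorem compile_correct:
  assumes "well_formed c" "represents m s" "bounded m M" "M + cgrowth c * steps c s \<le> B"
  shows "\<exists>t m'. exec (compile c) m t m' \<and> represents m' (sem c s) \<and>
    bounded m' (M + cgrowth c * steps c s) \<and> t \<le> steps c s * (pweight (compile c) * wordlen B)"
  using assms
proof (induction c arbitrary: m s M)
  case SKIP
  have "1 \<le> wordlen B" by (rule wordlen_pos)
  moreover have "exec Skip m 1 m" by (rule exec.Skip)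
  ultimately show ?case using SKIP by (intro exI[of _ 1] exI[of _ m]) auto
next
  case (Asg x i e)
  have B: "bounded m B" by (rule bounded_mono[OF Asg.prems(3)]) (use Asg.prems(4) in simp)
  obtain t where t: "exec (Store (cell x (comp_aexp i)) (comp_aexp e)) m t
      (m(val (cell x (comp_aexp i)) m := val (comp_aexp e) m))"
      "t \<le> pweight (Store (cell x (comp_aexp i)) (comp_aexp e)) * wordlen B"
    using exec_Store[OF B] by blast
  have "val (cell x (comp_aexp i)) m = address x (aval i s)" "val (comp_aexp e) m = int (aval e s)"
    using Asg.prems by (auto simp: val_cell val_comp_aexp)
  moreover have "represents (m(address x (aval i s) := int (aval e s))) (sem (Asg x i e) s)"
    using Asg.prems by (simp add: represents_upd)
  moreover have "bounded (m(address x (aval i s) := int (aval e s))) (M + growth e)"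
    by (rule bounded_upd)
      (use Asg.prems aval_storable_le bounded_mono in \<open>auto intro: bounded_mono[OF Asg.prems(3)]\<close>)
  ultimately show ?case using t by auto
next
  case (Sequ c d)
  let ?M = "M + cgrowth c * steps c s"
  have 0: "?M + cgrowth d * steps d (sem c s) \<le> M + cgrowth (c ;; d) * steps (c ;; d) s"
    by (simp add: algebra_simps)
  obtain t m1 where 1: "exec (compile c) m t m1" "represents m1 (sem c s)" "bounded m1 ?M"
    "t \<le> steps c s * (pweight (compile c) * wordlen B)"
    using Sequ.IH(1)[of m s M] Sequ.prems 0 by auto
  obtain u m2 where 2: "exec (compile d) m1 u m2" "represents m2 (sem d (sem c s))"
    "bounded m2 (?M + cgrowth d * steps d (sem c s))"
    "u \<le> steps d (sem c s) * (pweight (compile d) * wordlen B)"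
    using Sequ.IH(2)[of m1 "sem c s" ?M] 1 Sequ.prems 0 by auto
  have "exec (compile (c ;; d)) m (t + u) m2" using 1 2 by (auto intro: exec.Seq)
  moreover have "t + u \<le> steps (c ;; d) s * (pweight (compile (c ;; d)) * wordlen B)"
    using 1(4) 2(4) by (simp add: algebra_simps)
  moreover have "bounded m2 (M + cgrowth (c ;; d) * steps (c ;; d) s)"
    using bounded_mono[OF 2(3) 0] .
  ultimately show ?case using 2(2) by auto
next
  case (Less e f c d)
  let ?g = "Sub (comp_aexp f) (comp_aexp e)"
  have B: "bounded m B" by (rule bounded_mono[OF Less.prems(3)]) (use Less.prems(4) in simp)
  have v: "val ?g m = int (aval f s) - int (aval e s)"
    using Less.prems by (simp add: val_comp_aexp)
  have w: "expr_cost ?g m + len (val ?g m) \<le> weight1 ?g * wordlen B"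
    by (rule weight1_le[OF B])
  show ?case
  proof (cases "aval e s < aval f s")
    case True
    have 0: "M + cgrowth c * steps c s \<le> M + cgrowth (Less e f c d) * steps (Less e f c d) s"
      using True by (simp add: algebra_simps)
    obtain t m1 where 1: "exec (compile c) m t m1" "represents m1 (sem c s)"
      "bounded m1 (M + cgrowth c * steps c s)"
      "t \<le> steps c s * (pweight (compile c) * wordlen B)"
      using Less.IH(1)[of m s M] Less.prems 0 by auto
    have "exec (IfPos ?g (compile c) (compile d)) m (expr_cost ?g m + len (val ?g m) + t) m1"
      by (rule exec.IfTrue) (use 1 v True in simp_all)
    then have "exec (compile (Less e f c d)) m (expr_cost ?g m + len (val ?g m) + t) m1"
      by (simp only: compile.simps)
    moreover have "expr_cost ?g m + len (val ?g m) + t \<le>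
        steps (Less e f c d) s * (pweight (compile (Less e f c d)) * wordlen B)"
      using 1(4) w True by (simp add: algebra_simps del: expr_cost.simps val.simps)
    ultimately show ?thesis using 1(2) bounded_mono[OF 1(3) 0] True by auto
  next
    case False
    have 0: "M + cgrowth d * steps d s \<le> M + cgrowth (Less e f c d) * steps (Less e f c d) s"
      using False by (simp add: algebra_simps)
    obtain t m1 where 1: "exec (compile d) m t m1" "represents m1 (sem d s)"
      "bounded m1 (M + cgrowth d * steps d s)"
      "t \<le> steps d s * (pweight (compile d) * wordlen B)"
      using Less.IH(2)[of m s M] Less.prems 0 by auto
    have "exec (IfPos ?g (compile c) (compile d)) m (expr_cost ?g m + len (val ?g m) + t) m1"
      by (rule exec.IfFalse) (use 1 v False in simp_all)
    then have "exec (compile (Less e f c d)) m (expr_cost ?g m + len (val ?g m) + t) m1"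
      by (simp only: compile.simps)
    moreover have "expr_cost ?g m + len (val ?g m) + t \<le>
        steps (Less e f c d) s * (pweight (compile (Less e f c d)) * wordlen B)"
      using 1(4) w False by (simp add: algebra_simps del: expr_cost.simps val.simps)
    ultimately show ?thesis using 1(2) bounded_mono[OF 1(3) 0] False by auto
  qed
next
  case (For x l c)
  let ?X = "cell x (Const 0)" and ?L = "cell l (Const 0)"
  let ?g = "Sub (Load ?L) (Load ?X)" and ?i = "Store ?X (Add (Load ?X) (Const 1))"
  let ?w = "WhilePos ?g (Seq (compile c) ?i)"
  let ?N = "s l 0"
  let ?G = "cgrowth c + 1"
  define S where "S j = (\<Sum>i<j. steps c (iter x c s i) + 2)" for j
  have S_Suc: "S (Suc j) = S j + steps c (iter x c s j) + 2" for j by (simp add: S_def)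
  have S_mono: "j \<le> ?N \<Longrightarrow> S j \<le> S ?N" for j
    unfolding S_def by (rule sum_mono2) auto
  have stp: "steps (For x l c) s = 2 + S ?N" by (simp add: S_def)
  have wf: "x \<le> 32" "l \<le> 32" "x \<noteq> l" "x \<notin> writes c" "l \<notin> writes c" "well_formed c"
    using For.prems(1) by auto
  have lim: "iter x c s j l 0 = ?N" for j using wf by (simp add: iter_unwritten)
  have MB: "M + ?G * (2 + S ?N) \<le> B" using For.prems(4) stp by simp
  \<comment> \<open>Induction on the number of remaining rounds. The term with \<open>S j\<close>
    stands for the budget of the earlier rounds, so the right-hand side is the same for all
    \<open>j\<close>; the extra 1 pays for the final test.\<close>
  have loop: "\<exists>t m'. exec ?w m0 t m' \<and> represents m' (iter x c s ?N) \<and>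
      bounded m' (M + ?G * S ?N) \<and>
      t + S j * (pweight ?w * wordlen B) \<le> (S ?N + 1) * (pweight ?w * wordlen B)"
    if "j \<le> ?N" "represents m0 (iter x c s j)" "bounded m0 (M + ?G * S j)" for j m0
    using that
  proof (induction "?N - j" arbitrary: j m0)
    case 0
    then have j: "j = ?N" by simp
    have B: "bounded m0 B" by (rule bounded_mono[OF "0.prems"(3)]) (use MB S_mono j in simp)
    have "val ?g m0 = 0"
      using "0.prems"(2) wf lim j
      by (simp add: val_cell[of "Const 0" _ 0, simplified] represents_def iter_counter)
    then have "exec ?w m0 (expr_cost ?g m0 + len (val ?g m0)) m0" by (intro exec.WhileFalse) simp
    moreover have "expr_cost ?g m0 + len (val ?g m0) \<le> weight1 ?g * wordlen B"
      by (rule weight1_le[OF B])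
    ultimately show ?case using 0 j
      by (intro exI[of _ "expr_cost ?g m0 + len (val ?g m0)"] exI[of _ m0])
        (simp add: algebra_simps del: expr_cost.simps val.simps)
  next
    case (Suc r)
    then have j: "j < ?N" by simp
    let ?s = "iter x c s j"
    have MB': "M + ?G * S (Suc j) \<le> B" 
    proof -
      have "?G * S (Suc j) \<le> ?G * (2 + S ?N)" 
        using S_mono[of "Suc j"] j by (intro mult_left_mono) auto
      then show ?thesis using MB by linarith
    qed
    have inc: "M + ?G * S j + cgrowth c * steps c ?s + 1 \<le> M + ?G * S (Suc j)"
      by (simp add: S_Suc algebra_simps)
    have B: "bounded m0 B" by (rule bounded_mono[OF Suc.prems(3)]) (use MB' inc in linarith)
    have g: "val ?g m0 > 0"
      using Suc.prems(2) wf lim j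
      by (simp add: val_cell[of "Const 0" _ 0, simplified] represents_def iter_counter)
    have w: "expr_cost ?g m0 + len (val ?g m0) \<le> weight1 ?g * wordlen B"
      by (rule weight1_le[OF B])
    obtain t m1 where 1: "exec (compile c) m0 t m1" "represents m1 (sem c ?s)"
      "bounded m1 (M + ?G * S j + cgrowth c * steps c ?s)"
      "t \<le> steps c ?s * (pweight (compile c) * wordlen B)"
      using For.IH[of m0 ?s "M + ?G * S j"] wf Suc.prems MB' inc by auto
    have B1: "bounded m1 B" by (rule bounded_mono[OF 1(3)]) (use MB' inc in linarith)
    let ?m2 = "m1(val ?X m1 := val (Add (Load ?X) (Const 1)) m1)"
    obtain u where u: "exec ?i m1 u ?m2" "u \<le> pweight ?i * wordlen B"
      using exec_Store[OF B1] by blast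
    have vX: "val ?X m1 = address x 0" by (simp add: val_cell)
    have xj: "sem c ?s x 0 = j" using wf by (simp add: sem_unwritten iter_counter)
    have m2: "?m2 = m1(address x 0 := int (Suc j))"
      using 1(2) wf xj vX by (simp add: represents_def add.commute)
    have r2: "represents ?m2 (iter x c s (Suc j))"
      unfolding m2 iter_Suc xj by (rule represents_upd) (use 1 wf in auto)
    \<comment> \<open>The counter is itself a stored cell, so its increment exceeds the current
      bound by at most 1; this is the \<open>+ 1\<close> in \<open>cgrowth\<close> of a
      loop.\<close>
    have "j \<le> M + ?G * S j + cgrowth c * steps c ?s"
      using store_le[OF 1(2,3) wf(1), of 0] xj by simp
    then have "bounded ?m2 (M + ?G * S j + cgrowth c * steps c ?s + 1)"
      unfolding m2 by (intro bounded_upd bounded_mono[OF 1(3)]) auto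
    then have b2: "bounded ?m2 (M + ?G * S (Suc j))" using inc by (rule bounded_mono)
    have r: "r = ?N - Suc j" "Suc j \<le> ?N" using Suc.hyps(2) j by simp_all
    obtain v m3 where 3: "exec ?w ?m2 v m3" "represents m3 (iter x c s ?N)"
      "bounded m3 (M + ?G * S ?N)"
      "v + S (Suc j) * (pweight ?w * wordlen B) \<le> (S ?N + 1) * (pweight ?w * wordlen B)"
      using Suc.hyps(1)[OF r r2 b2] by blast
    have "exec ?w m0 (expr_cost ?g m0 + len (val ?g m0) + (t + u) + v) m3"
      by (rule exec.WhileTrue[OF g exec.Seq[OF 1(1) u(1)] 3(1)])
    moreover have "expr_cost ?g m0 + len (val ?g m0) + (t + u) + v + S j * (pweight ?w * wordlen B)
        \<le> (S ?N + 1) * (pweight ?w * wordlen B)"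
    proof -
      have "t \<le> steps c ?s * (pweight ?w * wordlen B)"
        using 1(4) by (rule order_trans) (intro mult_left_mono mult_right_mono, auto)
      moreover have "expr_cost ?g m0 + len (val ?g m0) + u \<le> pweight ?w * wordlen B"
        using w u(2) by (simp add: algebra_simps del: expr_cost.simps val.simps)
      ultimately have "expr_cost ?g m0 + len (val ?g m0) + (t + u) \<le>
          (steps c ?s + 2) * (pweight ?w * wordlen B)"
        by (simp add: algebra_simps del: expr_cost.simps val.simps pweight.simps)
      then show ?thesis using 3(4) S_Suc[of j]
        by (simp add: algebra_simps del: expr_cost.simps val.simps pweight.simps)
    qed
    ultimately show ?case using 3(2,3) by blast
  qed
  have B: "bounded m B" by (rule bounded_mono[OF For.prems(3)]) (use MB in linarith)
  let ?m1 = "m(val ?X m := val (Const 0) m)"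
  obtain t where t: "exec (Store ?X (Const 0)) m t ?m1"
    "t \<le> pweight (Store ?X (Const 0)) * wordlen B"
    using exec_Store[OF B] by blast
  have m1: "?m1 = m(address x 0 := int 0)" by (simp add: val_cell)
  have "represents ?m1 (iter x c s 0)"
    unfolding m1 iter_0 using For.prems(2) wf(1) by (rule represents_upd)
  moreover have "bounded ?m1 (M + ?G * S 0)"
    unfolding m1 using For.prems(3) by (intro bounded_upd bounded_mono[OF For.prems(3)]) auto
  ultimately obtain u m2 where 2: "exec ?w ?m1 u m2" "represents m2 (iter x c s ?N)"
    "bounded m2 (M + ?G * S ?N)"
    "u + S 0 * (pweight ?w * wordlen B) \<le> (S ?N + 1) * (pweight ?w * wordlen B)"
    using loop[OF le0] by blast
  have e: "exec (compile (For x l c)) m (t + u) m2"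
    using exec.Seq[OF t(1) 2(1)] by simp
  have "t + u \<le> (2 + S ?N) * ((pweight (Store ?X (Const 0)) + pweight ?w) * wordlen B)"
  proof -
    have "t + u \<le> pweight (Store ?X (Const 0)) * wordlen B + (S ?N + 1) * (pweight ?w * wordlen B)"
      using t(2) 2(4) by (simp add: S_def del: pweight.simps)
    then show ?thesis by (simp add: algebra_simps del: pweight.simps)
  qed
  moreover have "pweight (compile (For x l c)) = pweight (Store ?X (Const 0)) + pweight ?w"
    by simp
  ultimately have le: "t + u \<le> steps (For x l c) s * (pweight (compile (For x l c)) * wordlen B)"
    by (simp only: stp)
  have "represents m2 (sem (For x l c) s)" unfolding sem_For by (rule 2(2))
  moreover have "bounded m2 (M + cgrowth (For x l c) * steps (For x l c) s)"
    unfolding stp cgrowth.simps by (rule bounded_mono[OF 2(3)]) simp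
  ultimately show ?case using e le by blast
qed

section \<open>Pathwidth and vertex orderings\<close>

definition boundary :: "'a set set \<Rightarrow> 'a set \<Rightarrow> 'a set" where
  "boundary E A = {v \<in> A. \<exists>u. u \<notin> A \<and> {v, u} \<in> E}"

inductive reachable :: "'a set \<Rightarrow> 'a set set \<Rightarrow> nat \<Rightarrow> 'a set \<Rightarrow> bool" for V E w where
  empty: "reachable V E w {}"
| insert: "reachable V E w A \<Longrightarrow> y \<in> V \<Longrightarrow> y \<notin> A \<Longrightarrow> card (boundary E (insert y A)) \<le> w \<Longrightarrow>
    reachable V E w (insert y A)"

lemma boundary_subset: "boundary E A \<subseteq> A"
  by (auto simp: boundary_def)

lemma boundary_empty [simp]: "boundary E {} = {}"
  by (simp add: boundary_def)

lemma reachable_subset: "reachable V E w A \<Longrightarrow> A \<subseteq> V"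
  by (induction rule: reachable.induct) auto

lemma reachable_card: "reachable V E w A \<Longrightarrow> card (boundary E A) \<le> w"
  by (induction rule: reachable.induct) auto

lemma reachable_step:
  assumes "reachable V E w A" "A \<subseteq> B" "B \<subseteq> insert y A" "B \<subseteq> V" "card (boundary E B) \<le> w"
  shows "reachable V E w B"
proof (cases "B = A")
  case False
  then have "B = insert y A" "y \<notin> A" using assms(2,3) by auto
  then show ?thesis using assms by (auto intro: reachable.insert)
qed (use assms in simp)

lemma reachable_mono: "reachable V E w A \<Longrightarrow> w \<le> w' \<Longrightarrow> reachable V E w' A"
  by (induction rule: reachable.induct) (auto intro: reachable.intros)

text \<open>A boundary never has more vertices than the set itself. This makes \<open>n\<close> a
  safe initial value for the table of the dynamic program.\<close>

lemma reachable_card_bound: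
  assumes "finite A" "A \<subseteq> V" "card A \<le> w"
  shows "reachable V E w A"
  using assms
proof (induction A rule: finite_induct)
  case (insert y A)
  have "card (boundary E (insert y A)) \<le> card (insert y A)"
    by (rule card_mono[OF _ boundary_subset]) (use insert in auto)
  then show ?case using insert by (intro reachable.insert) auto
qed (auto intro: reachable.empty)

lemma reachable_list:
  "reachable V E w A \<Longrightarrow> \<exists>xs. distinct xs \<and> set xs = A \<and>
    (\<forall>i\<le>length xs. card (boundary E (set (take i xs))) \<le> w)"
proof (induction rule: reachable.induct)
  case empty
  show ?case by (rule exI[of _ "[]"]) simp
next
  case (insert A y)
  then obtain xs where xs: "distinct xs" "set xs = A"
    "\<forall>i\<le>length xs. card (boundary E (set (take i xs))) \<le> w" by auto
  have "card (boundary E (set (take i (xs @ [y])))) \<le> w" if "i \<le> length (xs @ [y])" for i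
    using xs insert.hyps that by (cases "i = length xs + 1") auto
  then show ?case using xs insert.hyps by (intro exI[of _ "xs @ [y]"]) auto
qed

section \<open>Path decompositions and orderings\<close>

definition path_edges :: "nat \<Rightarrow> nat set set" where
  "path_edges n = {{i, Suc i} | i. Suc i < n}"

lemma pair_in_path_edges:
  "{a, b} \<in> path_edges n \<longleftrightarrow> (b = Suc a \<or> a = Suc b) \<and> a < n \<and> b < n"
  by (auto simp: path_edges_def doubleton_eq_iff)

lemma path_edges_is_path: "0 < n \<Longrightarrow> is_path_graph {..<n} (path_edges n)"
  unfolding is_path_graph_def path_edges_def
  by (rule exI[of _ "[0..<n]"], simp add: lessThan_atLeast0, intro conjI Collect_cong ex_cong1) auto

lemma path_edges_simple: "simple_graph {..<n} (path_edges n)"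
  by (auto simp: simple_graph_def path_edges_def)

lemma path_edges_connected:
  assumes "S \<noteq> {}" "S \<subseteq> {..<n}" "\<And>a b c. a \<in> S \<Longrightarrow> c \<in> S \<Longrightarrow> a \<le> b \<Longrightarrow> b \<le> c \<Longrightarrow> b \<in> S"
  shows "induces_connected (path_edges n) S"
proof -
  let ?R = "{(x, y). x \<in> S \<and> y \<in> S \<and> {x, y} \<in> path_edges n}"
  have up: "(u, v) \<in> ?R\<^sup>*" if "u \<in> S" "v \<in> S" "u \<le> v" for u v
    using that(3,1,2)
  proof (induction v rule: dec_induct)
    case (step v)
    then have v: "v \<in> S" using assms(3)[of u "Suc v" v] by simp
    then have "(v, Suc v) \<in> ?R" using step assms(2) by (auto simp: pair_in_path_edges)
    moreover have "(u, v) \<in> ?R\<^sup>*" using step v by simp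
    ultimately show ?case by (rule rtrancl_into_rtrancl[rotated])
  qed simp
  have "sym ?R" by (auto simp: sym_def insert_commute)
  then have "sym (?R\<^sup>*)" by (rule sym_rtrancl)
  then have "(u, v) \<in> ?R\<^sup>*" if "u \<in> S" "v \<in> S" for u v
    using up[OF that] symD[OF _ up[OF that(2,1)]] by (cases "u \<le> v") auto
  then show ?thesis using assms(1) by (auto simp: induces_connected_def)
qed

text \<open>Both cyclic neighbours of the largest number on a cycle would have to be its
  predecessor, but they are distinct since the length is at least 3.\<close>

lemma path_edges_no_cycle: "\<not> is_cycle (path_edges n) xs"
proof
  assume c: "is_cycle (path_edges n) xs"
  let ?L = "length xs"
  have L: "3 \<le> ?L" and d: "distinct xs"
    and e: "\<And>i. i < ?L \<Longrightarrow> {xs ! i, xs ! (Suc i mod ?L)} \<in> path_edges n"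
    using c by (auto simp: is_cycle_def)
  have "Max (set xs) \<in> set xs" using L by (intro Max_in) auto
  then obtain j where j: "j < ?L" "xs ! j = Max (set xs)" by (auto simp: in_set_conv_nth)
  have le: "xs ! i \<le> xs ! j" if "i < ?L" for i using that j by simp
  define p where "p = (if j = 0 then ?L - 1 else j - 1)"
  define q where "q = Suc j mod ?L"
  have p: "p < ?L" "Suc p mod ?L = j" using j L by (auto simp: p_def)
  have q: "q < ?L" using L unfolding q_def by (intro mod_less_divisor) linarith
  have "p \<noteq> q" using j L by (auto simp: p_def q_def mod_Suc)
  have "xs ! j = Suc (xs ! q)"
    using e[OF j(1)] le[OF q] by (auto simp: pair_in_path_edges q_def)
  moreover have "xs ! j = Suc (xs ! p)"
    using e[OF p(1)] le[OF p(1)] unfolding p(2) by (auto simp: pair_in_path_edges)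
  ultimately have "xs ! p = xs ! q" by simp
  then show False using d p q \<open>p \<noteq> q\<close> by (simp add: nth_eq_iff_index_eq)
qed

lemma path_edges_is_tree: "0 < n \<Longrightarrow> is_tree {..<n} (path_edges n)"
  unfolding is_tree_def
  using path_edges_simple path_edges_no_cycle path_edges_connected[of "{..<n}" n] by auto

lemma edge_ends:
  assumes "simple_graph V E" "e \<in> E"
  obtains u v where "e = {u, v}" "u \<noteq> v" "u \<in> V" "v \<in> V"
  using assms unfolding simple_graph_def by (metis card_2_iff insert_subset)

text \<open>Bag \<open>i\<close> consists of the vertex at position \<open>i\<close> and those
  before it that still have a neighbour at position \<open>i\<close> or later. An edge is caught
  when its later end is added, and a vertex stays from its own position up to that of its last
  neighbour, hence in an interval of bags.\<close>

lemma decomposition_of_reachable: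
  assumes G: "simple_graph V E" "V \<noteq> {}" and r: "reachable V E w V"
  shows "\<exists>(I :: nat set) F X. path_decomposition V E I F X \<and> decomposition_width I X \<le> int w"
proof -
  obtain xs where xs: "distinct xs" "set xs = V"
    and w: "\<And>i. i \<le> length xs \<Longrightarrow> card (boundary E (set (take i xs))) \<le> w"
    using reachable_list[OF r] by blast
  let ?n = "length xs"
  have n: "0 < ?n" using xs(2) G(2) by auto
  have in_take: "xs ! i \<in> set (take j xs) \<longleftrightarrow> i < j" if "i < ?n" for i j
    using that xs(1) by (auto simp: in_set_conv_nth nth_eq_iff_index_eq)
  define X where "X i = boundary E (set (take i xs)) \<union> {xs ! i}" for i
  have X_iff: "xs ! i \<in> X j \<longleftrightarrow> i = j \<or> i < j \<and> (\<exists>k<?n. j \<le> k \<and> {xs ! i, xs ! k} \<in> E)"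
    if "i < ?n" "j < ?n" for i j
  proof -
    have "(\<exists>u. u \<notin> set (take j xs) \<and> {xs ! i, u} \<in> E) \<longleftrightarrow> (\<exists>k<?n. j \<le> k \<and> {xs ! i, xs ! k} \<in> E)"
    proof
      assume "\<exists>u. u \<notin> set (take j xs) \<and> {xs ! i, u} \<in> E"
      then obtain u where u: "u \<notin> set (take j xs)" "{xs ! i, u} \<in> E" by blast
      then have "u \<in> set xs" using G(1) xs(2) by (auto simp: simple_graph_def)
      then obtain k where "k < ?n" "u = xs ! k" by (auto simp: in_set_conv_nth)
      then show "\<exists>k<?n. j \<le> k \<and> {xs ! i, xs ! k} \<in> E" using u in_take[of k j] by auto
    next
      assume "\<exists>k<?n. j \<le> k \<and> {xs ! i, xs ! k} \<in> E"
      then show "\<exists>u. u \<notin> set (take j xs) \<and> {xs ! i, u} \<in> E" using in_take by (meson not_le)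
    qed
    then show ?thesis using that xs(1) in_take[of i j]
      by (auto simp: X_def boundary_def nth_eq_iff_index_eq)
  qed
  have XV: "X i \<subseteq> V" if "i < ?n" for i
    using that xs(2) boundary_subset[of E "set (take i xs)"] set_take_subset[of i xs]
    by (auto simp: X_def)
  have edges: "\<exists>i<?n. e \<subseteq> X i" if "e \<in> E" for e
  proof -
    obtain u v where uv: "e = {u, v}" "u \<noteq> v" "u \<in> V" "v \<in> V" using edge_ends G(1) \<open>e \<in> E\<close> .
    then have "u \<in> set xs" "v \<in> set xs" using xs(2) by simp_all
    then obtain i j where ij: "u = xs ! i" "v = xs ! j" "i < ?n" "j < ?n"
      by (auto simp: in_set_conv_nth)
    have "e \<subseteq> X (max i j)"
      using ij uv that X_iff[of i "max i j"] X_iff[of j "max i j"]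
      by (cases "i \<le> j") (auto simp: insert_commute max_def)
    then show ?thesis using ij by (intro exI[of _ "max i j"]) auto
  qed
  have conn: "induces_connected (path_edges ?n) {i \<in> {..<?n}. v \<in> X i}" if "v \<in> V" for v
  proof -
    have "v \<in> set xs" using that xs(2) by simp
    then obtain i where i: "v = xs ! i" "i < ?n" by (auto simp: in_set_conv_nth)
    show ?thesis
    proof (rule path_edges_connected)
      show "{i \<in> {..<?n}. v \<in> X i} \<noteq> {}" using i by (auto simp: X_def)
      fix a b c assume "a \<in> {i \<in> {..<?n}. v \<in> X i}" "c \<in> {i \<in> {..<?n}. v \<in> X i}" "a \<le> b" "b \<le> c"
      then have "a < ?n" "c < ?n" "xs ! i \<in> X a" "xs ! i \<in> X c" "a \<le> b" "b \<le> c" using i by auto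
      then have "xs ! i \<in> X b"
        using i X_iff[of i a] X_iff[of i b] X_iff[of i c] by auto
      then show "b \<in> {i \<in> {..<?n}. v \<in> X i}" using i \<open>b \<le> c\<close> \<open>c < ?n\<close> by auto
    qed auto
  qed
  have "\<forall>v\<in>V. \<exists>i\<in>{..<?n}. v \<in> X i"
    using xs(2) by (auto simp: X_def in_set_conv_nth) 
  then have pd: "path_decomposition V E {..<?n} (path_edges ?n) X"
    unfolding path_decomposition_def tree_decomposition_def
    using path_edges_is_tree[OF n] path_edges_is_path[OF n] XV edges conn by blast
  have "card (X i) \<le> w + 1" if "i < ?n" for i
  proof -
    have "card (X i) \<le> card (boundary E (set (take i xs))) + card {xs ! i}"
      unfolding X_def by (rule card_Un_le)
    then show ?thesis using w[of i] that by simp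
  qed
  then have "decomposition_width {..<?n} X \<le> int w"
    unfolding decomposition_width_def using n by (subst diff_le_eq, subst Max_le_iff) force+
  then show ?thesis using pd by blast
qed

text \<open>Vertices are ordered by the first bag \<open>l v\<close> containing them. For an initial
  segment \<open>A\<close> and a missing vertex \<open>y\<close> with \<open>l y\<close> minimal,
  each boundary vertex of \<open>A\<close> lies in the bag \<open>l y\<close>: it has entered by
  then, and it shares a bag with a missing neighbour no earlier than that. As \<open>y\<close>
  itself is also in this bag, at most \<open>w\<close> places are left for the boundary.\<close>

lemma reachable_of_decomposition:
  fixes I :: "'i set"
  assumes G: "simple_graph V E" "V \<noteq> {}" and pd: "path_decomposition V E I F X"
    and w: "decomposition_width I X = w"
  shows "0 \<le> w \<and> reachable V E (nat w) V"
proof -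
  have finV: "finite V" using G(1) by (simp add: simple_graph_def)
  obtain xs where xs: "xs \<noteq> []" "distinct xs" "set xs = I"
    and F: "F = {{xs ! i, xs ! Suc i} | i. Suc i < length xs}"
    using pd by (auto simp: path_decomposition_def is_path_graph_def)
  let ?n = "length xs"
  define Y where "Y p = X (xs ! p)" for p
  have YV: "Y p \<subseteq> V" if "p < ?n" for p
    using pd xs(3) that by (auto simp: path_decomposition_def tree_decomposition_def Y_def)
  have cover: "\<exists>p<?n. v \<in> Y p" if "v \<in> V" for v
    using pd xs(3) that unfolding path_decomposition_def tree_decomposition_def Y_def
    by (metis in_set_conv_nth)
  have edge: "\<exists>p<?n. e \<subseteq> Y p" if "e \<in> E" for e
    using pd xs(3) that unfolding path_decomposition_def tree_decomposition_def Y_def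
    by (metis in_set_conv_nth)
  \<comment> \<open>A walk in the path moves by one position at a time and avoids position
    \<open>q\<close>, so it never gets from the left of \<open>q\<close> to its right.\<close>
  have convex: "v \<in> Y q" if v: "v \<in> V" and pr: "p < ?n" "r < ?n" "v \<in> Y p" "v \<in> Y r" "p \<le> q" "q \<le> r"
    for v p q r
  proof (rule ccontr)
    assume q: "v \<notin> Y q"
    let ?S = "{i \<in> I. v \<in> X i}"
    let ?R = "{(x, y). x \<in> ?S \<and> y \<in> ?S \<and> {x, y} \<in> F}"
    have "induces_connected F ?S"
      using pd v by (auto simp: path_decomposition_def tree_decomposition_def)
    then have "(xs ! p, xs ! r) \<in> ?R\<^sup>*"
      using pr xs(3) by (auto simp: induces_connected_def Y_def)
    then have "\<exists>j<q. xs ! r = xs ! j"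
    proof (induction rule: rtrancl_induct)
      case base
      have "p \<noteq> q" using q pr by auto
      then show ?case using pr by (intro exI[of _ p]) auto
    next
      case (step y z)
      then obtain j where j: "j < q" "y = xs ! j" by auto
      from step(2) F obtain i where i: "{y, z} = {xs ! i, xs ! Suc i}" "Suc i < ?n" by auto
      have "z \<noteq> xs ! q" using step(2) q by (auto simp: Y_def)
      moreover have "z = xs ! i \<and> j = Suc i \<or> z = xs ! Suc i \<and> j = i"
        using i j xs(2) pr by (auto simp: doubleton_eq_iff nth_eq_iff_index_eq)
      ultimately show ?case using j by (metis Suc_lessD Suc_lessI)
    qed
    then show False using xs(2) pr by (auto simp: nth_eq_iff_index_eq)
  qed
  have fin: "finite ((\<lambda>i. int (card (X i))) ` I)" using xs(3) by auto
  have card_Y: "int (card (Y p)) \<le> w + 1" if "p < ?n" for p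
  proof -
    have "xs ! p \<in> I" using that xs(3) by auto
    then show ?thesis using Max_ge[OF fin, of "int (card (Y p))"] w
      by (auto simp: decomposition_width_def Y_def)
  qed
  define l where "l v = (LEAST p. p < ?n \<and> v \<in> Y p)" for v
  have l: "l v < ?n \<and> v \<in> Y (l v)" if "v \<in> V" for v
    unfolding l_def by (rule LeastI_ex) (use cover[OF that] in blast)
  have l_le: "l v \<le> p" if "p < ?n" "v \<in> Y p" for v p
    unfolding l_def using that by (intro Least_le) auto
  have finY: "finite (Y p)" if "p < ?n" for p using YV[OF that] finV by (rule finite_subset)
  \<comment> \<open>A graph with a vertex has a nonempty bag, so \<open>nat w\<close> does not
    truncate.\<close>
  have w0: "0 \<le> w"
  proof -
    obtain v where v: "v \<in> V" using G(2) by blast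
    then have "1 \<le> card (Y (l v))" using l[OF v] finY by (metis One_nat_def Suc_leI card_gt_0_iff empty_iff)
    then show ?thesis using card_Y[of "l v"] l[OF v] by linarith
  qed
  have small: "card (boundary E A) \<le> nat w"
    if A: "A \<subseteq> V" "\<And>u v. u \<in> A \<Longrightarrow> v \<in> V - A \<Longrightarrow> l u \<le> l v" for A
  proof (cases "A = V")
    case True
    then have "boundary E A = {}" using G(1) by (auto simp: boundary_def simple_graph_def)
    then show ?thesis by simp
  next
    case False
    then obtain z where "z \<in> V - A" using A(1) by auto
    from ex_has_least_nat[of "\<lambda>v. v \<in> V - A", OF this, of l]
    obtain y where y: "y \<in> V - A" "\<And>v. v \<in> V - A \<Longrightarrow> l y \<le> l v" by blast
    have ly: "l y < ?n" "y \<in> Y (l y)" using l y by auto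
    have "boundary E A \<subseteq> Y (l y) - {y}"
    proof
      fix v assume "v \<in> boundary E A"
      then obtain u where u: "v \<in> A" "u \<notin> A" "{v, u} \<in> E" by (auto simp: boundary_def)
      then have V: "v \<in> V" "u \<in> V" using G(1) by (auto simp: simple_graph_def)
      from edge[OF u(3)] obtain p where p: "p < ?n" "v \<in> Y p" "u \<in> Y p" by auto
      have "l v \<le> l y" using A(2) u y by auto
      moreover have "l y \<le> p" using y(2)[of u] V u l_le[OF p(1,3)] by auto
      ultimately have "v \<in> Y (l y)" using convex[of v "l v" p "l y"] l[OF V(1)] V p by auto
      then show "v \<in> Y (l y) - {y}" using u y by auto
    qed
    then have "card (boundary E A) \<le> card (Y (l y) - {y})"
      using finY[OF ly(1)] by (intro card_mono) auto
    also have "\<dots> = card (Y (l y)) - 1" using ly by simp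
    finally show ?thesis using card_Y[OF ly(1)] by linarith
  qed
  have "\<exists>A. A \<subseteq> V \<and> card A = m \<and> (\<forall>u\<in>A. \<forall>v\<in>V - A. l u \<le> l v) \<and> reachable V E (nat w) A"
    if "m \<le> card V" for m
    using that
  proof (induction m)
    case 0
    show ?case by (intro exI[of _ "{}"]) (auto intro: reachable.empty)
  next
    case (Suc m)
    then obtain A where A: "A \<subseteq> V" "card A = m" "\<And>u v. u \<in> A \<Longrightarrow> v \<in> V - A \<Longrightarrow> l u \<le> l v"
      "reachable V E (nat w) A" by auto
    have "A \<noteq> V" using A(2) Suc.prems by auto
    then obtain z where "z \<in> V - A" using A(1) by auto
    from ex_has_least_nat[of "\<lambda>v. v \<in> V - A", OF this, of l]
    obtain y where y: "y \<in> V - A" "\<And>v. v \<in> V - A \<Longrightarrow> l y \<le> l v" by blast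
    have closed: "\<And>u v. u \<in> insert y A \<Longrightarrow> v \<in> V - insert y A \<Longrightarrow> l u \<le> l v" using A(3) y by auto
    have "reachable V E (nat w) (insert y A)"
      using A(1,4) y(1) small[of "insert y A"] closed by (intro reachable.insert) auto
    moreover have "card (insert y A) = Suc m"
      using A(1,2) y finV by (simp add: finite_subset)
    ultimately show ?case using A(1) y(1) closed by (intro exI[of _ "insert y A"]) auto
  qed
  from this[of "card V"] obtain A where "A \<subseteq> V" "card A = card V" "reachable V E (nat w) A" by auto
  then have "reachable V E (nat w) V" using finV card_subset_eq by metis
  then show ?thesis using w0 by simp
qed

text \<open>The case \<open>V = {}\<close> has to be excluded: there the pathwidth is -1, whereas
  the empty ordering costs 0.\<close>

theorem pathwidth_eq:
  assumes G: "simple_graph V E" "V \<noteq> {}" and r: "reachable V E w V"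
    and least: "\<And>w'. reachable V E w' V \<Longrightarrow> w \<le> w'"
  shows "pathwidth V E = int w"
  unfolding pathwidth_def
proof (rule Least_equality)
  have lower: "int w \<le> v"
    if "\<exists>(I :: nat set) F X. path_decomposition V E I F X \<and> v = decomposition_width I X" for v
  proof -
    from that obtain I :: "nat set" and F X
      where "path_decomposition V E I F X" "decomposition_width I X = v" by blast
    then have "0 \<le> v" "reachable V E (nat v) V" using reachable_of_decomposition[OF G] by blast+
    then show ?thesis using least by fastforce
  qed
  show "\<And>v. \<exists>(I :: nat set) F X. path_decomposition V E I F X \<and> v = decomposition_width I X \<Longrightarrow> int w \<le> v"
    by (rule lower)
  obtain I :: "nat set" and F X
    where "path_decomposition V E I F X" "decomposition_width I X \<le> int w"
    using decomposition_of_reachable[OF G r] by blast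
  then show "\<exists>(I :: nat set) F X. path_decomposition V E I F X \<and> int w = decomposition_width I X"
    using lower by (metis order_antisym)
qed

section \<open>Statuses on a vertex cover\<close>

text \<open>A partial ordering of the vertices is abstracted to a status on the vertex cover \<open>C\<close>: \<open>0\<close> for
  absent, \<open>1\<close> for present, \<open>2\<close> for present together with all neighbours outside \<open>C\<close>.\<close>

definition members :: "'a set \<Rightarrow> 'a set set \<Rightarrow> 'a set \<Rightarrow> ('a \<Rightarrow> nat) \<Rightarrow> 'a set" where
  "members V E C s = {v \<in> C. 0 < s v} \<union>
     {v \<in> V - C. (\<forall>u. {v, u} \<in> E \<longrightarrow> 0 < s u) \<or> (\<exists>u. {v, u} \<in> E \<and> 1 < s u)}"

text \<open>For a raise from \<open>s\<close> to \<open>s'\<close>, the raised vertex of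
  \<open>C\<close> comes first, at \<open>j = 0\<close>, followed by the vertices outside
  \<open>C\<close> in increasing order. Consecutive sets differ in at most one vertex, so the
  largest boundary along the chain is the cost of the transition.\<close>

definition chain :: "nat set \<Rightarrow> nat set set \<Rightarrow> nat set \<Rightarrow> (nat \<Rightarrow> nat) \<Rightarrow> (nat \<Rightarrow> nat) \<Rightarrow> nat \<Rightarrow> nat set" where
  "chain V E C s s' j = members V E C s \<union> {v \<in> members V E C s'. v \<in> C \<or> v < j}"

definition advance :: "(nat \<Rightarrow> nat) \<Rightarrow> nat \<Rightarrow> nat \<Rightarrow> nat" where
  "advance s c = s(c := Suc (s c))"

locale covered_graph =
  fixes n :: nat and E :: "nat set set" and C :: "nat set"
  assumes graph: "simple_graph {..<n} E" and cover: "vertex_cover {..<n} E C"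
begin

abbreviation "mem \<equiv> members {..<n} E C"
abbreviation "chn \<equiv> chain {..<n} E C"
abbreviation "bd \<equiv> boundary E"
abbreviation "reach \<equiv> reachable {..<n} E"

lemma C_sub: "C \<subseteq> {..<n}" using cover by (simp add: vertex_cover_def)

lemma adj_less: "{u, v} \<in> E \<Longrightarrow> u < n \<and> v < n"
  using graph by (auto simp: simple_graph_def)

lemma adj_cover: "{u, v} \<in> E \<Longrightarrow> u \<in> C \<or> v \<in> C"
  using cover by (auto simp: vertex_cover_def)

lemma mem_sub: "mem s \<subseteq> {..<n}" using C_sub by (auto simp: members_def)

lemma mem_advance:
  assumes "c \<in> C"
  shows "mem s \<subseteq> mem (advance s c)"
proof -
  have "0 < s u \<Longrightarrow> 0 < advance s c u" "1 < s u \<Longrightarrow> 1 < advance s c u" for u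
    by (auto simp: advance_def)
  then show ?thesis unfolding members_def by blast
qed

lemma reach_advance:
  assumes c: "c \<in> C" and r: "reach w (mem s)"
    and cost: "\<And>j. j \<le> n \<Longrightarrow> card (bd (chn s (advance s c) j)) \<le> w"
  shows "reach w (mem (advance s c))"
proof -
  let ?t = "advance s c"
  have V: "chn s ?t j \<subseteq> {..<n}" for j using mem_sub[of s] mem_sub[of ?t] by (auto simp: chain_def)
  have "reach w (chn s ?t j)" if "j \<le> n" for j
    using that
  proof (induction j)
    case 0
    show ?case
    proof (rule reachable_step[OF r, of _ c])
      show "chn s ?t 0 \<subseteq> insert c (mem s)" 
        by (auto simp: chain_def members_def advance_def split: if_splits)
    qed (use V cost[of 0] in \<open>auto simp: chain_def[of _ _ _ s ?t]\<close>)
  next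
    case (Suc j)
    then have "reach w (chn s ?t j)" by simp
    then show ?case
      by (rule reachable_step[of _ _ _ _ _ j]) (use V cost[of "Suc j"] Suc.prems in \<open>auto simp: chain_def\<close>)
  qed
  from this[of n] have "reach w (chn s ?t n)" by simp
  moreover have "chn s ?t n = mem ?t"
    using mem_advance[OF c, of s] mem_sub[of ?t] by (auto simp: chain_def)
  ultimately show ?thesis by simp
qed

text \<open>With no cover vertex present, the canonical set consists of isolated vertices outside
  \<open>C\<close>, which never enter a boundary. The initial state therefore costs 0.\<close>

lemma reach_isolated: "reach 0 (mem (\<lambda>_. 0))"
proof -
  have "reach 0 A" if "finite A" "A \<subseteq> mem (\<lambda>_. 0)" for A
    using that
  proof (induction A rule: finite_induct)
    case (insert y A)
    have "bd (insert y A) = {}" using insert.prems by (auto simp: boundary_def members_def)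
    then show ?case using insert mem_sub[of "\<lambda>_. 0"] by (intro reachable.insert) auto
  qed (rule reachable.empty)
  then show ?thesis using mem_sub[of "\<lambda>_. 0"] finite_subset by blast
qed

section \<open>The exchange argument\<close>

definition closed :: "nat set \<Rightarrow> nat set" where
  "closed A = {c \<in> C \<inter> A. \<forall>v. {c, v} \<in> E \<longrightarrow> v \<notin> C \<longrightarrow> v \<in> A}"

lemma closedD: "c \<in> closed A \<Longrightarrow> {v, c} \<in> E \<Longrightarrow> v \<notin> C \<Longrightarrow> v \<in> A"
  by (simp add: closed_def insert_commute)

text \<open>\<open>B\<close> holds the cover vertices present and \<open>L\<close> those with status
  2. A prefix \<open>A\<close> of an ordering will be abstracted to
  \<open>status (A \<inter> C) (closed A)\<close>.\<close>

definition status :: "nat set \<Rightarrow> nat set \<Rightarrow> nat \<Rightarrow> nat" where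
  "status B L c = (if c \<in> L then 2 else if c \<in> B then 1 else 0)"

lemma mem_status:
  assumes "L \<subseteq> B" "B \<subseteq> C"
  shows "mem (status B L) =
    B \<union> {v \<in> {..<n} - C. (\<forall>u. {v, u} \<in> E \<longrightarrow> u \<in> B) \<or> (\<exists>u\<in>L. {v, u} \<in> E)}"
  using assms by (auto simp: members_def status_def split: if_splits)

text \<open>The only possible gain is \<open>y\<close>, and the loss of \<open>v\<close> pays for
  it.\<close>

lemma card_le_of_excuse:
  assumes "finite A" "card A \<le> w" "B \<subseteq> insert y A" "v \<in> A" "v \<notin> B"
  shows "card B \<le> w"
proof -
  have "B \<subseteq> insert y (A - {v})" using assms by auto
  then have "card B \<le> card (insert y (A - {v}))" using assms(1) by (intro card_mono) auto
  also have "\<dots> \<le> Suc (card (A - {v}))" by (rule card_insert_le_m1) auto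
  also have "\<dots> = card A" using assms(1,4) by (rule card_Suc_Diff1)
  finally show ?thesis using assms(2) by simp
qed

lemma finite_bd: "A \<subseteq> {..<n} \<Longrightarrow> finite (bd A)"
  by (rule finite_subset[OF order_trans[OF boundary_subset]]) auto

lemma not_bd: "v \<notin> A \<Longrightarrow> v \<notin> bd A"
  by (simp add: boundary_def)

text \<open>The two lemmas below compare an intermediate set \<open>F\<close> of the chain of a transition with the
  prefixes \<open>A\<close> and \<open>insert y A\<close> of the given ordering.\<close>

lemma bd_le_independent:
  assumes A: "A \<subseteq> {..<n}" "y < n" "y \<notin> C" "y \<notin> A"
    and w: "card (bd A) \<le> w" "card (bd (insert y A)) \<le> w"
    and F: "F \<subseteq> {..<n}" "F \<inter> C = A \<inter> C"
      "\<And>v u. v \<in> F \<Longrightarrow> v \<notin> C \<Longrightarrow> {v, u} \<in> E \<Longrightarrow> u \<notin> A \<Longrightarrow> v \<in> insert y A"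
      "\<And>v. v < n \<Longrightarrow> v \<notin> C \<Longrightarrow> (\<And>u. {v, u} \<in> E \<Longrightarrow> u \<in> A) \<Longrightarrow> v \<in> F"
      "\<And>c v. c \<in> closed A \<Longrightarrow> {c, v} \<in> E \<Longrightarrow> v \<notin> C \<Longrightarrow> v \<in> F"
  shows "card (bd F) \<le> w"
proof -
  let ?A = "insert y A"
  have C: "u \<in> C" if "{v, u} \<in> E" "v \<notin> C" for u v using adj_cover[OF that(1)] that(2) by simp
  have F_iff: "u \<in> F \<longleftrightarrow> u \<in> A" if "u \<in> C" for u using F(2) that by auto
  have y: "u \<noteq> y" if "u \<in> C" for u using A(3) that by auto
  \<comment> \<open>The neighbours of \<open>v\<close> lie in \<open>C\<close>, where
    \<open>F\<close> and \<open>A\<close> agree, and \<open>y\<close> is not among them; so a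
    neighbour missing from \<open>F\<close> is missing from \<open>insert y A\<close> as
    well.\<close>
  have out: "v \<in> bd ?A" if "v \<in> bd F" "v \<notin> C" for v
  proof -
    from that(1) obtain u where u: "v \<in> F" "u \<notin> F" "{v, u} \<in> E" by (auto simp: boundary_def)
    then have "u \<notin> A" "u \<noteq> y" using C[OF _ that(2)] F_iff y by blast+
    then show ?thesis using F(3)[OF u(1) that(2) u(3)] u by (auto simp: boundary_def)
  qed
  have inA: "v \<in> bd A" if "v \<in> bd F" "v \<in> C" for v
  proof -
    from that(1) obtain u where u: "v \<in> F" "u \<notin> F" "{v, u} \<in> E" by (auto simp: boundary_def)
    show ?thesis
    proof (cases "u \<in> C")
      case True
      then show ?thesis using u F_iff that by (auto simp: boundary_def)
    next
      case False
      then have "v \<notin> closed A" using F(5) u by blast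
      then show ?thesis using u F_iff that by (auto simp: closed_def boundary_def)
    qed
  qed
  have fin: "finite (bd A)" "finite (bd ?A)" using A by (auto intro: finite_bd)
  \<comment> \<open>If \<open>F\<close> postpones a boundary vertex \<open>v\<close> of
    \<open>insert y A\<close> outside \<open>C\<close>, there is room to spare: \<open>F\<close> is
    compared with \<open>A\<close>, and \<open>v\<close> makes up for \<open>y\<close>. If it
    postpones none, \<open>F\<close> is compared with \<open>insert y A\<close>.\<close>
  show ?thesis
  proof (cases "\<exists>v. v \<in> bd ?A \<and> v \<notin> C \<and> v \<notin> F")
    case True
    then obtain v where v: "v \<in> bd ?A" "v \<notin> C" "v \<notin> F" by blast
    have sub: "bd ?A - C \<subseteq> insert y (bd A - C)" by (auto simp: boundary_def)
    show ?thesis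
    proof (cases "v = y")
      case True
      have "bd F \<subseteq> bd A" 
      proof
        fix x assume x: "x \<in> bd F"
        then have "x \<noteq> y" using v True not_bd[of x F] by blast
        then show "x \<in> bd A" using x inA out sub by blast
      qed
      then show ?thesis using w fin by (meson card_mono le_trans)
    next
      case False
      then have "v \<in> bd A" using v sub by blast
      moreover have "bd F \<subseteq> insert y (bd A)" using inA out sub by blast
      moreover have "v \<notin> bd F" using v not_bd by simp
      ultimately show ?thesis using card_le_of_excuse[OF fin(1) w(1)] by metis
    qed
  next
    case False
    have "bd F \<subseteq> bd ?A"
    proof
      fix v assume v: "v \<in> bd F"
      show "v \<in> bd ?A"
      proof (cases "v \<in> C")
        case True
        obtain u where u: "v \<in> F" "u \<notin> F" "{v, u} \<in> E" using v by (auto simp: boundary_def)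
        have "u \<notin> ?A"
        proof (cases "u \<in> C")
          case True
          then show ?thesis using u F_iff y by auto
        next
          case uC: False
          show ?thesis
          proof
            assume "u \<in> ?A"
            moreover have "u < n" using adj_less u by blast
            \<comment> \<open>A vertex outside \<open>C\<close> that is postponed by
              \<open>F\<close> still lacks a neighbour, so it would be a boundary vertex of
              \<open>insert y A\<close>, which this case excludes.\<close>
            then obtain z where "{u, z} \<in> E" "z \<notin> A" using F(4)[of u] uC u by blast
            moreover from this have "z \<noteq> y" using C uC y by blast
            ultimately have "u \<in> bd ?A" by (auto simp: boundary_def)
            then show False using False uC u by blast
          qed
        qed
        then show ?thesis using u True F_iff by (auto simp: boundary_def)
      qed (use out v in blast)
    qed
    then show ?thesis using w fin by (meson card_mono le_trans)
  qed
qed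

lemma bd_le_cover:
  assumes A: "A \<subseteq> {..<n}" "y \<in> C" "y \<notin> A"
    and w: "card (bd A) \<le> w" "card (bd (insert y A)) \<le> w"
    and F: "F \<subseteq> {..<n}" "F \<inter> C = insert y A \<inter> C"
      "\<And>v u. v \<in> F \<Longrightarrow> v \<notin> C \<Longrightarrow> {v, u} \<in> E \<Longrightarrow> u \<notin> insert y A \<Longrightarrow> v \<in> A"
      "\<And>c v. c \<in> closed A \<Longrightarrow> {c, v} \<in> E \<Longrightarrow> v \<notin> C \<Longrightarrow> v \<in> F"
  shows "card (bd F) \<le> w"
proof -
  let ?A = "insert y A"
  have C: "u \<in> C" if "{v, u} \<in> E" "v \<notin> C" for u v using adj_cover[OF that(1)] that(2) by simp
  have F_iff: "u \<in> F \<longleftrightarrow> u \<in> ?A" if "u \<in> C" for u using F(2) that by auto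
  have yn: "y < n" using A(2) C_sub by auto
  have fin: "finite (bd A)" "finite (bd ?A)" using A yn by (auto intro: finite_bd)
  have sub: "bd F \<subseteq> insert y (bd ?A)"
  proof
    fix v assume v: "v \<in> bd F"
    then obtain u where u: "v \<in> F" "u \<notin> F" "{v, u} \<in> E" by (auto simp: boundary_def)
    show "v \<in> insert y (bd ?A)"
    proof (cases "v \<in> C")
      case False
      then have "u \<in> C" using C u by blast
      then show ?thesis using F(3) u F_iff False by (auto simp: boundary_def)
    next
      case True
      show ?thesis
      proof (cases "v = y")
        case False
        then have vA: "v \<in> A" using True u F_iff by auto
        show ?thesis
        proof (cases "u \<in> C")
          case True
          then show ?thesis using u F_iff vA by (auto simp: boundary_def)
        next
          case uC: False
          then have "v \<notin> closed A" using F(4) u by blast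
          then obtain x where "{v, x} \<in> E" "x \<notin> C" "x \<notin> A" using vA True by (auto simp: closed_def)
          moreover from this have "x \<noteq> y" using A(2) by auto
          ultimately show ?thesis using vA by (auto simp: boundary_def)
        qed
      qed simp
    qed
  qed
  \<comment> \<open>Only \<open>y\<close> can be a boundary vertex of \<open>F\<close> but not of
    \<open>insert y A\<close>. Then \<open>F\<close> lacks a neighbour \<open>v\<close> of
    \<open>y\<close> that lies in \<open>A\<close>. As \<open>y\<close> is missing from
    \<open>A\<close>, this \<open>v\<close> is in the boundary of \<open>A\<close>, and its absence
    from \<open>F\<close> makes up for \<open>y\<close>.\<close>
  show ?thesis
  proof (cases "y \<in> bd F \<and> y \<notin> bd ?A")
    case False
    then have "bd F \<subseteq> bd ?A" using sub by auto
    then show ?thesis using w fin by (meson card_mono le_trans)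
  next
    case True
    then obtain v where v: "v \<notin> F" "{y, v} \<in> E" by (auto simp: boundary_def)
    have "v \<in> ?A" using True v by (auto simp: boundary_def)
    moreover have "v \<noteq> y" using True v F_iff A(2) by auto
    ultimately have "v \<in> A" by simp
    have vC: "v \<notin> C" using F_iff v \<open>v \<in> A\<close> by auto
    have "{v, y} \<in> E" using v(2) by (simp add: insert_commute)
    then have "v \<in> bd A" using \<open>v \<in> A\<close> A(3) unfolding boundary_def by blast
    moreover have "v \<notin> bd F" using v not_bd by simp
    moreover have "bd F \<subseteq> insert y (bd A)"
      using sub by (auto simp: boundary_def)
    ultimately show ?thesis using card_le_of_excuse[OF fin(1) w(1)] by metis
  qed
qed

lemma advance_status_present:
  assumes "L \<subseteq> B" "c \<in> B" "c \<notin> L"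
  shows "advance (status B L) c = status B (insert c L)"
  using assms by (auto simp: advance_def status_def)

lemma advance_status_absent:
  assumes "L \<subseteq> B" "c \<notin> B"
  shows "advance (status B L) c = status (insert c B) L"
  using assms by (auto simp: advance_def status_def)

text \<open>Completeness of the abstraction: \<open>R\<close> holds of the statuses that the dynamic program
  finds to have cost at most \<open>w\<close>.\<close>

lemma status_reachable:
  assumes R0: "R (status {} {})"
    and R_advance: "\<And>B L c. L \<subseteq> B \<Longrightarrow> B \<subseteq> C \<Longrightarrow> c \<in> C \<Longrightarrow> c \<notin> L \<Longrightarrow> R (status B L) \<Longrightarrow>
      (\<And>j. j \<le> n \<Longrightarrow> card (bd (chn (status B L) (advance (status B L) c) j)) \<le> w) \<Longrightarrow>
      R (advance (status B L) c)"
    and r: "reach w A"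
  shows "R (status (A \<inter> C) (closed A))"
proof -
  have finC: "finite C" using C_sub finite_subset by blast
  \<comment> \<open>The cover vertices completed by one step of the ordering are raised from 1 to 2
    one after another, in any order. In the premise \<open>cost\<close>, \<open>K\<close> is the set
    of those that already have status 2.\<close>
  have raise: "R (status B (L \<union> M))"
    if "finite M" "L \<union> M \<subseteq> B" "B \<subseteq> C" "M \<inter> L = {}" "R (status B L)"
      and cost: "\<And>K c j. L \<subseteq> K \<Longrightarrow> c \<in> M - K \<Longrightarrow> K \<subseteq> L \<union> M \<Longrightarrow>
        card (bd (chn (status B K) (status B (insert c K)) j)) \<le> w"
    for B L M
    using that(1) subset_refl[of M]
  proof (induction rule: finite_subset_induct')
    case empty
    then show ?case using that by simp
  next
    case (insert c K)
    have "c \<in> B" "c \<notin> L \<union> K" "L \<union> K \<subseteq> B" using insert that by auto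
    then have adv: "advance (status B (L \<union> K)) c = status B (insert c (L \<union> K))"
      by (intro advance_status_present)
    have "card (bd (chn (status B (L \<union> K)) (advance (status B (L \<union> K)) c) j)) \<le> w" for j
      unfolding adv by (rule cost) (use insert \<open>c \<notin> L \<union> K\<close> in auto)
    then have "R (advance (status B (L \<union> K)) c)"
      by (intro R_advance) (use insert that \<open>c \<notin> L \<union> K\<close> in auto)
    then show ?case using adv by simp
  qed
  from r show ?thesis
  proof (induction rule: reachable.induct)
    case empty
    have "closed {} = {}" by (auto simp: closed_def)
    then show ?case using R0 by simp
  next
    case (insert A y)
    have AV: "A \<subseteq> {..<n}" using insert(1) by (rule reachable_subset)
    have w: "card (bd A) \<le> w" "card (bd (insert y A)) \<le> w"
      using insert(1,5) insert(4) reachable_card by auto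
    have y: "y < n" "y \<notin> A" using insert by auto
    have cl: "closed A \<subseteq> closed (insert y A)" "closed A \<subseteq> A \<inter> C" 
      "closed (insert y A) \<subseteq> insert y A \<inter> C" by (auto simp: closed_def)
    have chnV: "chn s t j \<subseteq> {..<n}" for s t j
      using mem_sub[of s] mem_sub[of t] by (auto simp: chain_def)
    show ?case
    proof (cases "y \<in> C")
      \<comment> \<open>Adding a vertex outside \<open>C\<close> makes no new cover vertex present,
        but it may complete several outside neighbourhoods at once.\<close>
      case False
      let ?B = "A \<inter> C" and ?M = "closed (insert y A) - closed A"
      have B: "insert y A \<inter> C = ?B" using False by auto
      have "R (status ?B (closed A \<union> ?M))"
      proof (rule raise)
        fix K c j assume K: "closed A \<subseteq> K" "c \<in> ?M - K" "K \<subseteq> closed A \<union> ?M"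
        let ?F = "chn (status ?B K) (status ?B (insert c K)) j"
        have KB: "K \<subseteq> ?B" "insert c K \<subseteq> ?B" using K cl B by auto
        have Kcl: "insert c K \<subseteq> closed (insert y A)" using K cl by auto
        have ms: "mem (status ?B K) = ?B \<union> {v \<in> {..<n} - C. (\<forall>u. {v, u} \<in> E \<longrightarrow> u \<in> ?B) \<or> (\<exists>u\<in>K. {v, u} \<in> E)}"
          "mem (status ?B (insert c K)) = ?B \<union> {v \<in> {..<n} - C. (\<forall>u. {v, u} \<in> E \<longrightarrow> u \<in> ?B) \<or> (\<exists>u\<in>insert c K. {v, u} \<in> E)}"
          using KB by (auto simp only: mem_status Int_lower2)
        show "card (bd ?F) \<le> w"
        proof (rule bd_le_independent[OF AV y(1) False y(2) w])
          show "?F \<subseteq> {..<n}" by (rule chnV)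
          show "?F \<inter> C = A \<inter> C" unfolding chain_def ms by auto
          show "v \<in> insert y A" if "v \<in> ?F" "v \<notin> C" "{v, u} \<in> E" "u \<notin> A" for v u
          proof -
            from that obtain x where "x \<in> insert c K" "{v, x} \<in> E" unfolding chain_def ms by auto
            then show ?thesis using Kcl that(2) closedD[of x "insert y A" v] by blast
          qed
          show "v \<in> ?F" if "v < n" "v \<notin> C" "\<And>u. {v, u} \<in> E \<Longrightarrow> u \<in> A" for v
            using that adj_cover unfolding chain_def ms by blast
          show "v \<in> ?F" if "c' \<in> closed A" "{c', v} \<in> E" "v \<notin> C" for c' v
            using that K(1) adj_less[OF that(2)] unfolding chain_def ms by (auto simp: insert_commute)
        qed
      qed (use cl B finC insert.IH in \<open>auto intro: finite_subset[OF _ finC]\<close>)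
      moreover have "closed A \<union> ?M = closed (insert y A)" using cl by auto
      ultimately show ?thesis using B by simp
    next
      \<comment> \<open>A vertex of \<open>C\<close> is raised from 0 to 1, and then to 2 if its
        neighbours outside \<open>C\<close> are all present already. No other cover vertex can
        become closed in this step.\<close>
      case True
      let ?B1 = "insert y A \<inter> C"
      let ?B0 = "A \<inter> C" and ?L = "closed A"
      have B: "?B1 = insert y ?B0" using True by (rule Int_insert_left_if1)
      have LB: "?L \<subseteq> ?B0" "?L \<subseteq> ?B1" using cl by auto
      have ms0: "mem (status ?B0 ?L) = ?B0 \<union> {v \<in> {..<n} - C. (\<forall>u. {v, u} \<in> E \<longrightarrow> u \<in> ?B0) \<or> (\<exists>u\<in>?L. {v, u} \<in> E)}"
        using LB by (auto simp only: mem_status Int_lower2)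
      have ms: "mem (status ?B1 K) = ?B1 \<union> {v \<in> {..<n} - C. (\<forall>u. {v, u} \<in> E \<longrightarrow> u \<in> ?B1) \<or> (\<exists>u\<in>K. {v, u} \<in> E)}"
        if "K \<subseteq> ?B1" for K
        using that by (auto simp only: mem_status Int_lower2)
      have adv: "advance (status ?B0 ?L) y = status ?B1 ?L"
        unfolding B by (rule advance_status_absent) (use LB y in auto)
      have "R (advance (status ?B0 ?L) y)"
      proof (rule R_advance)
        show "y \<notin> ?L" using LB y by auto
        fix j
        let ?F = "chn (status ?B0 ?L) (advance (status ?B0 ?L) y) j"
        show "card (bd ?F) \<le> w"
        proof (rule bd_le_cover[OF AV True y(2) w])
          show "?F \<subseteq> {..<n}" by (rule chnV)
          show "?F \<inter> C = insert y A \<inter> C" unfolding chain_def adv ms0 ms[OF LB(2)] by auto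
          show "v \<in> A" if "v \<in> ?F" "v \<notin> C" "{v, u} \<in> E" "u \<notin> insert y A" for v u
          proof -
            from that obtain x where "x \<in> ?L" "{v, x} \<in> E" unfolding chain_def adv ms0 ms[OF LB(2)] by auto
            then show ?thesis using that(2) by (auto simp: closed_def insert_commute)
          qed
          show "v \<in> ?F" if "c' \<in> closed A" "{c', v} \<in> E" "v \<notin> C" for c' v
            using that adj_less[OF that(2)] unfolding chain_def ms0 by (auto simp: insert_commute)
        qed
      qed (use LB True insert.IH in auto)
      then have R1: "R (status ?B1 ?L)" using adv by simp
      let ?M = "closed (insert y A) - closed A"
      have My: "?M \<subseteq> {y}" using True by (auto simp: closed_def)
      have "R (status ?B1 (?L \<union> ?M))"
      proof (rule raise)
        fix K c j assume K: "?L \<subseteq> K" "c \<in> ?M - K" "K \<subseteq> ?L \<union> ?M"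
        then have "c = y" "y \<in> closed (insert y A)" using My by blast+
        then have "K = ?L" using K My by blast
        let ?F = "chn (status ?B1 ?L) (status ?B1 (insert y ?L)) j"
        have yL: "insert y ?L \<subseteq> ?B1" using LB True by auto
        have "card (bd ?F) \<le> w"
        proof (rule bd_le_cover[OF AV True y(2) w])
          show "?F \<subseteq> {..<n}" by (rule chnV)
          show "?F \<inter> C = insert y A \<inter> C" unfolding chain_def ms[OF LB(2)] ms[OF yL] by auto
          show "v \<in> A" if "v \<in> ?F" "v \<notin> C" "{v, u} \<in> E" "u \<notin> insert y A" for v u
          proof -
            from that obtain x where "x \<in> insert y ?L" "{v, x} \<in> E"
              unfolding chain_def ms[OF LB(2)] ms[OF yL] by auto
            then have "v \<in> insert y A" 
              using that(2) \<open>y \<in> closed (insert y A)\<close> by (auto simp: closed_def insert_commute)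
            then show ?thesis using that(2) True by auto
          qed
          show "v \<in> ?F" if "c' \<in> closed A" "{c', v} \<in> E" "v \<notin> C" for c' v
            using that adj_less[OF that(2)] unfolding chain_def ms[OF LB(2)] by (auto simp: insert_commute)
        qed
        then show "card (bd (chn (status ?B1 K) (status ?B1 (insert c K)) j)) \<le> w"
          using \<open>c = y\<close> \<open>K = ?L\<close> by simp
      qed (use cl finC R1 in \<open>auto intro: finite_subset[OF _ finC]\<close>)
      moreover have "?L \<union> ?M = closed (insert y A)" using cl by auto
      ultimately show ?thesis by simp
    qed
  qed
qed

lemma closed_all: "closed {..<n} = C"
  using C_sub adj_less by (auto simp: closed_def)

end

section \<open>The dynamic program\<close>

text \<open>
  Array numbers of the program; scalars are stored at index \<open>0\<close>. Row \<open>u\<close> of the adjacency matrix starts at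
  \<open>1 + vROW[u]\<close>. The cover is listed in \<open>vC[0..<vK]\<close> (during its construction \<open>vC[0..<vJ]\<close>) and has the
  characteristic function \<open>vINC\<close>. \<open>vD\<close> holds the digits of a ternary counter, \<open>vPOW\<close> the powers of \<open>3\<close>,
  \<open>vL\<close> and \<open>vL2\<close> the number of counter values. \<open>vF\<close> maps a state to the least cost known so far, \<open>vST\<close> is the
  status of the current state, \<open>vPA\<close> and \<open>vPB\<close> are the canonical sets before and after a transition and
  \<open>vMF\<close> is a set between them.
\<close>

abbreviation (input) vROW :: nat where "vROW \<equiv> 2"
abbreviation (input) vU :: nat where "vU \<equiv> 3"
abbreviation (input) vW :: nat where "vW \<equiv> 4"
abbreviation (input) vN1 :: nat where "vN1 \<equiv> 5"
abbreviation (input) vL :: nat where "vL \<equiv> 6"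
abbreviation (input) vPOW :: nat where "vPOW \<equiv> 7"
abbreviation (input) vKA :: nat where "vKA \<equiv> 8"
abbreviation (input) vFOUND :: nat where "vFOUND \<equiv> 9"
abbreviation (input) vK :: nat where "vK \<equiv> 10"
abbreviation (input) vD :: nat where "vD \<equiv> 11"
abbreviation (input) vI :: nat where "vI \<equiv> 12"
abbreviation (input) vB :: nat where "vB \<equiv> 13"
abbreviation (input) vINC :: nat where "vINC \<equiv> 14"
abbreviation (input) vJ :: nat where "vJ \<equiv> 15"
abbreviation (input) vFAIL :: nat where "vFAIL \<equiv> 16"
abbreviation (input) vC :: nat where "vC \<equiv> 17"
abbreviation (input) vX :: nat where "vX \<equiv> 18"
abbreviation (input) vCNT :: nat where "vCNT \<equiv> 19"
abbreviation (input) vL2 :: nat where "vL2 \<equiv> 20"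
abbreviation (input) vT :: nat where "vT \<equiv> 21"
abbreviation (input) vF :: nat where "vF \<equiv> 22"
abbreviation (input) vST :: nat where "vST \<equiv> 23"
abbreviation (input) vPA :: nat where "vPA \<equiv> 24"
abbreviation (input) vPB :: nat where "vPB \<equiv> 25"
abbreviation (input) vCOST :: nat where "vCOST \<equiv> 26"
abbreviation (input) vMF :: nat where "vMF \<equiv> 27"
abbreviation (input) vFLAG :: nat where "vFLAG \<equiv> 28"
abbreviation (input) vZ :: nat where "vZ \<equiv> 29"
abbreviation (input) vANY :: nat where "vANY \<equiv> 30"
abbreviation (input) vCARRY :: nat where "vCARRY \<equiv> 31"
abbreviation (input) vOUT :: nat where "vOUT \<equiv> 32"

abbreviation (input) Var :: "nat \<Rightarrow> aexp" where "Var x \<equiv> Arr x (Num 0)"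
abbreviation (input) Set :: "nat \<Rightarrow> aexp \<Rightarrow> cmd" where "Set x e \<equiv> Asg x (Num 0) e"
abbreviation (input) When :: "aexp \<Rightarrow> aexp \<Rightarrow> cmd \<Rightarrow> cmd" where "When e f c \<equiv> Less e f c SKIP"

section \<open>Loop programs for canonical sets and boundaries\<close>

definition adj :: aexp where
  "adj = Arr 0 (Plus (Num 1) (Plus (Arr vROW (Var vU)) (Var vW)))"

definition graph_store :: "nat \<Rightarrow> nat set set \<Rightarrow> store \<Rightarrow> bool" where
  "graph_store n E s \<longleftrightarrow> s 0 0 = n \<and> (\<forall>u<n. \<forall>w<n. 0 < s 0 (Suc (s vROW u + w)) \<longleftrightarrow> {u, w} \<in> E)"

lemma graph_store_cong: "graph_store n E s \<Longrightarrow> s' 0 = s 0 \<Longrightarrow> s' vROW = s vROW \<Longrightarrow> graph_store n E s'"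
  by (simp add: graph_store_def)

lemma graph_store_size: "graph_store n E s \<Longrightarrow> s 0 0 = n"
  by (simp add: graph_store_def)

lemma aval_adj:
  "graph_store n E s \<Longrightarrow> s vU 0 < n \<Longrightarrow> s vW 0 < n \<Longrightarrow> 0 < aval adj s \<longleftrightarrow> {s vU 0, s vW 0} \<in> E"
  by (simp add: graph_store_def adj_def)

text \<open>The two flags decide the two alternatives in \<open>members\<close> for a vertex outside
  \<open>C\<close>; they are combined in \<open>member\<close> by testing whether their sum is
  positive.\<close>

definition scan_neighbours :: cmd where
  "scan_neighbours = For vW 0 (When (Num 0) adj
     (When (Arr vST (Var vW)) (Num 1) (Set vFLAG (Num 0)) ;;
      When (Num 1) (Arr vST (Var vW)) (Set vANY (Num 1))))"

lemma writes_scan_neighbours [simp]: "writes scan_neighbours = {vW, vFLAG, vANY}"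
  by (auto simp: scan_neighbours_def)

lemma sem_scan_neighbours:
  assumes g: "graph_store n E s" and u: "s vU 0 = u" "u < n" and "s vFLAG 0 = 1" "s vANY 0 = 0"
  shows "0 < sem scan_neighbours s vFLAG 0 \<longleftrightarrow> (\<forall>w<n. {u, w} \<in> E \<longrightarrow> 0 < s vST w)"
    "0 < sem scan_neighbours s vANY 0 \<longleftrightarrow> (\<exists>w<n. {u, w} \<in> E \<and> 1 < s vST w)"
proof -
  let ?I = "\<lambda>i (s' :: store). (0 < s' vFLAG 0 \<longleftrightarrow> (\<forall>w<i. {u, w} \<in> E \<longrightarrow> 0 < s vST w)) \<and>
    (0 < s' vANY 0 \<longleftrightarrow> (\<exists>w<i. {u, w} \<in> E \<and> 1 < s vST w))"
  have "?I (s 0 0) (sem scan_neighbours s)"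
    unfolding scan_neighbours_def
  proof (rule For_invariant[where I = ?I], goal_cases)
    case 2
    show ?case using assms by (simp add: upd_apply)
  next
    case (3 i s')
    have eq: "s' 0 = s 0" "s' vROW = s vROW" "s' vST = s vST" "s' vU = s vU"
      by (rule 3(4); simp)+
    have "0 < aval adj s' \<longleftrightarrow> {u, i} \<in> E"
      using aval_adj[OF graph_store_cong[OF g eq(1,2)]] 3(1,3) u eq graph_store_size[OF g] by simp
    then show ?case using 3(2,3) eq by (auto simp: upd_apply less_Suc_eq)
  qed simp
  then show "0 < sem scan_neighbours s vFLAG 0 \<longleftrightarrow> (\<forall>w<n. {u, w} \<in> E \<longrightarrow> 0 < s vST w)"
    "0 < sem scan_neighbours s vANY 0 \<longleftrightarrow> (\<exists>w<n. {u, w} \<in> E \<and> 1 < s vST w)"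
    using graph_store_size[OF g] by auto
qed

definition member :: "nat \<Rightarrow> cmd" where
  "member x = For vU 0
     (Set vFLAG (Num 1) ;; Set vANY (Num 0) ;; scan_neighbours ;;
      Less (Num 0) (Arr vINC (Var vU))
        (Less (Num 0) (Arr vST (Var vU)) (Asg x (Var vU) (Num 1)) (Asg x (Var vU) (Num 0)))
        (Less (Num 0) (Plus (Var vFLAG) (Var vANY)) (Asg x (Var vU) (Num 1)) (Asg x (Var vU) (Num 0))))"

lemma writes_member [simp]: "writes (member x) = {vU, vW, vFLAG, vANY, x}"
  by (auto simp: member_def)

definition chain_member :: cmd where
  "chain_member = For vU 0
     (Asg vMF (Var vU) (Num 0) ;;
      When (Num 0) (Arr vPA (Var vU)) (Asg vMF (Var vU) (Num 1)) ;;
      When (Num 0) (Arr vPB (Var vU))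
        (Less (Num 0) (Arr vINC (Var vU)) (Asg vMF (Var vU) (Num 1))
          (When (Var vU) (Var vB) (Asg vMF (Var vU) (Num 1)))))"

lemma writes_chain_member [simp]: "writes chain_member = {vU, vMF}"
  by (auto simp: chain_member_def)

lemma sem_chain_member:
  assumes "v < s 0 0"
  shows "0 < sem chain_member s vMF v \<longleftrightarrow>
    0 < s vPA v \<or> 0 < s vPB v \<and> (0 < s vINC v \<or> v < s vB 0)"
proof -
  let ?P = "\<lambda>v. 0 < s vPA v \<or> 0 < s vPB v \<and> (0 < s vINC v \<or> v < s vB 0)"
  let ?I = "\<lambda>i (s' :: store). \<forall>v<i. 0 < s' vMF v \<longleftrightarrow> ?P v"
  have "?I (s 0 0) (sem chain_member s)"
    unfolding chain_member_def
  proof (rule For_invariant[where I = ?I], goal_cases)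
    case (3 i s')
    have eq: "s' vPA = s vPA" "s' vPB = s vPB" "s' vINC = s vINC" "s' vB = s vB"
      by (rule 3(4); simp)+
    show ?case using 3(2,3) by (simp add: upd_apply eq less_Suc_eq)
  qed simp_all
  then show ?thesis using assms by simp
qed

definition scan_outside :: cmd where
  "scan_outside = For vW 0 (When (Num 0) adj (When (Arr vMF (Var vW)) (Num 1) (Set vFLAG (Num 1))))"

lemma writes_scan_outside [simp]: "writes scan_outside = {vW, vFLAG}"
  by (auto simp: scan_outside_def)

lemma sem_scan_outside:
  assumes g: "graph_store n E s" and u: "s vU 0 = u" "u < n" and "s vFLAG 0 = 0"
  shows "0 < sem scan_outside s vFLAG 0 \<longleftrightarrow> (\<exists>w<n. {u, w} \<in> E \<and> s vMF w = 0)"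
proof -
  let ?I = "\<lambda>i (s' :: store). 0 < s' vFLAG 0 \<longleftrightarrow> (\<exists>w<i. {u, w} \<in> E \<and> s vMF w = 0)"
  have "?I (s 0 0) (sem scan_outside s)"
    unfolding scan_outside_def
  proof (rule For_invariant[where I = ?I], goal_cases)
    case 2
    show ?case using assms by (simp add: upd_apply)
  next
    case (3 i s')
    have eq: "s' 0 = s 0" "s' vROW = s vROW" "s' vMF = s vMF" "s' vU = s vU"
      by (rule 3(4); simp)+
    have "0 < aval adj s' \<longleftrightarrow> {u, i} \<in> E"
      using aval_adj[OF graph_store_cong[OF g eq(1,2)]] 3(1,3) u eq graph_store_size[OF g] by simp
    then show ?case using 3(2,3) eq by (auto simp: upd_apply less_Suc_eq)
  qed simp
  then show ?thesis using graph_store_size[OF g] by simp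
qed

definition count_boundary :: cmd where
  "count_boundary = Set vCNT (Num 0) ;;
     For vU 0 (When (Num 0) (Arr vMF (Var vU))
       (Set vFLAG (Num 0) ;; scan_outside ;;
        When (Num 0) (Var vFLAG) (Set vCNT (Plus (Var vCNT) (Num 1)))))"

lemma writes_count_boundary [simp]: "writes count_boundary = {vCNT, vU, vW, vFLAG}"
  by (auto simp: count_boundary_def)

lemma sem_count_boundary:
  assumes G: "simple_graph {..<n} E" and g: "graph_store n E s"
    and M: "M \<subseteq> {..<n}" "\<And>v. v < n \<Longrightarrow> 0 < s vMF v \<longleftrightarrow> v \<in> M"
  shows "sem count_boundary s vCNT 0 = card (boundary E M)"
proof -
  let ?s0 = "upd s vCNT 0 0"
  let ?I = "\<lambda>i (s' :: store). s' vCNT 0 = card {v \<in> boundary E M. v < i}"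
  have "?I (?s0 0 0) (sem count_boundary s)"
    unfolding count_boundary_def sem.simps(3) sem.simps(2) aval.simps
  proof (rule For_invariant[where I = ?I], goal_cases)
    case 2
    show ?case by (simp add: upd_apply)
  next
    case (3 i s')
    have eq: "s' 0 = s 0" "s' vROW = s vROW" "s' vMF = s vMF"
      by (subst 3(4); simp add: upd_apply)+
    have i: "i < n" using 3(1) graph_store_size[OF g] by (simp add: upd_apply)
    let ?s1 = "upd s' vFLAG 0 0"
    have "0 < sem scan_outside ?s1 vFLAG 0 \<longleftrightarrow> (\<exists>w<n. {i, w} \<in> E \<and> ?s1 vMF w = 0)"
      by (rule sem_scan_outside[OF graph_store_cong[OF g]])
        (use eq i 3(3) in \<open>simp_all add: upd_apply\<close>)
    also have "\<dots> \<longleftrightarrow> (\<exists>w. {i, w} \<in> E \<and> w \<notin> M)"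
    proof -
      have "w < n" if "{i, w} \<in> E" for w using G that by (auto simp: simple_graph_def)
      moreover have "?s1 vMF w = 0 \<longleftrightarrow> w \<notin> M" if "w < n" for w
        using M(2)[OF that] eq by (auto simp: upd_apply)
      ultimately show ?thesis by blast
    qed
    finally have out: "0 < sem scan_outside ?s1 vFLAG 0 \<longleftrightarrow> (\<exists>w. {i, w} \<in> E \<and> w \<notin> M)" .
    have unchanged: "sem scan_outside ?s1 vCNT = s' vCNT"
      by (simp add: sem_unwritten upd_apply)
    have bd: "i \<in> boundary E M \<longleftrightarrow> i \<in> M \<and> (\<exists>w. {i, w} \<in> E \<and> w \<notin> M)" by (auto simp: boundary_def)
    have "{v \<in> boundary E M. v < Suc i} =
        (if i \<in> boundary E M then insert i {v \<in> boundary E M. v < i} else {v \<in> boundary E M. v < i})"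
      by (auto simp: less_Suc_eq)
    then have "card {v \<in> boundary E M. v < Suc i} =
        (if i \<in> boundary E M then Suc (s' vCNT 0) else s' vCNT 0)"
      using 3(2) by simp
    then show ?case using 3(3) M(2)[OF i] eq out unchanged bd by (simp add: upd_apply)
  qed simp
  moreover have "{v \<in> boundary E M. v < n} = boundary E M"
    using M(1) boundary_subset[of E M] by auto
  ultimately show ?thesis using graph_store_size[OF g] by (simp add: upd_apply)
qed

locale enumerated_cover = covered_graph n E C for n E C +
  fixes k :: nat and cc :: "nat \<Rightarrow> nat"
  assumes cc: "bij_betw cc {..<k} C"
begin

lemma sem_member:
  assumes g: "graph_store n E s" and INC: "\<And>v. v < n \<Longrightarrow> 0 < s vINC v \<longleftrightarrow> v \<in> C"
    and x: "x \<in> {vPA, vPB}" and v: "v < n"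
  shows "0 < sem (member x) s x v \<longleftrightarrow> v \<in> mem (s vST)"
proof -
  let ?I = "\<lambda>i (s' :: store). \<forall>v<i. 0 < s' x v \<longleftrightarrow> v \<in> mem (s vST)"
  have "?I (s 0 0) (sem (member x) s)"
    unfolding member_def
  proof (rule For_invariant[where I = ?I], goal_cases)
    case 1
    show ?case using x by auto
  next
    case (3 i s')
    have eq: "s' 0 = s 0" "s' vROW = s vROW" "s' vST = s vST" "s' vINC = s vINC"
      by (rule 3(4); use x in auto)+
    have i: "i < n" using 3(1) graph_store_size[OF g] by simp
    let ?s1 = "upd (upd s' vFLAG 0 1) vANY 0 0"
    let ?s2 = "sem scan_neighbours ?s1"
    have "graph_store n E ?s1"
      by (rule graph_store_cong[OF g]) (simp_all add: eq upd_apply)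
    note s2 = sem_scan_neighbours[OF this, of i]
    have "0 < ?s2 vFLAG 0 + ?s2 vANY 0 \<longleftrightarrow>
      (\<forall>w. {i, w} \<in> E \<longrightarrow> 0 < s vST w) \<or> (\<exists>w. {i, w} \<in> E \<and> 1 < s vST w)"
      using s2 adj_less eq i 3(3) unfolding add_gr_0 by (simp add: upd_apply) blast
    then have mem: "i \<in> mem (s vST) \<longleftrightarrow>
        (if 0 < s vINC i then 0 < s vST i else 0 < ?s2 vFLAG 0 + ?s2 vANY 0)"
      using INC[OF i] i by (auto simp: members_def)
    have s2_eq: "?s2 vU = s' vU" "?s2 vINC = s vINC" "?s2 vST = s vST" "?s2 x = s' x"
      using x eq by (auto simp: sem_unwritten upd_apply)
    have [simp]: "?s2 vU 0 = i" "x \<noteq> vU" using s2_eq 3(3) x by auto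
    define s2 where "s2 = ?s2"
    show ?case using 3(2) mem s2_eq \<open>x \<noteq> vU\<close> \<open>?s2 vU 0 = i\<close>
      unfolding sem.simps aval.simps s2_def[symmetric]
      by (auto simp: upd_apply less_Suc_eq)
  qed simp
  then show ?thesis using v graph_store_size[OF g] by simp
qed

end

section \<open>Ternary counters\<close>

definition number :: "nat \<Rightarrow> (nat \<Rightarrow> nat) \<Rightarrow> nat" where
  "number k D = (\<Sum>z<k. D z * 3 ^ z)"

lemma number_cong: "(\<And>z. z < k \<Longrightarrow> D z = D' z) \<Longrightarrow> number k D = number k D'"
  by (simp add: number_def)

lemma number_less: "(\<And>z. z < k \<Longrightarrow> D z \<le> 2) \<Longrightarrow> number k D < 3 ^ k"
proof (induction k)
  case (Suc k)
  have "D k * 3 ^ k \<le> 2 * 3 ^ k" using Suc.prems[of k] by (intro mult_right_mono) auto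
  moreover have "number k D < 3 ^ k" using Suc by simp
  moreover have "number (Suc k) D = number k D + D k * 3 ^ k" by (simp add: number_def)
  moreover have "(3::nat) ^ Suc k = 3 ^ k + 2 * 3 ^ k" by simp
  ultimately show ?case by linarith
qed (simp add: number_def)

lemma number_inject:
  assumes "number k D = number k D'" "\<And>z. z < k \<Longrightarrow> D z \<le> 2" "\<And>z. z < k \<Longrightarrow> D' z \<le> 2" "z < k"
  shows "D z = D' z"
  using assms
proof (induction k)
  case (Suc k)
  have eq: "number k D + D k * 3 ^ k = number k D' + D' k * 3 ^ k"
    using Suc.prems(1) by (simp add: number_def)
  have less: "number k D < 3 ^ k" "number k D' < 3 ^ k"
    using Suc.prems by (auto intro: number_less)
  have "(number k D + D k * 3 ^ k) div 3 ^ k = D k" "(number k D' + D' k * 3 ^ k) div 3 ^ k = D' k"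
    using less by simp_all
  then have "D k = D' k" using eq by simp
  then show ?case using Suc eq by (cases "z = k") auto
qed simp

lemma number_upd: "z < k \<Longrightarrow> number k (D(z := v)) + D z * 3 ^ z = number k D + v * 3 ^ z"
  by (simp add: number_def sum.remove[of "{..<k}" z] sum.cong[of "{..<k} - {z}" _ "\<lambda>x. (if x = z then v else D x) * 3 ^ x"])

lemma number_zero: "(\<And>z. z < k \<Longrightarrow> D z = 0) \<Longrightarrow> number k D = 0"
  by (simp add: number_def)

lemma number_two: "Suc (number k (\<lambda>_. 2)) = 3 ^ k"
  by (induction k) (simp_all add: number_def)

text \<open>Loops have no early exit, so the carry is a flag and the digits after its absorption are
  passed over. On overflow all digits become 0; this can occur only after the last counter value has
  been used.\<close>

definition increment :: "nat \<Rightarrow> cmd" where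
  "increment l = Set vCARRY (Num 1) ;; For vZ l (When (Num 0) (Var vCARRY)
     (Less (Arr vD (Var vZ)) (Num 2)
       (Asg vD (Var vZ) (Plus (Arr vD (Var vZ)) (Num 1)) ;; Set vCARRY (Num 0))
       (Asg vD (Var vZ) (Num 0))))"

lemma writes_increment [simp]: "writes (increment l) = {vCARRY, vZ, vD}"
  by (auto simp: increment_def)

lemma sem_increment:
  assumes k: "s l 0 = k" "l \<noteq> vCARRY" and D: "\<And>z. z < k \<Longrightarrow> s vD z \<le> 2"
    and N: "Suc (number k (s vD)) < 3 ^ k"
  shows "number k (sem (increment l) s vD) = Suc (number k (s vD))"
    "z < k \<Longrightarrow> sem (increment l) s vD z \<le> 2"
proof -
  let ?s0 = "upd s vCARRY 0 1" and ?s' = "sem (increment l) s"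
  \<comment> \<open>The pending carry is worth \<open>3 ^ i\<close>; a carry surviving all
    \<open>k\<close> digits would contradict \<open>N\<close>.\<close>
  let ?I = "\<lambda>i (s' :: store). (\<forall>z<k. s' vD z \<le> 2) \<and> s' vCARRY 0 \<le> 1 \<and>
     number k (s' vD) + s' vCARRY 0 * 3 ^ i = Suc (number k (s vD))"
  have "?I (?s0 l 0) ?s'"
    unfolding increment_def sem.simps(3) sem.simps(2) aval.simps
  proof (rule For_invariant[where I = ?I], goal_cases)
    case 2
    show ?case using D by (simp add: upd_apply)
  next
    case (3 i s')
    have i: "i < k" using 3(1) k by (simp add: upd_apply)
    let ?d = "s' vD i"
    have up: "number k ((s' vD)(i := v)) + ?d * 3 ^ i = number k (s' vD) + v * 3 ^ i" for v
      by (rule number_upd[OF i])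
    consider "s' vCARRY 0 = 0" | "s' vCARRY 0 = 1" "?d < 2" | "s' vCARRY 0 = 1" "?d = 2"
      using 3(2) i by fastforce
    then show ?case
    proof cases
      case 1
      then show ?thesis using 3(2,3) by (simp add: upd_apply)
    next
      case 2
      then show ?thesis using 3(2,3) up[of "Suc ?d"] i by (auto simp: upd_apply)
    next
      case c3: 3
      then show ?thesis using 3(2,3) up[of 0] i by (auto simp: upd_apply)
    qed
  qed simp
  then have I: "?I k ?s'" using k by (simp add: upd_apply)
  have "?s' vCARRY 0 \<noteq> 1" using I N by auto
  then have "?s' vCARRY 0 = 0" using I by linarith
  then show "number k (sem (increment l) s vD) = Suc (number k (s vD))" using I by simp
  show "z < k \<Longrightarrow> sem (increment l) s vD z \<le> 2" using I by simp
qed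

definition load_status :: cmd where
  "load_status = For vZ vK (Asg vST (Arr vC (Var vZ)) (Arr vD (Var vZ)))"

lemma writes_load_status [simp]: "writes load_status = {vZ, vST}"
  by (auto simp: load_status_def)

text \<open>\<open>vCOST\<close> starts with the cost of the current state, so the maximum with the
  boundaries along the chain is the bottleneck cost via this state. The limit is \<open>vN1\<close>
  because \<open>j\<close> runs through \<open>n + 1\<close> values.\<close>

definition chain_cost :: cmd where
  "chain_cost = Set vCOST (Arr vF (Var vT)) ;;
     For vB vN1 (chain_member ;; count_boundary ;; When (Var vCOST) (Var vCNT) (Set vCOST (Var vCNT)))"

lemma writes_chain_cost [simp]: "writes chain_cost = {vCOST, vB, vU, vMF, vCNT, vW, vFLAG}"
  by (auto simp: chain_cost_def)

definition transition :: cmd where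
  "transition = load_status ;; member vPA ;;
     Asg vST (Arr vC (Var vI)) (Plus (Arr vD (Var vI)) (Num 1)) ;; member vPB ;; chain_cost ;;
     When (Var vCOST) (Arr vF (Plus (Var vT) (Arr vPOW (Var vI))))
       (Asg vF (Plus (Var vT) (Arr vPOW (Var vI))) (Var vCOST))"

lemma writes_transition [simp]: "writes transition =
    {vZ, vST, vU, vW, vFLAG, vANY, vPA, vPB, vCOST, vB, vMF, vCNT, vF}"
  by (auto simp: transition_def)

definition transitions :: cmd where
  "transitions = For vI vK (When (Arr vD (Var vI)) (Num 2) transition)"

lemma writes_transitions [simp]: "writes transitions =
    {vZ, vST, vU, vW, vFLAG, vANY, vPA, vPB, vCOST, vB, vMF, vCNT, vF, vI}"
  by (auto simp: transitions_def)

text \<open>\<open>vOUT\<close> is overwritten in each round so that the entry of the last state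
  remains; without subtraction the index \<open>3 ^ k - 1\<close> would be awkward to form
  afterwards. Reading before the transitions is safe, since they change only entries with larger
  index.\<close>

definition dynamic_program :: cmd where
  "dynamic_program = For vT vL2 (Set vOUT (Arr vF (Var vT)) ;; transitions ;; increment vK)"

lemma writes_dynamic_program [simp]: "writes dynamic_program =
    {vZ, vST, vU, vW, vFLAG, vANY, vPA, vPB, vCOST, vB, vMF, vCNT, vF, vI, vT, vOUT, vCARRY, vD}"
  by (auto simp: dynamic_program_def)

text \<open>The order \<open>n\<close> plays the part of infinity. The digits must be cleared
  because the cover search has used the same counter.\<close>

definition initialise :: cmd where
  "initialise = For vT vL2 (Asg vF (Var vT) (Arr 0 (Num 0))) ;; Asg vF (Num 0) (Num 0) ;;
     For vI vK (Asg vD (Var vI) (Num 0))"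

lemma writes_initialise [simp]: "writes initialise = {vT, vF, vI, vD}"
  by (auto simp: initialise_def)

context enumerated_cover
begin

definition dp_store :: "store \<Rightarrow> bool" where
  "dp_store s \<longleftrightarrow> graph_store n E s \<and> s vN1 0 = Suc n \<and> s vK 0 = k \<and> s vL2 0 = 3 ^ k \<and>
     (\<forall>z<k. s vC z = cc z \<and> s vPOW z = 3 ^ z) \<and> (\<forall>v<n. 0 < s vINC v \<longleftrightarrow> v \<in> C)"

lemma dp_store_cong:
  "dp_store s \<Longrightarrow> (\<And>x. x \<in> {0, vROW, vN1, vK, vL2, vC, vPOW, vINC} \<Longrightarrow> s' x = s x) \<Longrightarrow> dp_store s'"
  unfolding dp_store_def using graph_store_cong[of n E s s'] by simp

lemma dp_storeD:
  assumes "dp_store s"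
  shows "graph_store n E s" "s vN1 0 = Suc n" "s vK 0 = k" "s vL2 0 = 3 ^ k" "s 0 0 = n"
    "\<And>z. z < k \<Longrightarrow> s vC z = cc z" "\<And>z. z < k \<Longrightarrow> s vPOW z = 3 ^ z"
    "\<And>v. v < n \<Longrightarrow> 0 < s vINC v \<longleftrightarrow> v \<in> C"
  using assms graph_store_size by (auto simp: dp_store_def)

text \<open>Prescribing 0 outside \<open>C\<close> makes a status determined by its ternary
  code.\<close>

definition valid :: "(nat \<Rightarrow> nat) \<Rightarrow> bool" where
  "valid \<sigma> \<longleftrightarrow> (\<forall>v. \<sigma> v \<le> 2) \<and> (\<forall>v. v \<notin> C \<longrightarrow> \<sigma> v = 0)"

definition index :: "(nat \<Rightarrow> nat) \<Rightarrow> nat" where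
  "index \<sigma> = number k (\<lambda>z. \<sigma> (cc z))"

lemma cc_in: "z < k \<Longrightarrow> cc z \<in> C" using cc by (auto simp: bij_betw_def)
lemma cc_inj: "z < k \<Longrightarrow> z' < k \<Longrightarrow> cc z = cc z' \<longleftrightarrow> z = z'"
  using cc by (auto simp: bij_betw_def inj_on_def)
lemma cc_surj: "c \<in> C \<Longrightarrow> \<exists>z<k. c = cc z" using cc by (auto simp: bij_betw_def)

lemma valid_eqI:
  assumes "valid \<sigma>" "\<And>z. z < k \<Longrightarrow> \<tau> (cc z) = \<sigma> (cc z)" "\<And>v. v \<notin> C \<Longrightarrow> \<tau> v = 0"
  shows "\<tau> = \<sigma>"
proof
  fix v show "\<tau> v = \<sigma> v"
    using assms cc_surj[of v] by (cases "v \<in> C") (auto simp: valid_def)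
qed

lemma index_less: "valid \<sigma> \<Longrightarrow> index \<sigma> < 3 ^ k"
  unfolding index_def by (rule number_less) (simp add: valid_def)

lemma index_inject: "valid \<sigma> \<Longrightarrow> valid \<tau> \<Longrightarrow> index \<tau> = index \<sigma> \<Longrightarrow> \<tau> = \<sigma>"
  by (rule valid_eqI) (auto simp: index_def valid_def dest: number_inject)

lemma valid_advance: "valid \<sigma> \<Longrightarrow> c \<in> C \<Longrightarrow> \<sigma> c < 2 \<Longrightarrow> valid (advance \<sigma> c)"
  by (auto simp: valid_def advance_def)

lemma index_advance: "z < k \<Longrightarrow> index (advance \<sigma> (cc z)) = index \<sigma> + 3 ^ z"
proof -
  assume z: "z < k"
  have "index (advance \<sigma> (cc z)) = number k ((\<lambda>z. \<sigma> (cc z))(z := Suc (\<sigma> (cc z))))"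
    unfolding index_def by (rule number_cong) (use z cc_inj in \<open>auto simp: advance_def\<close>)
  then show ?thesis
    using number_upd[OF z, of "\<lambda>z. \<sigma> (cc z)" "Suc (\<sigma> (cc z))"] by (simp add: index_def)
qed

lemma valid_of_digits:
  assumes "\<And>z. z < k \<Longrightarrow> D z \<le> 2"
  obtains \<sigma> where "valid \<sigma>" "\<And>z. z < k \<Longrightarrow> \<sigma> (cc z) = D z" "index \<sigma> = number k D"
proof -
  define \<sigma> where "\<sigma> v = (if v \<in> C then D (the_inv_into {..<k} cc v) else 0)" for v
  have "\<sigma> (cc z) = D z" if "z < k" for z
    using cc cc_in that by (simp add: \<sigma>_def bij_betw_def the_inv_into_f_f)
  moreover have "valid \<sigma>"
    using assms cc the_inv_into_into[of cc "{..<k}" _ "{..<k}"]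
    by (auto simp: valid_def \<sigma>_def bij_betw_def)
  ultimately show ?thesis using that by (simp add: index_def cong: number_cong)
qed

lemma sem_load_status:
  assumes s: "dp_store s" and \<sigma>: "valid \<sigma>" "\<And>z. z < k \<Longrightarrow> s vD z = \<sigma> (cc z)"
    and ST: "\<And>v. v \<notin> C \<Longrightarrow> s vST v = 0"
  shows "sem load_status s vST = \<sigma>"
proof -
  note d = dp_storeD[OF s]
  let ?I = "\<lambda>i (s' :: store). (\<forall>z<i. s' vST (cc z) = \<sigma> (cc z)) \<and> (\<forall>v. v \<notin> C \<longrightarrow> s' vST v = 0)"
  have "?I (s vK 0) (sem load_status s)"
    unfolding load_status_def
  proof (rule For_invariant[where I = ?I], goal_cases)
    case 2
    show ?case using ST by (simp add: upd_apply)
  next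
    case (3 i s')
    have eq: "s' vC = s vC" "s' vD = s vD" by (rule 3(4); simp)+
    have i: "i < k" using 3(1) d by simp
    show ?case using 3(2,3) \<sigma>(2)[OF i] cc_inj[OF _ i] cc_in[OF i] d(6)[OF i] i
      by (auto simp: upd_apply eq less_Suc_eq)
  qed simp
  then show ?thesis using d \<sigma>(1) by (intro valid_eqI) auto
qed

text \<open>The maximum is described by the thresholds \<open>w\<close> that it does not exceed.
  Soundness and completeness both use it in this form.\<close>

lemma sem_chain_cost:
  assumes s: "dp_store s"
    and PA: "\<And>v. v < n \<Longrightarrow> 0 < s vPA v \<longleftrightarrow> v \<in> mem \<sigma>"
    and PB: "\<And>v. v < n \<Longrightarrow> 0 < s vPB v \<longleftrightarrow> v \<in> mem \<tau>"
  shows "sem chain_cost s vCOST 0 \<le> w \<longleftrightarrow>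
    s vF (s vT 0) \<le> w \<and> (\<forall>j\<le>n. card (bd (chn \<sigma> \<tau> j)) \<le> w)"
proof -
  note d = dp_storeD[OF s]
  let ?s0 = "upd s vCOST 0 (s vF (s vT 0))"
  let ?I = "\<lambda>i (s' :: store). s' vCOST 0 \<le> w \<longleftrightarrow>
    s vF (s vT 0) \<le> w \<and> (\<forall>j<i. card (bd (chn \<sigma> \<tau> j)) \<le> w)"
  have "?I (?s0 vN1 0) (sem chain_cost s)"
    unfolding chain_cost_def sem.simps(3) sem.simps(2) aval.simps
  proof (rule For_invariant[where I = ?I], goal_cases)
    case 2
    show ?case by (simp add: upd_apply)
  next
    case (3 i s')
    have eq: "s' 0 = s 0" "s' vROW = s vROW" "s' vPA = s vPA" "s' vPB = s vPB" "s' vINC = s vINC"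
      by (subst 3(4); simp add: upd_apply)+
    let ?s1 = "sem chain_member s'"
    have "0 < ?s1 vMF v \<longleftrightarrow> v \<in> chn \<sigma> \<tau> i" if "v < n" for v
      using sem_chain_member[of v s'] that eq 3(3) d PA PB by (auto simp: chain_def)
    moreover have "chn \<sigma> \<tau> i \<subseteq> {..<n}" using mem_sub[of \<sigma>] mem_sub[of \<tau>] by (auto simp: chain_def)
    moreover have "graph_store n E ?s1"
      by (rule graph_store_cong[OF d(1)]) (simp_all add: sem_unwritten eq)
    ultimately have CNT: "sem count_boundary ?s1 vCNT 0 = card (bd (chn \<sigma> \<tau> i))"
      by (intro sem_count_boundary[OF graph]) auto
    have "sem count_boundary ?s1 vCOST = s' vCOST" by (simp add: sem_unwritten)
    then show ?case using 3(2,3) CNT by (auto simp: upd_apply less_Suc_eq)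
  qed simp
  then show ?thesis using d by (simp add: upd_apply less_Suc_eq_le)
qed

lemma sem_transition:
  assumes s: "dp_store s" and \<sigma>: "valid \<sigma>" "\<And>z. z < k \<Longrightarrow> s vD z = \<sigma> (cc z)"
    and ST: "\<And>v. v \<notin> C \<Longrightarrow> s vST v = 0" and i: "s vI 0 = i" "i < k"
  defines "\<tau> \<equiv> advance \<sigma> (cc i)"
  obtains q where
    "\<And>w. q \<le> w \<longleftrightarrow> s vF (s vT 0) \<le> w \<and> (\<forall>j\<le>n. card (bd (chn \<sigma> \<tau> j)) \<le> w)"
    "sem transition s vF = (s vF)(s vT 0 + 3 ^ i := min q (s vF (s vT 0 + 3 ^ i)))"
    "\<And>v. v \<notin> C \<Longrightarrow> sem transition s vST v = 0"
proof -
  note d = dp_storeD[OF s]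
  define s1 where "s1 = sem load_status s"
  define s2 where "s2 = sem (member vPA) s1"
  define s3 where "s3 = upd s2 vST (s2 vC (s2 vI 0)) (s2 vD (s2 vI 0) + 1)"
  define s4 where "s4 = sem (member vPB) s3"
  define s5 where "s5 = sem chain_cost s4"
  have s1: "s1 x = s x" if "x \<notin> {vZ, vST}" for x
    using that by (simp add: s1_def sem_unwritten)
  have s2: "s2 x = s1 x" if "x \<notin> {vU, vW, vFLAG, vANY, vPA}" for x
    using that by (simp add: s2_def sem_unwritten)
  have s3: "s3 x = s2 x" if "x \<noteq> vST" for x
    using that by (simp add: s3_def upd_apply)
  have s4: "s4 x = s3 x" if "x \<notin> {vU, vW, vFLAG, vANY, vPB}" for x
    using that by (simp add: s4_def sem_unwritten)
  have s5: "s5 x = s4 x" if "x \<notin> {vCOST, vB, vU, vMF, vCNT, vW, vFLAG}" for x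
    using that by (simp add: s5_def sem_unwritten)
  have ST1: "s1 vST = \<sigma>" unfolding s1_def by (rule sem_load_status[OF s \<sigma> ST])
  have ST3: "s3 vST = \<tau>"
    using ST1 i d(6)[OF i(2)] \<sigma>(2)[OF i(2)]
    by (simp add: s3_def upd_apply s2 s1 \<tau>_def advance_def)
  have "dp_store s1" by (rule dp_store_cong[OF s]) (auto simp: s1)
  note d1 = dp_storeD[OF this]
  have "dp_store s3" by (rule dp_store_cong[OF \<open>dp_store s1\<close>]) (auto simp: s3 s2)
  note d3 = dp_storeD[OF this]
  have dp4: "dp_store s4" by (rule dp_store_cong[OF \<open>dp_store s3\<close>]) (auto simp: s4)
  have PA2: "0 < s2 vPA v \<longleftrightarrow> v \<in> mem \<sigma>" if "v < n" for v
    unfolding s2_def ST1[symmetric] by (rule sem_member[OF d1(1,8)]) (use that in simp_all)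
  have PA: "0 < s4 vPA v \<longleftrightarrow> v \<in> mem \<sigma>" if "v < n" for v
    using PA2[OF that] by (simp add: s4 s3)
  have PB: "0 < s4 vPB v \<longleftrightarrow> v \<in> mem \<tau>" if "v < n" for v
    unfolding s4_def ST3[symmetric] by (rule sem_member[OF d3(1,8)]) (use that in simp_all)
  have F: "s4 vF = s vF" "s4 vT = s vT" "s5 vF = s vF" "s5 vT = s vT" "s5 vI = s vI" "s5 vPOW = s vPOW"
    by (simp_all add: s5 s4 s3 s2 s1)
  have q: "s5 vCOST 0 \<le> w \<longleftrightarrow> s vF (s vT 0) \<le> w \<and> (\<forall>j\<le>n. card (bd (chn \<sigma> \<tau> j)) \<le> w)" for w
    using sem_chain_cost[OF dp4 PA PB, of w] F by (simp add: s5_def)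
  have fin: "sem transition s = sem (When (Var vCOST) (Arr vF (Plus (Var vT) (Arr vPOW (Var vI))))
       (Asg vF (Plus (Var vT) (Arr vPOW (Var vI))) (Var vCOST))) s5"
    by (simp add: transition_def s5_def s4_def s3_def s2_def s1_def)
  have "sem transition s vF = (s vF)(s vT 0 + 3 ^ i := min (s5 vCOST 0) (s vF (s vT 0 + 3 ^ i)))"
    unfolding fin using F i d(7)[OF i(2)] by (auto simp: upd_apply min_def)
  moreover have "sem transition s vST v = 0" if "v \<notin> C" for v
  proof -
    have "sem transition s vST = s3 vST" unfolding fin by (simp add: upd_apply s5 s4)
    then show ?thesis using ST3 that \<sigma>(1) cc_in[OF i(2)] by (auto simp: \<tau>_def advance_def valid_def)
  qed
  ultimately show ?thesis using q that by blast
qed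

text \<open>At every moment, a table entry is a cost within which the canonical set of its state can
  be built.\<close>

definition sound :: "(nat \<Rightarrow> nat) \<Rightarrow> bool" where
  "sound F \<longleftrightarrow> (\<forall>\<sigma>. valid \<sigma> \<longrightarrow> reach (F (index \<sigma>)) (mem \<sigma>))"

text \<open>In terms of thresholds: the entry of the raised status is at most the maximum of the
  entry of \<open>\<sigma>\<close> and the cost of the chain.\<close>

definition relaxed :: "(nat \<Rightarrow> nat) \<Rightarrow> (nat \<Rightarrow> nat) \<Rightarrow> nat \<Rightarrow> bool" where
  "relaxed F \<sigma> z \<longleftrightarrow> (\<forall>w. F (index \<sigma>) \<le> w \<longrightarrow>
     (\<forall>j\<le>n. card (bd (chn \<sigma> (advance \<sigma> (cc z)) j)) \<le> w) \<longrightarrow> F (index \<sigma> + 3 ^ z) \<le> w)"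

text \<open>Entries only decrease, and the entry of a processed state is final because later updates
  concern larger indices. So a transition, once relaxed, remains relaxed.\<close>

lemma relaxed_mono:
  assumes "relaxed F \<sigma> z" "F' (index \<sigma>) = F (index \<sigma>)" "\<And>x. F' x \<le> F x"
  shows "relaxed F' \<sigma> z"
  using assms unfolding relaxed_def by (metis le_trans)

lemma sem_transitions:
  assumes s: "dp_store s" and \<sigma>: "valid \<sigma>" "\<And>z. z < k \<Longrightarrow> s vD z = \<sigma> (cc z)"
    and ST: "\<And>v. v \<notin> C \<Longrightarrow> s vST v = 0" and t: "s vT 0 = index \<sigma>"
    and F: "sound (s vF)"
  defines "F' \<equiv> sem transitions s vF"
  shows "sound F'" "\<And>x. F' x \<le> s vF x" "\<And>x. x \<le> index \<sigma> \<Longrightarrow> F' x = s vF x"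
    "\<And>z. z < k \<Longrightarrow> \<sigma> (cc z) < 2 \<Longrightarrow> relaxed F' \<sigma> z"
    "\<And>v. v \<notin> C \<Longrightarrow> sem transitions s vST v = 0"
proof -
  note d = dp_storeD[OF s]
  let ?I = "\<lambda>i (s' :: store). sound (s' vF) \<and> (\<forall>x. s' vF x \<le> s vF x) \<and>
    (\<forall>x\<le>index \<sigma>. s' vF x = s vF x) \<and> (\<forall>z<i. \<sigma> (cc z) < 2 \<longrightarrow> relaxed (s' vF) \<sigma> z) \<and>
    (\<forall>v. v \<notin> C \<longrightarrow> s' vST v = 0)"
  have "?I (s vK 0) (sem transitions s)"
    unfolding transitions_def
  proof (rule For_invariant[where I = ?I], goal_cases)
    case 2
    show ?case using F ST by (simp add: upd_apply)
  next
    case (3 i s')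
    have i: "i < k" "s' vI 0 = i" using 3(1,3) d by simp_all
    have dp: "dp_store s'" by (rule dp_store_cong[OF s], rule 3(4)) auto
    have eq: "s' vD = s vD" "s' vT = s vT" by (rule 3(4); simp)+
    have D: "s' vD z = \<sigma> (cc z)" if "z < k" for z using \<sigma>(2)[OF that] eq by simp
    have ST': "s' vST v = 0" if "v \<notin> C" for v using 3(2) that by simp
    show ?case
    proof (cases "\<sigma> (cc i) < 2")
      case False
      then show ?thesis using 3(2) i D[OF i(1)] by (auto simp: upd_apply less_Suc_eq)
    next
      case True
      let ?\<tau> = "advance \<sigma> (cc i)" and ?G = "sem transition s' vF"
      obtain q where q: "\<And>w. q \<le> w \<longleftrightarrow> s' vF (s' vT 0) \<le> w \<and> (\<forall>j\<le>n. card (bd (chn \<sigma> ?\<tau> j)) \<le> w)"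
        and G: "?G = (s' vF)(s' vT 0 + 3 ^ i := min q (s' vF (s' vT 0 + 3 ^ i)))"
        and ST2: "\<And>v. v \<notin> C \<Longrightarrow> sem transition s' vST v = 0"
        using sem_transition[OF dp \<sigma>(1) D ST' i(2,1)] by blast
      have t': "s' vT 0 = index \<sigma>" using t eq by simp
      have le: "?G x \<le> s' vF x" for x by (simp add: G)
      have same: "?G x = s' vF x" if "x \<le> index \<sigma>" for x
      proof -
        have "0 < (3::nat) ^ i" by simp
        then have "x \<noteq> index \<sigma> + 3 ^ i" using that by linarith
        then show ?thesis by (simp add: G t')
      qed
      have \<tau>: "valid ?\<tau>" "index ?\<tau> = index \<sigma> + 3 ^ i"
        using valid_advance[OF \<sigma>(1) cc_in True] index_advance i by auto
      have "sound ?G"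
        unfolding sound_def
      proof (intro allI impI)
        fix \<rho> assume \<rho>: "valid \<rho>"
        show "reach (?G (index \<rho>)) (mem \<rho>)"
        proof (cases "index \<rho> = index ?\<tau> \<and> q < s' vF (index ?\<tau>)")
          case True
          then have "\<rho> = ?\<tau>" using index_inject \<rho> \<tau>(1) by blast
          have "s' vF (index \<sigma>) \<le> q" "\<And>j. j \<le> n \<Longrightarrow> card (bd (chn \<sigma> ?\<tau> j)) \<le> q"
            using q[of q] t' by auto
          moreover have "reach (s' vF (index \<sigma>)) (mem \<sigma>)" using 3(2) \<sigma>(1) unfolding sound_def by blast
          ultimately have "reach q (mem ?\<tau>)"
            by (intro reach_advance cc_in i) (auto intro: reachable_mono)
          then show ?thesis using True \<open>\<rho> = ?\<tau>\<close> \<tau>(2) by (simp add: G t')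
        next
          case False
          then have "?G (index \<rho>) = s' vF (index \<rho>)" using \<tau>(2) by (auto simp: G t')
          then show ?thesis using 3(2) \<rho> by (simp add: sound_def)
        qed
      qed
      moreover have "relaxed ?G \<sigma> i"
        using q same[of "index \<sigma>"] by (auto simp: relaxed_def G t' min_le_iff_disj)
      moreover have "relaxed ?G \<sigma> z" if "relaxed (s' vF) \<sigma> z" for z
        using that by (rule relaxed_mono) (simp_all add: le same)
      moreover have "\<forall>x. ?G x \<le> s vF x" using le 3(2) by (meson le_trans)
      ultimately show ?thesis
        using 3(2) i D[OF i(1)] True ST2 same by (auto simp: upd_apply less_Suc_eq)
    qed
  qed simp
  then show "sound F'" "\<And>x. F' x \<le> s vF x" "\<And>x. x \<le> index \<sigma> \<Longrightarrow> F' x = s vF x"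
    "\<And>z. z < k \<Longrightarrow> \<sigma> (cc z) < 2 \<Longrightarrow> relaxed F' \<sigma> z"
    "\<And>v. v \<notin> C \<Longrightarrow> sem transitions s vST v = 0"
    using d by (auto simp: F'_def)
qed

lemma sem_dynamic_program:
  assumes s: "dp_store s" and D: "\<And>z. z < k \<Longrightarrow> s vD z = 0"
    and ST: "\<And>v. v \<notin> C \<Longrightarrow> s vST v = 0"
    and F: "sound (s vF)" "s vF 0 = 0"
  defines "F' \<equiv> sem dynamic_program s vF"
  shows "sound F'" "F' 0 = 0" "\<And>\<sigma> z. valid \<sigma> \<Longrightarrow> z < k \<Longrightarrow> \<sigma> (cc z) < 2 \<Longrightarrow> relaxed F' \<sigma> z"
    "sem dynamic_program s vOUT 0 = F' (3 ^ k - 1)"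
proof -
  note d = dp_storeD[OF s]
  \<comment> \<open>The digits are tied to \<open>t\<close> only while \<open>t < 3 ^ k\<close>,
    because the last round increments the counter beyond its range.\<close>
  let ?I = "\<lambda>t (s' :: store). sound (s' vF) \<and> s' vF 0 = 0 \<and>
    (\<forall>\<sigma> z. valid \<sigma> \<longrightarrow> z < k \<longrightarrow> \<sigma> (cc z) < 2 \<longrightarrow> index \<sigma> < t \<longrightarrow> relaxed (s' vF) \<sigma> z) \<and>
    (0 < t \<longrightarrow> s' vOUT 0 = s' vF (t - 1)) \<and> (\<forall>v. v \<notin> C \<longrightarrow> s' vST v = 0) \<and>
    (t < 3 ^ k \<longrightarrow> number k (s' vD) = t \<and> (\<forall>z<k. s' vD z \<le> 2))"
  have "?I (s vL2 0) (sem dynamic_program s)"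
    unfolding dynamic_program_def
  proof (rule For_invariant[where I = ?I], goal_cases)
    case 2
    show ?case using F ST D by (simp add: upd_apply number_zero)
  next
    case (3 t s')
    have t: "t < 3 ^ k" using 3(1) d by simp
    then have digits: "number k (s' vD) = t" "\<And>z. z < k \<Longrightarrow> s' vD z \<le> 2" using 3(2) by auto
    obtain \<sigma> where \<sigma>: "valid \<sigma>" "\<And>z. z < k \<Longrightarrow> \<sigma> (cc z) = s' vD z" "index \<sigma> = t"
      by (rule valid_of_digits[of "s' vD"]) (use digits in auto)
    let ?s1 = "upd s' vOUT 0 (s' vF t)"
    let ?s2 = "sem transitions ?s1" and ?s3 = "sem (increment vK) (sem transitions ?s1)"
    have dp1: "dp_store ?s1"
    proof (rule dp_store_cong[OF s])
      fix x assume "x \<in> {0, vROW, vN1, vK, vL2, vC, vPOW, vINC}"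
      then have "s' x = s x" "x \<noteq> vOUT" by (intro 3(4), auto)
      then show "?s1 x = s x" by (simp add: upd_apply)
    qed
    have "?s1 vD z = \<sigma> (cc z)" if "z < k" for z using \<sigma>(2)[OF that] by (simp add: upd_apply)
    moreover have "?s1 vST v = 0" if "v \<notin> C" for v using 3(2) that by (simp add: upd_apply)
    moreover have "?s1 vT 0 = index \<sigma>" using 3(3) \<sigma>(3) by (simp add: upd_apply)
    moreover have "sound (?s1 vF)" using 3(2) by (simp add: upd_apply)
    ultimately have tr: "sound (?s2 vF)" "\<And>x. ?s2 vF x \<le> s' vF x" "\<And>x. x \<le> t \<Longrightarrow> ?s2 vF x = s' vF x"
      "\<And>z. z < k \<Longrightarrow> \<sigma> (cc z) < 2 \<Longrightarrow> relaxed (?s2 vF) \<sigma> z" "\<And>v. v \<notin> C \<Longrightarrow> ?s2 vST v = 0"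
      using sem_transitions[OF dp1 \<sigma>(1)] \<sigma>(3) by (simp_all add: upd_apply)
    have eq: "?s3 vF = ?s2 vF" "?s3 vST = ?s2 vST" "?s3 vOUT 0 = s' vF t" "?s2 vD = s' vD" "?s2 vK 0 = k"
      using dp_storeD(3)[OF dp1] by (simp_all add: sem_unwritten upd_apply)
    have "relaxed (?s2 vF) \<rho> z"
      if "valid \<rho>" "z < k" "\<rho> (cc z) < 2" "index \<rho> < Suc t" for \<rho> z
    proof (cases "index \<rho> = t")
      case True
      then have "\<rho> = \<sigma>" using index_inject that(1) \<sigma>(1,3) by blast
      then show ?thesis using tr(4) that by blast
    next
      case False
      then have "relaxed (s' vF) \<rho> z" using 3(2) that by auto
      then show ?thesis by (rule relaxed_mono) (use tr that in auto)
    qed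
    moreover have "number k (?s3 vD) = Suc t" "z < k \<Longrightarrow> ?s3 vD z \<le> 2" if "Suc t < 3 ^ k" for z
      using sem_increment[of ?s2 vK k] eq digits that by auto
    moreover have body: "sem (Set vOUT (Arr vF (Var vT)) ;; transitions ;; increment vK) s' = ?s3"
      using 3(3) by simp
    moreover have "?s3 vF 0 = 0" using tr(3)[of 0] 3(2) eq(1) by simp
    ultimately show ?case
      unfolding body using tr(1,5) eq(1,2,3) tr(3)[of t] by (simp add: upd_apply)
  qed simp
  then have I: "?I (3 ^ k) (sem dynamic_program s)" using d by simp
  then show "sound F'" "F' 0 = 0" "sem dynamic_program s vOUT 0 = F' (3 ^ k - 1)"
    by (simp_all add: F'_def)
  show "\<And>\<sigma> z. valid \<sigma> \<Longrightarrow> z < k \<Longrightarrow> \<sigma> (cc z) < 2 \<Longrightarrow> relaxed F' \<sigma> z"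
    using I index_less by (simp add: F'_def)
qed

lemma sem_initialise:
  assumes s: "dp_store s"
  defines "s' \<equiv> sem initialise s"
  shows "\<And>z. z < k \<Longrightarrow> s' vD z = 0" "s' vF 0 = 0" "sound (s' vF)"
proof -
  note d = dp_storeD[OF s]
  define s1 where "s1 = sem (For vT vL2 (Asg vF (Var vT) (Arr 0 (Num 0)))) s"
  define s2 where "s2 = upd s1 vF 0 0"
  let ?I = "\<lambda>i (s' :: store). \<forall>x<i. s' vF x = n"
  have "?I (s vL2 0) s1"
    unfolding s1_def
  proof (rule For_invariant[where I = ?I], goal_cases)
    case (3 i s')
    have "s' 0 = s 0" by (rule 3(4)) simp_all
    then show ?case using 3(2,3) d by (simp add: upd_apply less_Suc_eq)
  qed simp_all
  then have F1: "s1 vF x = n" if "x < 3 ^ k" for x using d that by simp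
  have s': "s' = sem (For vI vK (Asg vD (Var vI) (Num 0))) s2"
    by (simp add: s'_def initialise_def s2_def s1_def)
  have "s2 vK = s vK" by (simp add: s2_def s1_def upd_apply sem_unwritten del: sem.simps(5))
  let ?J = "\<lambda>i (s' :: store). \<forall>z<i. s' vD z = 0"
  have "?J (s2 vK 0) s'"
    unfolding s'
  proof (rule For_invariant[where I = ?J], goal_cases)
    case (3 i s')
    then show ?case by (simp add: upd_apply less_Suc_eq)
  qed simp_all
  then show "\<And>z. z < k \<Longrightarrow> s' vD z = 0" using d \<open>s2 vK = s vK\<close> by simp
  have F: "s' vF = s2 vF" unfolding s' by (rule sem_unwritten) simp
  then show "s' vF 0 = 0" by (simp add: s2_def upd_apply)
  show "sound (s' vF)"
    unfolding sound_def
  proof (intro allI impI)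
    fix \<sigma> assume \<sigma>: "valid \<sigma>"
    show "reach (s' vF (index \<sigma>)) (mem \<sigma>)"
    proof (cases "index \<sigma> = 0")
      case True
      have 0: "valid (\<lambda>_. 0)" by (simp add: valid_def)
      have "\<sigma> = (\<lambda>_. 0)"
        by (rule index_inject[OF 0 \<sigma>]) (simp add: True, simp add: index_def number_zero)
      then show ?thesis using reach_isolated True F by (simp add: s2_def upd_apply)
    next
      case False
      then have "s' vF (index \<sigma>) = n" using F F1 index_less[OF \<sigma>] by (simp add: s2_def upd_apply)
      moreover have "card (mem \<sigma>) \<le> n" using card_mono[OF _ mem_sub[of \<sigma>]] by simp
      ultimately show ?thesis
        using mem_sub[of \<sigma>] by (auto intro: reachable_card_bound finite_subset)
    qed
  qed
qed

lemma status_valid: "L \<subseteq> B \<Longrightarrow> B \<subseteq> C \<Longrightarrow> valid (status B L)"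
  by (auto simp: valid_def status_def)

text \<open>Soundness of the table shows that the output is attained. Its minimality is
  \<open>status_reachable\<close> for the statuses with entry at most \<open>w\<close>; their
  closure under raises of cost at most \<open>w\<close> is what \<open>relaxed\<close>
  provides.\<close>

theorem dynamic_program_correct:
  assumes n: "0 < n" and s: "dp_store s" and ST: "\<And>v. v \<notin> C \<Longrightarrow> s vST v = 0"
  shows "pathwidth {..<n} E = int (sem dynamic_program (sem initialise s) vOUT 0)"
proof (rule pathwidth_eq[OF graph])
  let ?s = "sem initialise s"
  have dp: "dp_store ?s" by (rule dp_store_cong[OF s], rule sem_unwritten) auto
  note init = sem_initialise[OF s]
  have ST': "?s vST v = 0" if "v \<notin> C" for v using ST[OF that] by (simp add: sem_unwritten)
  let ?F = "sem dynamic_program ?s vF"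
  have fin: "sound ?F" "?F 0 = 0"
    "\<And>\<sigma> z. valid \<sigma> \<Longrightarrow> z < k \<Longrightarrow> \<sigma> (cc z) < 2 \<Longrightarrow> relaxed ?F \<sigma> z"
    "sem dynamic_program ?s vOUT 0 = ?F (3 ^ k - 1)"
    using sem_dynamic_program[OF dp, OF init(1) ST' init(3,2)] by blast+
  have out: "sem dynamic_program ?s vOUT 0 = ?F (index (status C C))"
  proof -
    have "index (status C C) = number k (\<lambda>_. 2)"
      unfolding index_def by (rule number_cong) (simp add: status_def cc_in)
    then have "index (status C C) = 3 ^ k - 1" using number_two[of k] by simp
    then show ?thesis using fin(4) by simp
  qed
  have "mem (status C C) = {..<n}"
    using C_sub adj_cover by (auto simp: mem_status)
  moreover have "valid (status C C)" by (rule status_valid) auto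
  ultimately show "reach (sem dynamic_program ?s vOUT 0) {..<n}"
    using fin(1) out unfolding sound_def by metis
  show "{..<n} \<noteq> {}" using n by auto
  fix w assume "reach w {..<n}"
  define R where "R \<sigma> \<longleftrightarrow> ?F (index \<sigma>) \<le> w" for \<sigma>
  have "R (status ({..<n} \<inter> C) (closed {..<n}))"
  proof (rule status_reachable[of R w])
    have "index (status {} {}) = 0" by (simp add: index_def number_zero status_def)
    then show "R (status {} {})" using fin(2) by (simp add: R_def)
  next
    fix B L c
    assume "L \<subseteq> B" "B \<subseteq> C" and c: "c \<in> C" "c \<notin> L" and R: "R (status B L)"
      and cost: "\<And>j. j \<le> n \<Longrightarrow> card (bd (chn (status B L) (advance (status B L) c) j)) \<le> w"
    then have v: "valid (status B L)" by (intro status_valid)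
    obtain z where z: "z < k" "c = cc z" using cc_surj[OF c(1)] by blast
    have "status B L (cc z) < 2" using c z by (simp add: status_def)
    from fin(3)[OF v z(1) this] show "R (advance (status B L) c)"
      using R cost z index_advance[OF z(1)] by (simp add: relaxed_def R_def)
  qed fact
  moreover have "status ({..<n} \<inter> C) (closed {..<n}) = status C C"
    using C_sub closed_all by (simp add: Int_absorb1)
  ultimately show "sem dynamic_program ?s vOUT 0 \<le> w" using out by (simp add: R_def)
qed

end

section \<open>Finding a minimum vertex cover\<close>

text \<open>The state pairs a failure flag with the list of chosen vertices, and the digit consulted
  is that of the position about to be filled. Digits 1 and 2 act alike: two values would do, but in
  this way the counter of the dynamic program is reused, and \<open>3 ^ \<kappa>\<close> trials fit
  the time bound.\<close>

definition greedy_step ::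
    "nat set set \<Rightarrow> nat \<Rightarrow> (nat \<Rightarrow> nat) \<Rightarrow> nat \<Rightarrow> nat \<Rightarrow> bool \<times> nat list \<Rightarrow> bool \<times> nat list" where
  "greedy_step E \<kappa> d u w st =
     (if {u, w} \<in> E \<and> u \<notin> set (snd st) \<and> w \<notin> set (snd st)
      then if length (snd st) < \<kappa>
        then (fst st, snd st @ [if d (length (snd st)) = 0 then u else w])
        else (True, snd st)
      else st)"

definition greedy :: "nat set set \<Rightarrow> nat \<Rightarrow> nat \<Rightarrow> (nat \<Rightarrow> nat) \<Rightarrow> bool \<times> nat list" where
  "greedy E n \<kappa> d = fold (\<lambda>u. fold (greedy_step E \<kappa> d u) [0..<n]) [0..<n] (False, [])"

text \<open>Flattens the double scan, so that the inductions below run over one list of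
  pairs.\<close>

lemma fold_product:
  "fold (\<lambda>x. fold (f x) ys) xs st = fold (\<lambda>(x, y). f x y) (List.product xs ys) st"
  by (induction xs arbitrary: st) (simp_all add: fold_map comp_def)

abbreviation greedy_run where
  "greedy_run E \<kappa> d \<equiv> fold (\<lambda>(u, w). greedy_step E \<kappa> d u w)"

lemma greedy_eq_run: "greedy E n \<kappa> d = greedy_run E \<kappa> d (List.product [0..<n] [0..<n]) (False, [])"
  by (simp add: greedy_def fold_product)

lemma greedy_step_cong: "(\<And>z. z < \<kappa> \<Longrightarrow> d z = d' z) \<Longrightarrow> greedy_step E \<kappa> d = greedy_step E \<kappa> d'"
  by (intro ext) (simp add: greedy_step_def)

lemma greedy_cong: "(\<And>z. z < \<kappa> \<Longrightarrow> d z = d' z) \<Longrightarrow> greedy E n \<kappa> d = greedy E n \<kappa> d'"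
  using greedy_step_cong[of \<kappa> d d' E] by (simp add: greedy_def)

lemma greedy_step_mono:
  "set (snd st) \<subseteq> set (snd (greedy_step E \<kappa> d u w st))" "fst st \<Longrightarrow> fst (greedy_step E \<kappa> d u w st)"
  by (auto simp: greedy_step_def)

lemma greedy_run_mono:
  "set (snd st) \<subseteq> set (snd (greedy_run E \<kappa> d es st))"
  "fst st \<Longrightarrow> fst (greedy_run E \<kappa> d es st)"
proof (induction es arbitrary: st)
  case (Cons e es)
  {
    case 1
    then show ?case using Cons(1)[of "case_prod (greedy_step E \<kappa> d) e st"]
      greedy_step_mono(1)[of st E \<kappa> d "fst e" "snd e"] by (auto simp: split_beta)
  next
    case 2
    then show ?case using Cons(2)[of "case_prod (greedy_step E \<kappa> d) e st"]
      greedy_step_mono(2)[of st E \<kappa> d "fst e" "snd e"] by (auto simp: split_beta)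
  }
qed auto

lemma greedy_run_invariant:
  assumes "distinct (snd st)" "length (snd st) \<le> \<kappa>" "set (snd st) \<subseteq> V" "set es \<subseteq> V \<times> V"
  shows "distinct (snd (greedy_run E \<kappa> d es st)) \<and> length (snd (greedy_run E \<kappa> d es st)) \<le> \<kappa> \<and>
    set (snd (greedy_run E \<kappa> d es st)) \<subseteq> V"
  using assms
proof (induction es arbitrary: st)
  case (Cons e es)
  obtain u w where e: "e = (u, w)" by fastforce
  have "distinct (snd (greedy_step E \<kappa> d u w st))" "length (snd (greedy_step E \<kappa> d u w st)) \<le> \<kappa>"
    "set (snd (greedy_step E \<kappa> d u w st)) \<subseteq> V"
    using Cons.prems e by (auto simp: greedy_step_def)
  then show ?case using Cons.IH Cons.prems(4) e by simp
qed simp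

lemma greedy_run_sound:
  assumes "\<not> fst (greedy_run E \<kappa> d es st)" "(u, w) \<in> set es" "{u, w} \<in> E"
  shows "u \<in> set (snd (greedy_run E \<kappa> d es st)) \<or> w \<in> set (snd (greedy_run E \<kappa> d es st))"
  using assms
proof (induction es arbitrary: st)
  case (Cons e es)
  show ?case
  proof (cases "e = (u, w)")
    case True
    let ?st = "greedy_step E \<kappa> d u w st"
    have "\<not> fst ?st"
      using Cons.prems(1) greedy_run_mono(2)[of ?st E \<kappa> d es] True by auto
    then have "u \<in> set (snd ?st) \<or> w \<in> set (snd ?st)"
      using Cons.prems(3) by (auto simp: greedy_step_def split: if_splits)
    then show ?thesis using greedy_run_mono(1)[of ?st E \<kappa> d es] True by auto
  next
    case False
    then show ?thesis
      using Cons.IH[of "case_prod (greedy_step E \<kappa> d) e st"] Cons.prems by auto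
  qed
qed simp

text \<open>The digits follow \<open>C\<close>: at an uncovered edge they select an end in
  \<open>C\<close>. The list stays a duplicate-free part of \<open>C\<close>, so a further vertex
  always fits within \<open>\<kappa>\<close>. Digits below \<open>length cs\<close> have been
  consumed already and must be preserved, which is the purpose of \<open>d'\<close>.\<close>

lemma greedy_run_complete:
  assumes C: "finite C" "card C \<le> \<kappa>"
    and es: "\<And>u w. (u, w) \<in> set es \<Longrightarrow> {u, w} \<in> E \<Longrightarrow> u \<in> C \<or> w \<in> C"
    and "distinct cs" "set cs \<subseteq> C" "\<forall>z. d' z \<le> 2"
  shows "\<exists>d. (\<forall>z. d z \<le> 2) \<and> (\<forall>z<length cs. d z = d' z) \<and> \<not> fst (greedy_run E \<kappa> d es (False, cs))"
  using es \<open>distinct cs\<close> \<open>set cs \<subseteq> C\<close> \<open>\<forall>z. d' z \<le> 2\<close>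
proof (induction es arbitrary: cs d')
  case Nil
  then show ?case by (intro exI[of _ d']) simp
next
  case (Cons e es)
  obtain u w where e: "e = (u, w)" by fastforce
  have es: "\<And>u w. (u, w) \<in> set es \<Longrightarrow> {u, w} \<in> E \<Longrightarrow> u \<in> C \<or> w \<in> C" using Cons.prems(1) by simp
  show ?case
  proof (cases "{u, w} \<in> E \<and> u \<notin> set cs \<and> w \<notin> set cs")
    case False
    then have "greedy_step E \<kappa> d u w (False, cs) = (False, cs)" for d
      by (auto simp: greedy_step_def)
    then show ?thesis using Cons.IH[OF es Cons.prems(2-4)] e by simp
  next
    case True
    let ?x = "if u \<in> C then u else w"
    have x: "?x \<in> C" "?x \<notin> set cs" using True Cons.prems(1)[of u w] e by auto
    have cs': "distinct (cs @ [?x])" "set (cs @ [?x]) \<subseteq> C" using Cons.prems x by auto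
    have "card (set (cs @ [?x])) \<le> card C" using C(1) cs'(2) by (rule card_mono)
    then have len: "length cs < \<kappa>" using C(2) distinct_card[OF cs'(1)] by simp
    let ?d = "d'(length cs := if u \<in> C then 0 else 1)"
    have d2: "\<forall>z. ?d z \<le> 2" using Cons.prems(4) by simp
    obtain d where d: "\<forall>z. d z \<le> 2" "\<forall>z<length (cs @ [?x]). d z = ?d z"
      "\<not> fst (greedy_run E \<kappa> d es (False, cs @ [?x]))"
      using Cons.IH[OF es cs' d2] by blast
    have "d (length cs) = (if u \<in> C then 0 else 1)" using d(2) by simp
    then have "greedy_step E \<kappa> d u w (False, cs) = (False, cs @ [?x])"
      using True len by (simp add: greedy_step_def)
    then show ?thesis using d e by (intro exI[of _ d]) auto
  qed
qed

lemma greedy_sound: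
  assumes G: "simple_graph {..<n} E" and ok: "\<not> fst (greedy E n \<kappa> d)"
  shows "distinct (snd (greedy E n \<kappa> d))" "length (snd (greedy E n \<kappa> d)) \<le> \<kappa>"
    "vertex_cover {..<n} E (set (snd (greedy E n \<kappa> d)))"
proof -
  let ?es = "List.product [0..<n] [0..<n]"
  have inv: "distinct (snd (greedy E n \<kappa> d)) \<and> length (snd (greedy E n \<kappa> d)) \<le> \<kappa> \<and>
    set (snd (greedy E n \<kappa> d)) \<subseteq> {..<n}"
    unfolding greedy_eq_run by (rule greedy_run_invariant) auto
  then show "distinct (snd (greedy E n \<kappa> d))" "length (snd (greedy E n \<kappa> d)) \<le> \<kappa>" by auto
  have "e \<inter> set (snd (greedy E n \<kappa> d)) \<noteq> {}" if "e \<in> E" for e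
  proof -
    from edge_ends[OF G that] obtain u w where e: "e = {u, w}" "u \<in> {..<n}" "w \<in> {..<n}" by metis
    then have "(u, w) \<in> set ?es" by simp
    from greedy_run_sound[OF _ this] ok e that show ?thesis unfolding greedy_eq_run by blast
  qed
  then show "vertex_cover {..<n} E (set (snd (greedy E n \<kappa> d)))"
    using inv by (simp add: vertex_cover_def)
qed

lemma greedy_complete:
  assumes C: "vertex_cover {..<n} E C" "card C \<le> \<kappa>"
  shows "\<exists>d. (\<forall>z. d z \<le> 2) \<and> \<not> fst (greedy E n \<kappa> d)"
proof -
  have "finite C" using C(1) by (auto simp: vertex_cover_def intro: finite_subset)
  moreover have "u \<in> C \<or> w \<in> C" if "{u, w} \<in> E" for u w
    using C(1) that by (auto simp: vertex_cover_def)
  ultimately have "\<exists>d. (\<forall>z. d z \<le> 2) \<and> (\<forall>z<length ([] :: nat list). d z = 0) \<and>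
      \<not> fst (greedy_run E \<kappa> d (List.product [0..<n] [0..<n]) (False, []))"
    by (intro greedy_run_complete[OF _ C(2), where d' = "\<lambda>_. 0" and cs = "[]"]) auto
  then show ?thesis unfolding greedy_eq_run by blast
qed

lemma vertex_cover_number_attained:
  assumes "simple_graph V E"
  obtains C where "vertex_cover V E C" "card C = vertex_cover_number V E"
proof -
  have "vertex_cover V E V"
    unfolding vertex_cover_def
  proof (intro conjI ballI)
    fix e assume "e \<in> E"
    then obtain u v where "e = {u, v}" "u \<in> V" using edge_ends[OF assms] by metis
    then show "e \<inter> V \<noteq> {}" by auto
  qed simp
  then have "\<exists>k C. vertex_cover V E C \<and> card C = k" by blast
  from LeastI_ex[OF this] show ?thesis using that unfolding vertex_cover_number_def by blast
qed

lemma vertex_cover_number_le_order: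
  assumes "simple_graph {..<n} E"
  shows "vertex_cover_number {..<n} E \<le> n"
proof -
  obtain C where "vertex_cover {..<n} E C" "card C = vertex_cover_number {..<n} E"
    using vertex_cover_number_attained[OF assms] .
  then show ?thesis using card_mono[of "{..<n}" C] by (simp add: vertex_cover_def)
qed

section \<open>The cover search as a loop program\<close>

definition clear_cover :: cmd where
  "clear_cover = For vU 0 (Asg vINC (Var vU) (Num 0)) ;; Set vJ (Num 0) ;; Set vFAIL (Num 0)"

definition consider_edge :: cmd where
  "consider_edge = When (Num 0) adj (When (Plus (Arr vINC (Var vU)) (Arr vINC (Var vW))) (Num 1)
     (Less (Var vJ) (Var vKA)
       (Less (Arr vD (Var vJ)) (Num 1) (Set vX (Var vU)) (Set vX (Var vW)) ;;
        Asg vC (Var vJ) (Var vX) ;; Asg vINC (Var vX) (Num 1) ;; Set vJ (Plus (Var vJ) (Num 1)))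
       (Set vFAIL (Num 1))))"

lemma writes_consider_edge [simp]: "writes consider_edge = {vX, vC, vINC, vJ, vFAIL}"
  by (auto simp: consider_edge_def)

definition try_cover :: cmd where
  "try_cover = clear_cover ;; For vU 0 (For vW 0 consider_edge) ;;
     When (Var vFAIL) (Num 1) (Set vFOUND (Num 1) ;; Set vK (Var vJ))"

lemma writes_clear_cover [simp]: "writes clear_cover = {vU, vINC, vJ, vFAIL}"
  by (auto simp: clear_cover_def)

lemma writes_try_cover [simp]: "writes try_cover = {vU, vINC, vJ, vFAIL, vW, vX, vC, vFOUND, vK}"
  by (auto simp: try_cover_def)

definition cover_store :: "nat \<Rightarrow> store \<Rightarrow> bool \<times> nat list \<Rightarrow> bool" where
  "cover_store n s st \<longleftrightarrow> s vJ 0 = length (snd st) \<and> (\<forall>z<length (snd st). s vC z = snd st ! z) \<and>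
     (\<forall>v<n. 0 < s vINC v \<longleftrightarrow> v \<in> set (snd st)) \<and> (0 < s vFAIL 0 \<longleftrightarrow> fst st)"

lemma cover_store_cong:
  "cover_store n s st \<Longrightarrow> (\<And>x. x \<in> {vJ, vC, vINC, vFAIL} \<Longrightarrow> s' x = s x) \<Longrightarrow> cover_store n s' st"
  by (simp add: cover_store_def)

lemma sem_clear_cover:
  assumes "s 0 0 = n"
  shows "cover_store n (sem clear_cover s) (False, [])"
proof -
  let ?I = "\<lambda>i (s' :: store). \<forall>v<i. s' vINC v = 0"
  have "?I (s 0 0) (sem (For vU 0 (Asg vINC (Var vU) (Num 0))) s)"
    by (rule For_invariant[where I = ?I]) (auto simp: upd_apply less_Suc_eq)
  then show ?thesis
    using assms by (simp add: clear_cover_def cover_store_def upd_apply del: sem.simps(5))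
qed

lemma sem_consider_edge:
  assumes g: "graph_store n E s" and uw: "s vU 0 = u" "s vW 0 = w" "u < n" "w < n"
    and st: "cover_store n s st"
  shows "cover_store n (sem consider_edge s) (greedy_step E (s vKA 0) (s vD) u w st)"
proof -
  have adj: "0 < aval adj s \<longleftrightarrow> {u, w} \<in> E" using aval_adj[OF g] uw by simp
  have INC: "s vINC u + s vINC w < 1 \<longleftrightarrow> u \<notin> set (snd st) \<and> w \<notin> set (snd st)"
    using st uw by (auto simp: cover_store_def)
  show ?thesis
  proof (cases "{u, w} \<in> E \<and> u \<notin> set (snd st) \<and> w \<notin> set (snd st)")
    case False
    then have "sem consider_edge s = s"
      using adj INC uw by (auto simp: consider_edge_def)
    then show ?thesis using False st by (auto simp: greedy_step_def)
  next
    case True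
    then have c: "sem consider_edge s = sem
       (Less (Var vJ) (Var vKA)
       (Less (Arr vD (Var vJ)) (Num 1) (Set vX (Var vU)) (Set vX (Var vW)) ;;
        Asg vC (Var vJ) (Var vX) ;; Asg vINC (Var vX) (Num 1) ;; Set vJ (Plus (Var vJ) (Num 1)))
       (Set vFAIL (Num 1))) s"
      using adj INC uw by (simp add: consider_edge_def)
    show ?thesis
      unfolding c using True st uw
      by (auto simp: cover_store_def greedy_step_def upd_apply nth_append less_Suc_eq)
  qed
qed

lemma sem_scan_edges:
  assumes g: "graph_store n E s" and st: "cover_store n s (False, [])"
  shows "cover_store n (sem (For vU 0 (For vW 0 consider_edge)) s) (greedy E n (s vKA 0) (s vD))"
proof -
  let ?step = "greedy_step E (s vKA 0) (s vD)"
  let ?I = "\<lambda>i (s' :: store). cover_store n s' (fold (\<lambda>u. fold (?step u) [0..<n]) [0..<i] (False, []))"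
  have "?I (s 0 0) (sem (For vU 0 (For vW 0 consider_edge)) s)"
  proof (rule For_invariant[where I = ?I], goal_cases)
    case 2
    show ?case using st by (simp add: cover_store_def upd_apply)
  next
    case (3 i s')
    have i: "i < n" using 3(1) graph_store_size[OF g] by simp
    have eq: "s' 0 = s 0" "s' vROW = s vROW" "s' vKA = s vKA" "s' vD = s vD" by (rule 3(4); simp)+
    define st0 where "st0 = fold (\<lambda>u. fold (?step u) [0..<n]) [0..<i] (False, [])"
    let ?J = "\<lambda>j (s' :: store). cover_store n s' (fold (?step i) [0..<j] st0)"
    have "?J (s' 0 0) (sem (For vW 0 consider_edge) s')"
    proof (rule For_invariant[where I = ?J], goal_cases)
      case 2
      show ?case using 3(2) by (simp add: cover_store_def upd_apply st0_def)
    next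
      case prems: (3 j s2)
      have eq2: "s2 0 = s 0" "s2 vROW = s vROW" "s2 vKA = s vKA" "s2 vD = s vD" "s2 vU = s' vU"
        using eq by (simp_all add: prems(4))
      have "cover_store n (sem consider_edge s2)
          (greedy_step E (s2 vKA 0) (s2 vD) i j (fold (?step i) [0..<j] st0))"
        by (rule sem_consider_edge[OF graph_store_cong[OF g eq2(1,2)]])
          (use prems eq2 3(3) i eq graph_store_size[OF g] in auto)
      then show ?case using eq2
        by (auto elim!: cover_store_cong simp: upd_apply)
    qed simp
    then have "cover_store n (sem (For vW 0 consider_edge) s') (fold (?step i) [0..<n] st0)"
      using eq graph_store_size[OF g] by simp
    then show ?case unfolding st0_def
      by (auto elim!: cover_store_cong simp: upd_apply)
  qed simp
  then show ?thesis using graph_store_size[OF g] by (simp add: greedy_def)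
qed

definition cover_found :: "nat \<Rightarrow> nat set set \<Rightarrow> store \<Rightarrow> bool" where
  "cover_found n E s \<longleftrightarrow> (\<exists>cs. distinct cs \<and> vertex_cover {..<n} E (set cs) \<and> s vK 0 = length cs \<and>
     (\<forall>z<length cs. s vC z = cs ! z) \<and> (\<forall>v<n. 0 < s vINC v \<longleftrightarrow> v \<in> set cs))"

lemma cover_found_cong:
  "cover_found n E s \<Longrightarrow> (\<And>x. x \<in> {vK, vC, vINC} \<Longrightarrow> s' x = s x) \<Longrightarrow> cover_found n E s'"
  by (simp add: cover_found_def)

lemma sem_try_cover:
  assumes G: "simple_graph {..<n} E" and g: "graph_store n E s" and "s vFOUND 0 = 0"
  shows "if fst (greedy E n (s vKA 0) (s vD)) then sem try_cover s vFOUND 0 = 0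
    else 0 < sem try_cover s vFOUND 0 \<and> cover_found n E (sem try_cover s) \<and> sem try_cover s vK 0 \<le> s vKA 0"
proof -
  let ?r = "greedy E n (s vKA 0) (s vD)"
  define s1 where "s1 = sem (For vU 0 (For vW 0 consider_edge)) (sem clear_cover s)"
  have "graph_store n E (sem clear_cover s)"
    by (rule graph_store_cong[OF g]) (simp_all add: sem_unwritten)
  from sem_scan_edges[OF this sem_clear_cover[of s n, OF graph_store_size[OF g]]]
  have st: "cover_store n s1 ?r" by (simp add: s1_def sem_unwritten del: sem.simps(5))
  have FOUND: "s1 vFOUND 0 = 0" using assms(3) by (simp add: s1_def sem_unwritten del: sem.simps(5))
  have fin: "sem try_cover s = sem (When (Var vFAIL) (Num 1) (Set vFOUND (Num 1) ;; Set vK (Var vJ))) s1"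
    by (simp add: try_cover_def s1_def)
  show ?thesis
  proof (cases "fst ?r")
    case True
    then show ?thesis using st FOUND unfolding fin by (simp add: cover_store_def)
  next
    case False
    have s': "sem try_cover s = upd (upd s1 vFOUND 0 1) vK 0 (length (snd ?r))"
      using st False unfolding fin by (simp add: cover_store_def upd_apply)
    have "cover_found n E (sem try_cover s)"
      unfolding cover_found_def s'
      by (rule exI[of _ "snd ?r"])
        (use greedy_sound[OF G False] st in \<open>simp add: cover_store_def upd_apply\<close>)
    then show ?thesis using False greedy_sound(2)[OF G False] s' by (simp add: upd_apply)
  qed
qed

definition tries :: cmd where
  "tries = For vB vL (When (Var vFOUND) (Num 1) (try_cover ;; increment vKA))"

lemma writes_tries [simp]: "writes tries =
    {vB, vU, vINC, vJ, vFAIL, vW, vX, vC, vFOUND, vK, vCARRY, vZ, vD}"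
  by (auto simp: tries_def)

text \<open>If every digit string of length \<open>k\<close> fails, there is no cover of size
  \<open>k\<close>, and the lower bound on the minimum rises by 1. On success the list has at most
  \<open>k\<close> vertices and is therefore a minimum cover.\<close>

lemma sem_tries:
  assumes G: "simple_graph {..<n} E" and g: "graph_store n E s" and FOUND: "s vFOUND 0 = 0"
    and k: "s vKA 0 = k" "s vL 0 = 3 ^ k" "k \<le> vertex_cover_number {..<n} E"
    and D: "\<And>z. z < k \<Longrightarrow> s vD z = 0"
  shows "if sem tries s vFOUND 0 = 0 then Suc k \<le> vertex_cover_number {..<n} E
    else cover_found n E (sem tries s) \<and> sem tries s vK 0 \<le> k"
proof -
  let ?I = "\<lambda>b (s' :: store). if s' vFOUND 0 = 0
    then (b < 3 ^ k \<longrightarrow> number k (s' vD) = b \<and> (\<forall>z<k. s' vD z \<le> 2)) \<and>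
      (\<forall>d. (\<forall>z<k. d z \<le> 2) \<longrightarrow> number k d < b \<longrightarrow> fst (greedy E n k d))
    else cover_found n E s' \<and> s' vK 0 \<le> k"
  have "?I (s vL 0) (sem tries s)"
    unfolding tries_def
  proof (rule For_invariant[where I = ?I], goal_cases)
    case 2
    show ?case using D FOUND by (simp add: upd_apply number_zero)
  next
    case (3 b s')
    have eq: "s' 0 = s 0" "s' vROW = s vROW" "s' vKA = s vKA" by (rule 3(4); simp)+
    have b: "b < 3 ^ k" using 3(1) k by simp
    show ?case
    proof (cases "s' vFOUND 0 = 0")
      case False
      then show ?thesis using 3(2) by (auto simp: upd_apply elim!: cover_found_cong)
    next
      case True
      then have D': "number k (s' vD) = b" "\<And>z. z < k \<Longrightarrow> s' vD z \<le> 2"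
        and tried: "\<And>d. (\<And>z. z < k \<Longrightarrow> d z \<le> 2) \<Longrightarrow> number k d < b \<Longrightarrow> fst (greedy E n k d)"
        using 3(2) b by auto
      let ?s1 = "sem try_cover s'" and ?s2 = "sem (increment vKA) (sem try_cover s')"
      have body: "sem (When (Var vFOUND) (Num 1) (try_cover ;; increment vKA)) s' = ?s2"
        using True by simp
      have trial: "if fst (greedy E n k (s' vD)) then ?s1 vFOUND 0 = 0
          else 0 < ?s1 vFOUND 0 \<and> cover_found n E ?s1 \<and> ?s1 vK 0 \<le> k"
      proof -
        have KA: "s' vKA 0 = k" using eq k(1) by simp
        show ?thesis using sem_try_cover[OF G graph_store_cong[OF g eq(1,2)] True] unfolding KA .
      qed
      have F2: "?s2 vFOUND = ?s1 vFOUND" "?s2 vK = ?s1 vK" by (simp_all add: sem_unwritten)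
      have C2: "cover_found n E ?s1 \<Longrightarrow> cover_found n E ?s2"
        by (erule cover_found_cong) (auto simp: sem_unwritten)
      show ?thesis
      proof (cases "fst (greedy E n k (s' vD))")
        case False
        then have "cover_found n E (upd ?s2 vB 0 (Suc b))"
          using trial C2 by (auto elim!: cover_found_cong simp: upd_apply)
        then show ?thesis unfolding body using trial False F2 by (simp add: upd_apply)
      next
        case fail: True
        have "?s1 vD = s' vD" "?s1 vKA 0 = k" using eq k(1) by (simp_all add: sem_unwritten)
        then have "number k (?s2 vD) = Suc b" "z < k \<Longrightarrow> ?s2 vD z \<le> 2" if "Suc b < 3 ^ k" for z
          using sem_increment[of ?s1 vKA k] D' that by auto
        moreover have "fst (greedy E n k d)"
          if d: "\<And>z. z < k \<Longrightarrow> d z \<le> 2" "number k d < Suc b" for d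
        proof (cases "number k d = b")
          case True
          then have "greedy E n k d = greedy E n k (s' vD)"
            using number_inject[of k d "s' vD"] D' d(1) by (intro greedy_cong) auto
          then show ?thesis using fail by simp
        next
          case False
          then show ?thesis using tried[OF d(1)] d(2) by simp
        qed
        ultimately show ?thesis unfolding body using trial fail F2 by (simp add: upd_apply)
      qed
    qed
  qed simp
  then have I: "?I (3 ^ k) (sem tries s)" using k by simp
  show ?thesis
  proof (cases "sem tries s vFOUND 0 = 0")
    case False
    then show ?thesis using I by simp
  next
    case True
    have "vertex_cover_number {..<n} E \<noteq> k"
    proof
      assume vc: "vertex_cover_number {..<n} E = k"
      obtain C where "vertex_cover {..<n} E C" "card C = vertex_cover_number {..<n} E"
        using vertex_cover_number_attained[OF G] .
      then obtain d where "\<forall>z. d z \<le> 2" "\<not> fst (greedy E n k d)"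
        using greedy_complete[of n E C k] vc by auto
      moreover from this have "number k d < 3 ^ k" by (intro number_less) auto
      ultimately show False using I True by auto
    qed
    then show ?thesis using True k(3) by simp
  qed
qed

text \<open>Stored values may grow only by constants, so \<open>3 ^ (\<kappa> + 1)\<close> is built
  by adding 3 in each of \<open>3 ^ \<kappa>\<close> rounds. The result waits in
  \<open>vCNT\<close>: \<open>vL\<close> is a limit inside this command, and \<open>steps_le\<close>
  applies only if the command does not write it. \<open>search_body\<close> copies it
  afterwards.\<close>

definition search_round :: cmd where
  "search_round = For vI vKA (Asg vD (Var vI) (Num 0)) ;; tries ;; Set vCNT (Num 0) ;;
     For vB vL (Set vCNT (Plus (Var vCNT) (Num 3))) ;;
     Asg vPOW (Plus (Var vKA) (Num 1)) (Var vCNT)"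

lemma writes_search_round [simp]: "writes search_round =
    {vB, vU, vINC, vJ, vFAIL, vW, vX, vC, vFOUND, vK, vCARRY, vZ, vD, vI, vCNT, vPOW}"
  by (auto simp: search_round_def)

definition search_body :: cmd where
  "search_body = When (Var vFOUND) (Num 1) (search_round ;; Set vL (Var vCNT))"

lemma writes_search_body [simp]: "writes search_body =
    {vB, vU, vINC, vJ, vFAIL, vW, vX, vC, vFOUND, vK, vCARRY, vZ, vD, vI, vCNT, vPOW, vL}"
  by (auto simp: search_body_def)

definition cover_search :: cmd where
  "cover_search = For vKA vN1 search_body"

lemma writes_cover_search [simp]: "writes cover_search =
    {vB, vU, vINC, vJ, vFAIL, vW, vX, vC, vFOUND, vK, vCARRY, vZ, vD, vI, vCNT, vPOW, vL, vKA}"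
  by (auto simp: cover_search_def)

lemma sem_search_round:
  assumes G: "simple_graph {..<n} E" and g: "graph_store n E s" and FOUND: "s vFOUND 0 = 0"
    and k: "s vKA 0 = k" "s vL 0 = 3 ^ k" "k \<le> vertex_cover_number {..<n} E"
  defines "s' \<equiv> sem search_round s"
  shows "if s' vFOUND 0 = 0 then Suc k \<le> vertex_cover_number {..<n} E
      else cover_found n E s' \<and> s' vK 0 \<le> k"
    "s' vCNT 0 = 3 ^ Suc k" "s' vPOW = (s vPOW)(Suc k := 3 ^ Suc k)"
proof -
  define s1 where "s1 = sem (For vI vKA (Asg vD (Var vI) (Num 0))) s"
  define s2 where "s2 = sem tries s1"
  define s3 where "s3 = sem (For vB vL (Set vCNT (Plus (Var vCNT) (Num 3)))) (upd s2 vCNT 0 0)"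
  have s1: "s1 x = s x" if "x \<notin> {vI, vD}" for x
    unfolding s1_def by (rule sem_unwritten) (use that in auto)
  have s2: "s2 x = s1 x" if "x \<notin> {vB, vU, vINC, vJ, vFAIL, vW, vX, vC, vFOUND, vK, vCARRY, vZ, vD}" for x
    unfolding s2_def by (rule sem_unwritten) (use that in auto)
  have s3: "s3 x = s2 x" if "x \<notin> {vB, vCNT}" for x
  proof -
    have "s3 x = upd s2 vCNT 0 0 x" unfolding s3_def by (rule sem_unwritten) (use that in auto)
    then show ?thesis using that by (simp add: upd_apply)
  qed
  have s': "s' = upd s3 vPOW (Suc (s3 vKA 0)) (s3 vCNT 0)"
    by (simp add: s'_def search_round_def s3_def s2_def s1_def)
  let ?I = "\<lambda>i (s' :: store). \<forall>z<i. s' vD z = 0"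
  have "?I (s vKA 0) s1"
    unfolding s1_def by (rule For_invariant[where I = ?I]) (auto simp: upd_apply less_Suc_eq)
  then have "s1 vD z = 0" if "z < k" for z using that k by simp
  moreover have "graph_store n E s1" by (rule graph_store_cong[OF g]) (simp_all add: s1)
  ultimately have tr: "if s2 vFOUND 0 = 0 then Suc k \<le> vertex_cover_number {..<n} E
    else cover_found n E s2 \<and> s2 vK 0 \<le> k"
    unfolding s2_def using sem_tries[OF G, of s1 k] FOUND k by (simp add: s1)
  let ?J = "\<lambda>i (s' :: store). s' vCNT 0 = 3 * i"
  have "?J (upd s2 vCNT 0 0 vL 0) s3"
    unfolding s3_def by (rule For_invariant[where I = ?J]) (auto simp: upd_apply)
  then have CNT: "s3 vCNT 0 = 3 ^ Suc k" using k by (simp add: upd_apply s2 s1)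
  have KA: "s3 vKA 0 = k" using k by (simp add: s3 s2 s1)
  show "s' vCNT 0 = 3 ^ Suc k" using CNT by (simp add: s' upd_apply)
  show "s' vPOW = (s vPOW)(Suc k := 3 ^ Suc k)"
    using CNT KA by (simp add: s' upd_apply s3 s2 s1)
  have "cover_found n E s2 \<Longrightarrow> cover_found n E s'"
    by (erule cover_found_cong) (auto simp: s' upd_apply s3)
  then show "if s' vFOUND 0 = 0 then Suc k \<le> vertex_cover_number {..<n} E
      else cover_found n E s' \<and> s' vK 0 \<le> k"
    using tr by (simp add: s' upd_apply s3)
qed

definition search_store :: "nat \<Rightarrow> nat set set \<Rightarrow> nat \<Rightarrow> store \<Rightarrow> bool" where
  "search_store n E \<kappa> s \<longleftrightarrow> (if s vFOUND 0 = 0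
     then s vL 0 = 3 ^ \<kappa> \<and> \<kappa> \<le> vertex_cover_number {..<n} E \<and> (\<forall>z\<le>\<kappa>. s vPOW z = 3 ^ z)
     else cover_found n E s \<and> s vK 0 \<le> vertex_cover_number {..<n} E \<and> (\<forall>z\<le>s vK 0. s vPOW z = 3 ^ z))"

text \<open>Stated for every intermediate round, because the running time needs that each round that
  still searches has limit \<open>3 ^ i\<close> with \<open>i\<close> at most the cover
  number.\<close>

lemma sem_cover_search_iter:
  assumes G: "simple_graph {..<n} E" and g: "graph_store n E s"
    and init: "s vFOUND 0 = 0" "s vL 0 = 1" "s vPOW 0 = 1" and i: "i \<le> s vN1 0"
  shows "search_store n E i (iter vKA search_body s i)"
proof (rule iter_invariant[where I = "search_store n E", OF _ _ _ i], goal_cases)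
  case 2
  show ?case using init by (simp add: search_store_def upd_apply)
next
  case (3 k s')
  have eq: "s' 0 = s 0" "s' vROW = s vROW" by (rule 3(4); simp)+
  show ?case
  proof (cases "s' vFOUND 0 = 0")
    case False
    then have "sem search_body s' = s'" by (simp add: search_body_def)
    then show ?thesis using 3(2) False
      by (auto simp: search_store_def upd_apply elim!: cover_found_cong)
  next
    case True
    let ?s1 = "sem search_round s'"
    have body: "sem search_body s' = upd ?s1 vL 0 (?s1 vCNT 0)"
      using True by (simp add: search_body_def)
    have k: "s' vL 0 = 3 ^ k" "k \<le> vertex_cover_number {..<n} E" "\<forall>z\<le>k. s' vPOW z = 3 ^ z"
      using 3(2) True by (auto simp: search_store_def)
    note r = sem_search_round[OF G graph_store_cong[OF g eq] True 3(3) k(1,2)]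
    have "cover_found n E ?s1 \<Longrightarrow> cover_found n E (upd (upd ?s1 vL 0 (?s1 vCNT 0)) vKA 0 (Suc k))"
      by (erule cover_found_cong) (auto simp: upd_apply)
    then show ?thesis
      unfolding body using r k(2,3) by (auto simp: search_store_def upd_apply le_Suc_eq)
  qed
qed simp

lemma sem_cover_search:
  assumes "simple_graph {..<n} E" "graph_store n E s"
    "s vFOUND 0 = 0" "s vL 0 = 1" "s vPOW 0 = 1" "s vN1 0 = Suc n"
  defines "s' \<equiv> sem cover_search s"
  shows "cover_found n E s'" "s' vK 0 \<le> vertex_cover_number {..<n} E" "\<forall>z\<le>s' vK 0. s' vPOW z = 3 ^ z"
proof -
  have "search_store n E (Suc n) s'"
    using sem_cover_search_iter[OF assms(1-5), of "Suc n"] assms(6)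
    by (simp add: s'_def cover_search_def sem_For del: sem.simps(5))
  \<comment> \<open>After \<open>n + 1\<close> rounds a cover has been found, as otherwise the cover
    number would exceed \<open>n\<close>.\<close>
  then show "cover_found n E s'" "s' vK 0 \<le> vertex_cover_number {..<n} E"
      "\<forall>z\<le>s' vK 0. s' vPOW z = 3 ^ z"
    using vertex_cover_number_le_order[OF assms(1)] by (auto simp: search_store_def split: if_splits)
qed

section \<open>The complete algorithm and its running time\<close>

text \<open>The offsets \<open>u * n\<close> are obtained by counting, for lack of a multiplication.
  \<open>vCNT\<close> may be assumed to start at 0, since the negative addresses are 0 in the
  input.\<close>

definition setup_rows :: cmd where
  "setup_rows = For vU 0 (Asg vROW (Var vU) (Var vCNT) ;;
     For vW 0 (Set vCNT (Plus (Var vCNT) (Num 1)))) ;;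
   Set vN1 (Plus (Var 0) (Num 1)) ;; Set vL (Num 1) ;; Asg vPOW (Num 0) (Num 1)"

lemma writes_setup_rows [simp]: "writes setup_rows = {vU, vROW, vW, vCNT, vN1, vL, vPOW}"
  by (auto simp: setup_rows_def)

text \<open>Kept apart from the assignment of its exponential limit \<open>vL2\<close>, so that
  \<open>steps_le\<close> applies to it.\<close>

definition solve :: cmd where
  "solve = initialise ;; dynamic_program"

definition pathwidth_cmd :: cmd where
  "pathwidth_cmd = setup_rows ;; cover_search ;; Set vL2 (Arr vPOW (Var vK)) ;; solve ;; Set 0 (Var vOUT)"

section \<open>Input encoding and overall correctness\<close>

definition input_store :: "nat \<Rightarrow> nat set set \<Rightarrow> store" where
  "input_store n E x i = (if x = 0 then nat (graph_input n E (int i)) else 0)"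

lemma graph_input_negative: "a < 0 \<Longrightarrow> graph_input n E a = 0"
proof -
  assume "a < 0"
  then have "\<not> (\<exists>u<n. \<exists>v<n. a = int (1 + u * n + v) \<and> {u, v} \<in> E)"
    using of_nat_less_0_iff by blast
  then show ?thesis using \<open>a < 0\<close> unfolding graph_input_def by simp
qed

lemma graph_input_nonneg: "0 \<le> graph_input n E a"
  by (simp add: graph_input_def)

lemma represents_input: "represents (graph_input n E) (input_store n E)"
  by (simp add: represents_def input_store_def address_def graph_input_negative graph_input_nonneg)

lemma bounded_input: "bounded (graph_input n E) (n + 1)"
  by (auto simp: bounded_def graph_input_def)

text \<open>A row-major position determines row and column by division with remainder, so the
  existential in \<open>graph_input\<close> can be met by this pair only.\<close>

lemma graph_input_adjacent:
  assumes "u < n" "w < n"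
  shows "graph_input n E (int (Suc (u * n + w))) = (if {u, w} \<in> E then 1 else 0)"
proof -
  have eq: "u' = u \<and> w' = w" if "u' * n + w' = u * n + w" "w' < n" for u' w'
  proof -
    have "(a * n + b) div n = a" if "b < n" for a b using that by simp
    then have "u' = u" using that assms(2) by metis
    then show ?thesis using that by simp
  qed
  have "(\<exists>u'<n. \<exists>w'<n. int (Suc (u * n + w)) = int (1 + u' * n + w') \<and> {u', w'} \<in> E) \<longleftrightarrow> {u, w} \<in> E"
    (is "?L \<longleftrightarrow> _")
  proof
    assume ?L
    then obtain u' w' where "w' < n" "int (Suc (u * n + w)) = int (1 + u' * n + w')" "{u', w'} \<in> E"
      by blast
    moreover from this have "u' * n + w' = u * n + w" by linarith
    ultimately show "{u, w} \<in> E" using eq by blast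
  next
    assume "{u, w} \<in> E"
    moreover have "int (Suc (u * n + w)) = int (1 + u * n + w)" by simp
    ultimately show ?L using assms by blast
  qed
  moreover have "(int (Suc (u * n + w)) = 0) = False" by (simp only: of_nat_eq_0_iff) simp
  ultimately show ?thesis by (simp only: graph_input_def if_False)
qed

lemma sem_setup_rows:
  fixes n E
  defines "s \<equiv> sem setup_rows (input_store n E)"
  shows "graph_store n E s" "s vN1 0 = Suc n" "s vL 0 = 1" "s vPOW 0 = 1"
proof -
  let ?s = "input_store n E"
  let ?I = "\<lambda>i (s' :: store). s' vCNT 0 = i * n \<and> (\<forall>u<i. s' vROW u = u * n)"
  define s1 where "s1 = sem (For vU 0 (Asg vROW (Var vU) (Var vCNT) ;;
     For vW 0 (Set vCNT (Plus (Var vCNT) (Num 1))))) ?s"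
  have n: "?s 0 0 = n" by (simp add: input_store_def graph_input_def)
  have "?I (?s 0 0) s1"
    unfolding s1_def
  proof (rule For_invariant[where I = ?I], goal_cases)
    case 2
    show ?case by (simp add: upd_apply input_store_def)
  next
    case (3 i s')
    let ?s1 = "upd s' vROW i (i * n)"
    let ?J = "\<lambda>j (s' :: store). s' vCNT 0 = i * n + j"
    let ?s2 = "sem (For vW 0 (Set vCNT (Plus (Var vCNT) (Num 1)))) ?s1"
    have "?J (?s1 0 0) ?s2"
      by (rule For_invariant[where I = ?J]) (use 3(2) in \<open>auto simp: upd_apply\<close>)
    moreover have "s' 0 = ?s 0" by (rule 3(4)) simp_all
    ultimately have CNT: "?s2 vCNT 0 = i * n + n" using n by (simp add: upd_apply)
    have ROW: "?s2 vROW = ?s1 vROW" by (rule sem_unwritten) simp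
    have body: "sem (Asg vROW (Var vU) (Var vCNT) ;; For vW 0 (Set vCNT (Plus (Var vCNT) (Num 1)))) s' = ?s2"
      using 3(2,3) by simp
    show ?case unfolding body using CNT ROW 3(2) by (auto simp: upd_apply less_Suc_eq)
  qed simp
  then have ROW: "s1 vROW u = u * n" if "u < n" for u using n that by simp
  have 0: "s1 0 = ?s 0" unfolding s1_def by (rule sem_unwritten) simp
  have s: "s = upd (upd (upd s1 vN1 0 (Suc n)) vL 0 1) vPOW 0 1"
    unfolding s_def setup_rows_def sem.simps(3) s1_def[symmetric] using 0 n by (simp add: upd_apply)
  show "s vN1 0 = Suc n" "s vL 0 = 1" "s vPOW 0 = 1" by (simp_all add: s upd_apply)
  show "graph_store n E s"
    using graph_input_adjacent[of _ n _ E] ROW n 0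
    by (auto simp: graph_store_def s upd_apply input_store_def)
qed

lemma sem_pathwidth_cmd:
  assumes G: "simple_graph {..<n} E" and n: "0 < n"
  shows "int (sem pathwidth_cmd (input_store n E) 0 0) = pathwidth {..<n} E"
proof -
  define s1 where "s1 = sem setup_rows (input_store n E)"
  define s2 where "s2 = sem cover_search s1"
  define s3 where "s3 = upd s2 vL2 0 (s2 vPOW (s2 vK 0))"
  note r = sem_setup_rows[of n E, folded s1_def]
  have 0: "s1 x = (\<lambda>_. 0)" if "x \<notin> {0, vU, vROW, vW, vCNT, vN1, vL, vPOW}" for x
    using that by (simp add: s1_def sem_unwritten input_store_def fun_eq_iff)
  have s2: "s2 x = s1 x" if "x \<in> {0, vROW, vN1, vST}" for x
    using that by (auto simp: s2_def sem_unwritten)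
  have s3: "s3 x = s2 x" if "x \<noteq> vL2" for x using that by (simp add: s3_def upd_apply)
  have FOUND: "s1 vFOUND 0 = 0" using 0 by simp
  note c = sem_cover_search[OF G r(1) FOUND r(3,4,2), folded s2_def]
  obtain cs where cs: "distinct cs" "vertex_cover {..<n} E (set cs)" "s2 vK 0 = length cs"
    "\<forall>z<length cs. s2 vC z = cs ! z" "\<forall>v<n. 0 < s2 vINC v \<longleftrightarrow> v \<in> set cs"
    using c(1) by (auto simp: cover_found_def)
  interpret enumerated_cover n E "set cs" "length cs" "(!) cs"
    by unfold_locales (use G cs in \<open>auto intro: bij_betw_nth\<close>)
  have "graph_store n E s3" by (rule graph_store_cong[OF r(1)]) (simp_all add: s3 s2)
  then have "dp_store s3"
    using r(2) cs(3-5) c(3) by (simp add: dp_store_def s3 s2, simp add: s3_def upd_apply)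
  moreover have "s3 vST v = 0" for v using 0 by (simp add: s3 s2)
  ultimately have "pathwidth {..<n} E = int (sem solve s3 vOUT 0)"
    using dynamic_program_correct[OF n] by (simp add: solve_def)
  then show ?thesis
    by (simp add: pathwidth_cmd_def s3_def s2_def s1_def upd_apply)
qed

lemma round_bound:
  fixes a r x :: nat
  assumes "1 \<le> x" "2 \<le> r"
  shows "2 + r * (4 + a * x) \<le> (a + 6) * (r * x)"
proof -
  have "r * 1 \<le> r * x" using assms(1) by (intro mult_left_mono) auto
  then have "2 + 4 * r \<le> 6 * (r * x)" using assms(2) by linarith
  then show ?thesis by (simp add: algebra_simps)
qed

lemma steps_pathwidth_cmd:
  obtains c d where "\<And>n E. simple_graph {..<n} E \<Longrightarrow>
    steps pathwidth_cmd (input_store n E) \<le> c * ((n + 2) ^ d * 3 ^ vertex_cover_number {..<n} E)"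
proof
  let ?X = "{vL, vL2}"
  let ?d1 = "depth (- ?X) setup_rows" and ?d2 = "depth (- ?X) search_round" and ?d3 = "depth (- ?X) solve"
  let ?d = "?d1 + Suc ?d2 + ?d3"
  let ?c = "csize setup_rows + (csize search_round + 6) + csize solve + 2"
  fix n :: nat and E :: "nat set set"
  assume G: "simple_graph {..<n} E"
  let ?k = "vertex_cover_number {..<n} E"
  let ?R = "n + 2" and ?Q = "3 ^ ?k :: nat"
  define s where "s = input_store n E"
  define s1 where "s1 = sem setup_rows s"
  define s2 where "s2 = sem cover_search s1"
  define s3 where "s3 = upd s2 vL2 0 (s2 vPOW (s2 vK 0))"
  note r = sem_setup_rows[of n E, folded s_def, folded s1_def]
  have n: "s 0 0 = n" "s1 0 0 = n"
    using graph_store_size[OF r(1)] by (simp_all add: s_def input_store_def graph_input_def)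
  have FOUND: "s1 vFOUND 0 = 0" by (simp add: s1_def s_def sem_unwritten input_store_def)
  note c = sem_cover_search[OF G r(1) FOUND r(3,4,2), folded s2_def]
  have RQ: "1 \<le> ?R" "1 \<le> ?Q" by simp_all
  have "steps setup_rows s \<le> csize setup_rows * (?R ^ ?d1 * ?Q ^ depth ?X setup_rows)"
    by (rule steps_le[OF _ RQ]) (use n in \<open>auto simp: setup_rows_def\<close>)
  also have "depth ?X setup_rows = 0" by (simp add: setup_rows_def)
  finally have 1: "steps setup_rows s \<le> csize setup_rows * (?R ^ ?d1)" by simp
  \<comment> \<open>\<open>steps_le\<close> cannot be applied to the whole search, because
    \<open>vL\<close> changes from round to round. Each round is bounded by itself, with
    \<open>3 ^ i\<close> replaced by its largest value \<open>?Q\<close>.\<close>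
  have body: "steps search_body (iter vKA search_body s1 i) \<le> 2 + csize search_round * (?R ^ ?d2 * ?Q)"
    if "i < Suc n" for i
  proof -
    let ?s = "iter vKA search_body s1 i"
    have inv: "search_store n E i ?s"
      by (rule sem_cover_search_iter[OF G r(1) FOUND r(3,4)]) (use that r(2) in simp)
    show ?thesis
    proof (cases "?s vFOUND 0 = 0")
      case False
      then show ?thesis by (simp add: search_body_def)
    next
      case True
      then have L: "?s vL 0 = 3 ^ i" "i \<le> ?k" using inv by (auto simp: search_store_def)
      have "?s 0 = s1 0" by (rule iter_unwritten) auto
      moreover have "?s vKA 0 = i" by (rule iter_counter) simp
      moreover have "(3::nat) ^ i \<le> ?Q" using L(2) by (intro power_increasing) auto
      ultimately have "steps search_round ?s \<le>
          csize search_round * (?R ^ ?d2 * ?Q ^ depth ?X search_round)"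
        by (intro steps_le[OF _ RQ])
          (use that L n in \<open>auto simp: search_round_def tries_def try_cover_def clear_cover_def
            consider_edge_def increment_def\<close>)
      \<comment> \<open>No loop with limit \<open>vL\<close> contains another, so a round
        contributes a single exponential factor.\<close>
      also have "depth ?X search_round = 1"
        by (simp add: search_round_def tries_def try_cover_def clear_cover_def
            consider_edge_def increment_def)
      finally show ?thesis using True by (simp add: search_body_def)
    qed
  qed
  have "steps cover_search s1 \<le> 2 + s1 vN1 0 * (2 + csize search_round * (?R ^ ?d2 * ?Q) + 2)"
    unfolding cover_search_def by (rule steps_For_le) (use body r(2) in simp)
  also have "\<dots> = 2 + Suc n * (2 + csize search_round * (?R ^ ?d2 * ?Q) + 2)"
    by (simp only: r(2))
  also have "\<dots> \<le> 2 + ?R * (4 + csize search_round * (?R ^ ?d2 * ?Q))"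
    by (intro add_left_mono mult_mono) auto
  also have "\<dots> \<le> (csize search_round + 6) * (?R ^ Suc ?d2 * ?Q)"
  proof -
    have x: "1 * 1 \<le> ?R ^ ?d2 * ?Q" by (intro mult_mono) auto
    have "2 + ?R * (4 + csize search_round * (?R ^ ?d2 * ?Q)) \<le>
        (csize search_round + 6) * (?R * (?R ^ ?d2 * ?Q))"
      by (rule round_bound) (use x in simp_all)
    then show ?thesis by (simp only: power_Suc mult.assoc)
  qed
  finally have 2: "steps cover_search s1 \<le> (csize search_round + 6) * (?R ^ Suc ?d2 * ?Q)" .
  have "s3 0 = s 0" by (simp add: s3_def s2_def s1_def upd_apply sem_unwritten)
  moreover have "s3 vK 0 = s2 vK 0" "s3 vL2 0 = s2 vPOW (s2 vK 0)" "s3 vN1 0 = Suc n"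
    using r(2) by (simp_all add: s3_def s2_def upd_apply sem_unwritten)
  moreover have "s2 vPOW (s2 vK 0) \<le> ?Q" using c(2,3) by (auto intro: power_increasing)
  moreover have "s2 vK 0 \<le> n" using c(2) vertex_cover_number_le_order[OF G] by simp
  ultimately have "steps solve s3 \<le> csize solve * (?R ^ ?d3 * ?Q ^ depth ?X solve)"
    by (intro steps_le[OF _ RQ])
      (use n in \<open>auto simp: solve_def initialise_def dynamic_program_def transitions_def transition_def
        load_status_def member_def scan_neighbours_def chain_cost_def chain_member_def
        count_boundary_def scan_outside_def increment_def\<close>)
  also have "depth ?X solve = 1"
    by (simp add: solve_def initialise_def dynamic_program_def transitions_def transition_def
        load_status_def member_def scan_neighbours_def chain_cost_def chain_member_def
        count_boundary_def scan_outside_def increment_def)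
  finally have 3: "steps solve s3 \<le> csize solve * (?R ^ ?d3 * ?Q)" by simp
  let ?B = "?R ^ ?d * ?Q"
  have "?R ^ ?d1 * 1 \<le> ?B" "?R ^ Suc ?d2 * ?Q \<le> ?B" "?R ^ ?d3 * ?Q \<le> ?B"
    by (intro mult_mono power_increasing; simp)+
  then have "csize setup_rows * (?R ^ ?d1) \<le> csize setup_rows * ?B"
    "(csize search_round + 6) * (?R ^ Suc ?d2 * ?Q) \<le> (csize search_round + 6) * ?B"
    "csize solve * (?R ^ ?d3 * ?Q) \<le> csize solve * ?B"
    by (intro mult_left_mono; simp)+
  moreover have "1 * 1 \<le> ?B" by (intro mult_mono one_le_power) simp_all
  moreover have "steps pathwidth_cmd s = steps setup_rows s + (steps cover_search s1 + (1 + (steps solve s3 + 1)))"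
    by (simp add: pathwidth_cmd_def s3_def s2_def s1_def)
  ultimately have "steps pathwidth_cmd s \<le> csize setup_rows * ?B + (csize search_round + 6) * ?B +
      csize solve * ?B + 2 * ?B"
    using 1 2 3 by linarith
  also have "\<dots> = ?c * ?B" by (simp only: distrib_right)
  finally show "steps pathwidth_cmd (input_store n E) \<le> ?c * (?R ^ ?d * ?Q)" unfolding s_def .
qed

lemma well_formed_pathwidth_cmd: "well_formed pathwidth_cmd"
  by (simp add: pathwidth_cmd_def setup_rows_def cover_search_def search_body_def search_round_def
      tries_def try_cover_def clear_cover_def consider_edge_def adj_def solve_def initialise_def
      dynamic_program_def transitions_def transition_def load_status_def member_def
      scan_neighbours_def chain_cost_def chain_member_def count_boundary_def scan_outside_def
      increment_def)

lemma pathwidth_empty: "pathwidth ({} :: nat set) {} = - 1"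
proof -
  have width: "decomposition_width I X = - 1" if "path_decomposition ({} :: nat set) {} I F X"
    for I :: "nat set" and F X
  proof -
    have "I \<noteq> {}" "\<And>i. i \<in> I \<Longrightarrow> X i = {}"
      using that by (auto simp: path_decomposition_def tree_decomposition_def is_path_graph_def)
    then have "(\<lambda>i. int (card (X i))) ` I = {0}" by auto
    then show ?thesis by (simp add: decomposition_width_def)
  qed
  have ex: "path_decomposition ({} :: nat set) {} {..<1::nat} (path_edges 1) (\<lambda>_. {})"
    using path_edges_is_tree[of 1] path_edges_is_path[of 1]
    by (simp add: path_decomposition_def tree_decomposition_def)
  show ?thesis
    unfolding pathwidth_def
  proof (rule Least_equality)
    show "\<exists>(I :: nat set) F X. path_decomposition ({} :: nat set) {} I F X \<and> - 1 = decomposition_width I X"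
      using ex width[OF ex] by (intro exI conjI) auto
  qed (use width in force)
qed

text \<open>The loop language knows only natural numbers, so the value -1 for the graph without
  vertices is written by a separate machine instruction.\<close>

definition pathwidth_program :: program where
  "pathwidth_program =
     IfPos (Load (Const 0)) (compile pathwidth_cmd) (Store (Const 0) (Const (- 1)))"

lemma pathwidth_program_correct:
  assumes G: "simple_graph {..<n} E"
  defines "N \<equiv> steps pathwidth_cmd (input_store n E)"
  assumes B: "n + 1 + cgrowth pathwidth_cmd * N \<le> B"
  shows "\<exists>t m. exec pathwidth_program (graph_input n E) t m \<and> m 0 = pathwidth {..<n} E \<and>
    t \<le> (1 + N) * (pweight pathwidth_program * wordlen B)"
proof -
  let ?m = "graph_input n E" and ?e = "Load (Const 0)"
  have bB: "bounded ?m B" by (rule bounded_mono[OF bounded_input]) (use B in simp)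
  have v: "val ?e ?m = int n" by (simp add: graph_input_def)
  have w: "expr_cost ?e ?m + len (val ?e ?m) \<le> weight1 ?e * wordlen B" by (rule weight1_le[OF bB])
  show ?thesis
  proof (cases "n = 0")
    case False
    obtain t m where 1: "exec (compile pathwidth_cmd) ?m t m"
      "represents m (sem pathwidth_cmd (input_store n E))"
      "t \<le> N * (pweight (compile pathwidth_cmd) * wordlen B)"
      using compile_correct[OF well_formed_pathwidth_cmd represents_input bounded_input B[unfolded N_def]]
      unfolding N_def by blast
    have "m (address 0 0) = int (sem pathwidth_cmd (input_store n E) 0 0)"
      using 1(2) unfolding represents_def by blast
    then have "m 0 = int (sem pathwidth_cmd (input_store n E) 0 0)" by (simp add: address_def)
    then have "m 0 = pathwidth {..<n} E" using sem_pathwidth_cmd[OF G] False by simp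
    moreover have "exec pathwidth_program ?m (expr_cost ?e ?m + len (val ?e ?m) + t) m"
      unfolding pathwidth_program_def by (rule exec.IfTrue) (use v False 1 in simp_all)
    moreover have "expr_cost ?e ?m + len (val ?e ?m) + t \<le>
        (1 + N) * (pweight pathwidth_program * wordlen B)"
      using w 1(3) by (simp add: pathwidth_program_def algebra_simps del: expr_cost.simps val.simps)
    ultimately show ?thesis by blast
  next
    case True
    obtain t where t: "exec (Store (Const 0) (Const (- 1))) ?m t
        (?m(val (Const 0) ?m := val (Const (- 1)) ?m))"
      "t \<le> pweight (Store (Const 0) (Const (- 1))) * wordlen B"
      using exec_Store[OF bB] by blast
    have "E = {}" using G True by (auto simp: simple_graph_def)
    have "exec pathwidth_program ?m (expr_cost ?e ?m + len (val ?e ?m) + t)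
        (?m(val (Const 0) ?m := val (Const (- 1)) ?m))"
      unfolding pathwidth_program_def by (rule exec.IfFalse) (use v True t in simp_all)
    moreover have "expr_cost ?e ?m + len (val ?e ?m) + t \<le>
        (1 + N) * (pweight pathwidth_program * wordlen B)"
      using w t(2) by (simp add: pathwidth_program_def algebra_simps del: expr_cost.simps val.simps)
    moreover have "(?m(val (Const 0) ?m := val (Const (- 1)) ?m)) 0 = pathwidth {..<n} E"
      using True \<open>E = {}\<close> pathwidth_empty by simp
    ultimately show ?thesis by blast
  qed
qed

text \<open>Each factor is at most a power of 2 with exponent linear in \<open>n\<close>, using
  \<open>x < 2 ^ x\<close> for \<open>g * c\<close> and \<open>n + 2\<close>, and 4 in place of
  3.\<close>

lemma wordlen_linear:
  "wordlen (n + 1 + g * (c * ((n + 2) ^ d * 3 ^ n))) \<le> (g * c + 2 * d + 4) * (n + 1)"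
proof -
  have "g * c * ((n + 2) ^ d * 3 ^ n) \<le> 2 ^ (g * c) * ((2 ^ (n + 2)) ^ d * 4 ^ n)"
    by (intro mult_mono power_mono less_imp_le[OF less_exp]) auto
  also have "\<dots> = 2 ^ (g * c + (n + 2) * d + 2 * n)"
  proof -
    have "(4::nat) ^ n = 2 ^ (2 * n)" by (simp add: power_mult)
    then show ?thesis by (simp only: power_add power_mult mult.assoc)
  qed
  finally have "g * (c * ((n + 2) ^ d * 3 ^ n)) \<le> 2 ^ (g * c + (n + 2) * d + 2 * n)"
    by (simp only: mult.assoc)
  also have "\<dots> \<le> 2 ^ (g * c + (n + 2) * d + 2 * n + (n + 2))" by (intro power_increasing) auto
  finally have 1: "g * (c * ((n + 2) ^ d * 3 ^ n)) \<le> 2 ^ (g * c + (n + 2) * d + 2 * n + (n + 2))" .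
  have "n + 2 < 2 ^ (n + 2)" by (rule less_exp)
  also have "(2::nat) ^ (n + 2) \<le> 2 ^ (g * c + (n + 2) * d + 2 * n + (n + 2))"
    by (intro power_increasing) auto
  finally have "n + 2 + g * (c * ((n + 2) ^ d * 3 ^ n)) < 2 * 2 ^ (g * c + (n + 2) * d + 2 * n + (n + 2))"
    using 1 by linarith
  then have "n + 1 + g * (c * ((n + 2) ^ d * 3 ^ n)) + 1 < 2 ^ Suc (g * c + (n + 2) * d + 2 * n + (n + 2))"
    by simp
  then have "floorlog 2 (n + 1 + g * (c * ((n + 2) ^ d * 3 ^ n)) + 1) \<le>
      Suc (g * c + (n + 2) * d + 2 * n + (n + 2))"
    by (rule floorlog_le)
  then have "wordlen (n + 1 + g * (c * ((n + 2) ^ d * 3 ^ n))) \<le> g * c + (n + 2) * d + 3 * n + 4"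
    by (simp add: wordlen_def)
  also have "\<dots> \<le> (g * c + 2 * d + 4) * (n + 1)"
    by (simp add: algebra_simps)
  finally show ?thesis .
qed

theorem theorem3:
  shows "\<exists>(P :: program) (T :: nat \<Rightarrow> nat \<Rightarrow> real).
    T \<in> Ostar (\<lambda>n k. 3 ^ k) \<and>
    (\<forall>(n :: nat) (E :: nat set set). simple_graph {..<n} E \<longrightarrow>
      (\<exists>t m. exec P (graph_input n E) t m \<and>
             m 0 = pathwidth {..<n} E \<and>
             real t \<le> T n (vertex_cover_number {..<n} E)))"
proof -
  obtain c d where cd: "\<And>n E. simple_graph {..<n} E \<Longrightarrow>
    steps pathwidth_cmd (input_store n E) \<le> c * ((n + 2) ^ d * 3 ^ vertex_cover_number {..<n} E)"
    using steps_pathwidth_cmd by blast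
  let ?g = "cgrowth pathwidth_cmd" and ?p = "pweight pathwidth_program"
  define S where "S n k = c * ((n + 2) ^ d * 3 ^ k)" for n k :: nat
  \<comment> \<open>As the cover number is at most \<open>n\<close>, \<open>S n n\<close> bounds the
    steps in terms of \<open>n\<close> alone. The word length is then linear in \<open>n\<close> and
    contributes only a polynomial factor.\<close>
  define B where "B n = n + 1 + ?g * S n n" for n
  define T where "T n k = (1 + S n k) * (?p * wordlen (B n))" for n k
  let ?C = "(1 + c) * 2 ^ d * ?p * (?g * c + 2 * d + 4)"
  have "T n k \<le> ?C * (3 ^ k * (n + 1) ^ (d + 1))" for n k
  proof -
    have "1 * 1 \<le> (n + 2) ^ d * (3::nat) ^ k" by (intro mult_mono) auto
    then have "1 + S n k \<le> (1 + c) * ((n + 2) ^ d * 3 ^ k)"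
      unfolding S_def distrib_right by linarith
    also have "\<dots> \<le> (1 + c) * ((2 * (n + 1)) ^ d * 3 ^ k)"
      by (intro mult_mono power_mono) auto
    finally have S: "1 + S n k \<le> (1 + c) * ((2 * (n + 1)) ^ d * 3 ^ k)" .
    have "wordlen (B n) \<le> (?g * c + 2 * d + 4) * (n + 1)"
      unfolding B_def S_def by (rule wordlen_linear)
    with S have "T n k \<le> (1 + c) * ((2 * (n + 1)) ^ d * 3 ^ k) * (?p * ((?g * c + 2 * d + 4) * (n + 1)))"
      unfolding T_def by (intro mult_mono) auto
    also have "\<dots> = ?C * (3 ^ k * (n + 1) ^ (d + 1))"
      unfolding power_mult_distrib power_add power_one_right by (simp only: ac_simps)
    finally show ?thesis .
  qed
  then have "real (T n k) \<le> real (?C * (3 ^ k * (n + 1) ^ (d + 1)))" for n k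
    by (rule of_nat_mono)
  then have "\<bar>real (T n k)\<bar> \<le> real ?C * (\<bar>3 ^ k\<bar> * real (n + 1) ^ (d + 1))" for n k
    by (simp only: of_nat_mult of_nat_power abs_of_nat abs_of_nonneg of_nat_numeral zero_le_power
        zero_le_numeral)
  then have "(\<lambda>n k. real (T n k)) \<in> Ostar (\<lambda>n k. 3 ^ k)"
    unfolding Ostar_def by blast
  moreover have "\<exists>t m. exec pathwidth_program (graph_input n E) t m \<and> m 0 = pathwidth {..<n} E \<and>
      real t \<le> real (T n (vertex_cover_number {..<n} E))" if G: "simple_graph {..<n} E" for n E
  proof -
    let ?k = "vertex_cover_number {..<n} E" and ?N = "steps pathwidth_cmd (input_store n E)"
    have N: "?N \<le> S n ?k" using cd[OF G] by (simp add: S_def)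
    have "S n ?k \<le> S n n"
      unfolding S_def using vertex_cover_number_le_order[OF G]
      by (intro mult_left_mono power_increasing) auto
    with N have "n + 1 + ?g * ?N \<le> B n" unfolding B_def by (intro add_left_mono mult_left_mono) auto
    from pathwidth_program_correct[OF G this] obtain t m
      where 1: "exec pathwidth_program (graph_input n E) t m" "m 0 = pathwidth {..<n} E"
        "t \<le> (1 + ?N) * (?p * wordlen (B n))" by blast
    note 1(3)
    also have "(1 + ?N) * (?p * wordlen (B n)) \<le> T n ?k"
      unfolding T_def using N by (intro mult_right_mono) auto
    finally show ?thesis using 1(1,2) by auto
  qed
  ultimately show ?thesis by blast
qed

end
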